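(* Let $K$ be a field and let $A=\bigoplus_{i=0}^d A_i$ be a standard graded Artinian Gorenstein algebra over $A_0=K$, where the characteristic of $K$ is zero or greater than $d$. Let $B$ be a $K$-subalgebra of $A$ generated by a subspace of $A_1$ such that $B_d=A_d\neq 0$. Then: (1) there exists a homogeneous irreducible ideal $\mathfrak{b}$ of $B$ such that $B/\mathfrak{b}$ is a Gorenstein algebra with socle degree $d$; (2) a Macaulay dual generator of $B'=B/\mathfrak{b}$ is obtained from that of $A$ by substitution by linear forms; that is, for a Macaulay dual generator $F(x_1,\ldots,x_n)$ for $A$ there is a Macaulay dual generator $G(y_1,\ldots,y_m)$ for $B'$ which is obtained from $F$ by substitution by linear forms.
   Context: Standard graded means $A_0=K$ and $A=K[A_1]$, with $A_1$ finite-dimensional. $B$ is graded by $B_i=B\cap A_i$. The socle degree of a graded Artinian Gorenstein algebra is its largest degree with nonzero component. A proper ideal is irreducible if it is not the intersection of two strictly larger ideals. Let $R=K[x_1,\ldots,x_n]$ with all variables of degree $1$, and $R_d$ its homogeneous component of degree $d$. $R$ acts on itself by $f\circ F=f\left(\frac{\partial}{\partial x_1},\ldots,\frac{\partial}{\partial x_n}\right)F$. For $F\in R_d$ put $\mathrm{Ann}_R(F)=\{f\in R\mid f\circ F=0\}$. A homogeneous polynomial $F\in R_d$ is a Macaulay dual generator for a standard graded Artinian Gorenstein algebra $A$ of socle degree $d$ if $A\cong R/\mathrm{Ann}_R(F)$ as graded $K$-algebras (and similarly for $B'$ with the polynomial ring $K[y_1,\ldots,y_m]$). Given polynomials $F=F(x_1,\ldots,x_n)$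 and $G=G(y_1,\ldots,y_m)$ in independent sets of variables, $G$ is said to be obtained from $F$ by substitution by linear forms if there exists a full rank $m\times n$ matrix $M=(m_{ij})$ over $K$ such that $F(x_1,\ldots,x_n)=G(y_1,\ldots,y_m)$ after the substitution $(x_1\ x_2\ \cdots\ x_n)=(y_1\ y_2\ \cdots\ y_m)M$, i.e. $G(y_1,\ldots,y_m)=F\left(\sum_{i=1}^m m_{i1}y_i,\ldots,\sum_{i=1}^m m_{in}y_i\right)$. *)

theory Defs
  imports
    "HOL-Algebra.QuotRing"
    "HOL-Algebra.Generated_Rings"
    "HOL-Library.Poly_Mapping"
    "Jordan_Normal_Form.DL_Rank"
begin

section \<open>Graded algebras over a field\<close>

text \<open>
  The ground field \<open>K\<close> is a type \<open>'k\<close> of class \<open>field\<close>, used as the ring record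
  \<^term>\<open>class_ring\<close>. A graded algebra is an algebra record \<open>A\<close> together with the
  family \<open>gr\<close> of its homogeneous components.
\<close>

definition graded_algebra :: "('k::field, 'a) module \<Rightarrow> (nat \<Rightarrow> 'a set) \<Rightarrow> bool" where
  "graded_algebra A gr \<longleftrightarrow>
     algebra (class_ring :: 'k ring) A \<and>
     (\<forall>i. subspace (class_ring :: 'k ring) (gr i) A) \<and>
     \<one>\<^bsub>A\<^esub> \<in> gr 0 \<and>
     (\<forall>i j. \<forall>a\<in>gr i. \<forall>b\<in>gr j. a \<otimes>\<^bsub>A\<^esub> b \<in> gr (i + j)) \<and>
     (\<forall>a\<in>carrier A. \<exists>!f. (\<forall>i. f i \<in> gr i) \<and> finite {i. f i \<noteq> \<zero>\<^bsub>A\<^esub>} \<and>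
        a = (\<Oplus>\<^bsub>A\<^esub>i\<in>{i. f i \<noteq> \<zero>\<^bsub>A\<^esub>}. f i))"

definition scalars :: "('k::field, 'a) module \<Rightarrow> 'a set" where
  "scalars A = range (\<lambda>k. k \<odot>\<^bsub>A\<^esub> \<one>\<^bsub>A\<^esub>)"

text \<open>The subalgebra \<open>K[V]\<close> is the subring generated by \<open>K \<cdot> 1\<close> and \<open>V\<close>.\<close>

definition subalgebra_generated :: "('k::field, 'a) module \<Rightarrow> 'a set \<Rightarrow> 'a set" where
  "subalgebra_generated A V = generate_ring A (scalars A \<union> V)"

text \<open>\<open>A\<^sub>0 = K\<close> includes that \<open>K\<close> embeds into \<open>A\<close>, i.e. \<open>1 \<noteq> 0\<close> in \<open>A\<close>.\<close>

definition standard_graded :: "('k::field, 'a) module \<Rightarrow> (nat \<Rightarrow> 'a set) \<Rightarrow> bool" where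
  "standard_graded A gr \<longleftrightarrow>
     graded_algebra A gr \<and> \<one>\<^bsub>A\<^esub> \<noteq> \<zero>\<^bsub>A\<^esub> \<and> gr 0 = scalars A \<and>
     subalgebra_generated A (gr 1) = carrier A \<and>
     vectorspace.fin_dim (class_ring :: 'k ring) (A\<lparr>carrier := gr 1\<rparr>)"

definition artinian :: "('a, 'b) ring_scheme \<Rightarrow> bool" where
  "artinian R \<longleftrightarrow>
     (\<forall>I :: nat \<Rightarrow> 'a set. (\<forall>i. ideal (I i) R \<and> I (Suc i) \<subseteq> I i) \<longrightarrow>
        (\<exists>N. \<forall>i\<ge>N. I i = I N))"

text \<open>
  In a standard graded Artinian algebra the maximal ideal is the sum of the components of
  positive degree, so this is the annihilator of the maximal ideal. The algebra is Gorenstein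
  iff the socle is one-dimensional over the residue field \<open>K\<close>.
\<close>

definition socle :: "('k::field, 'a) module \<Rightarrow> (nat \<Rightarrow> 'a set) \<Rightarrow> 'a set" where
  "socle A gr = {a \<in> carrier A. \<forall>i>0. \<forall>x\<in>gr i. x \<otimes>\<^bsub>A\<^esub> a = \<zero>\<^bsub>A\<^esub>}"

definition artinian_gorenstein :: "('k::field, 'a) module \<Rightarrow> (nat \<Rightarrow> 'a set) \<Rightarrow> bool" where
  "artinian_gorenstein A gr \<longleftrightarrow>
     standard_graded A gr \<and> artinian A \<and>
     vectorspace.fin_dim (class_ring :: 'k ring) (A\<lparr>carrier := socle A gr\<rparr>) \<and>
     vectorspace.dim (class_ring :: 'k ring) (A\<lparr>carrier := socle A gr\<rparr>) = 1"

definition has_socle_degree :: "('k::field, 'a) module \<Rightarrow> (nat \<Rightarrow> 'a set) \<Rightarrow> nat \<Rightarrow> bool" where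
  "has_socle_degree A gr d \<longleftrightarrow> gr d \<noteq> {\<zero>\<^bsub>A\<^esub>} \<and> (\<forall>i>d. gr i = {\<zero>\<^bsub>A\<^esub>})"


section \<open>Ideals and quotients\<close>

definition homogeneous_ideal :: "'a set \<Rightarrow> ('k::field, 'a) module \<Rightarrow> (nat \<Rightarrow> 'a set) \<Rightarrow> bool" where
  "homogeneous_ideal I A gr \<longleftrightarrow> ideal I A \<and> I = genideal A (I \<inter> (\<Union>i. gr i))"

definition irreducible_ideal :: "'a set \<Rightarrow> ('a, 'b) ring_scheme \<Rightarrow> bool" where
  "irreducible_ideal I R \<longleftrightarrow> ideal I R \<and> I \<noteq> carrier R \<and>
     \<not> (\<exists>J L. ideal J R \<and> ideal L R \<and> I \<subset> J \<and> I \<subset> L \<and> I = J \<inter> L)"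

text \<open>The quotient ring \<^term>\<open>A Quot I\<close> with the induced scalar multiplication and grading.\<close>

definition quotient_algebra :: "('k::field, 'a) module \<Rightarrow> 'a set \<Rightarrow> ('k, 'a set) module" where
  "quotient_algebra A I =
     \<lparr>carrier = carrier (A Quot I), monoid.mult = monoid.mult (A Quot I), one = one (A Quot I),
      zero = zero (A Quot I), add = add (A Quot I),
      smult = (\<lambda>k S. \<Union>x\<in>S. I +>\<^bsub>A\<^esub> (k \<odot>\<^bsub>A\<^esub> x))\<rparr>"

definition quotient_grading ::
    "('k::field, 'a) module \<Rightarrow> (nat \<Rightarrow> 'a set) \<Rightarrow> 'a set \<Rightarrow> nat \<Rightarrow> 'a set set" where
  "quotient_grading A gr I i = (\<lambda>a. I +>\<^bsub>A\<^esub> a) ` gr i"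

definition gorenstein_quotient_ideal ::
    "'a set \<Rightarrow> ('k::field, 'a) module \<Rightarrow> (nat \<Rightarrow> 'a set) \<Rightarrow> nat \<Rightarrow> bool" where
  "gorenstein_quotient_ideal I A gr d \<longleftrightarrow>
     homogeneous_ideal I A gr \<and> irreducible_ideal I A \<and>
     artinian_gorenstein (quotient_algebra A I) (quotient_grading A gr I) \<and>
     has_socle_degree (quotient_algebra A I) (quotient_grading A gr I) d"

definition graded_algebra_iso ::
    "('k::field, 'a) module \<Rightarrow> (nat \<Rightarrow> 'a set) \<Rightarrow> ('k, 'b) module \<Rightarrow> (nat \<Rightarrow> 'b set) \<Rightarrow>
      ('a \<Rightarrow> 'b) set" where
  "graded_algebra_iso A gr B gr' =
     {h \<in> ring_iso A B. (\<forall>k. \<forall>a\<in>carrier A. h (k \<odot>\<^bsub>A\<^esub> a) = k \<odot>\<^bsub>B\<^esub> h a) \<and>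
        (\<forall>i. h ` gr i = gr' i)}"


section \<open>Polynomials and Macaulay dual generators\<close>

text \<open>
  Polynomials map exponent vectors to coefficients. The variables of a polynomial in \<open>n\<close>
  variables are indexed by \<open>0, \<dots>, n - 1\<close>.
\<close>

type_synonym 'k mpoly = "(nat \<Rightarrow>\<^sub>0 nat) \<Rightarrow>\<^sub>0 'k"

definition Const :: "'k::field \<Rightarrow> 'k mpoly" where
  "Const c = Poly_Mapping.single 0 c"

definition Var :: "nat \<Rightarrow> 'k::field mpoly" where
  "Var i = Poly_Mapping.single (Poly_Mapping.single i 1) 1"

definition poly_ring :: "nat \<Rightarrow> ('k::field, 'k mpoly) module" where
  "poly_ring n =
     \<lparr>carrier = {p. \<forall>a\<in>Poly_Mapping.keys p. Poly_Mapping.keys a \<subseteq> {..<n}},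
      monoid.mult = (*), one = 1, zero = 0, add = (+), smult = (\<lambda>c p. Const c * p)\<rparr>"

definition homogeneous_polys :: "nat \<Rightarrow> nat \<Rightarrow> 'k::field mpoly set" where
  "homogeneous_polys n d = {p \<in> carrier (poly_ring n).
     \<forall>a\<in>Poly_Mapping.keys p. (\<Sum>i\<in>Poly_Mapping.keys a. Poly_Mapping.lookup a i) = d}"

text \<open>
  Formal \<open>\<partial>/\<partial>x\<^sub>i\<close>. The truncated subtraction \<open>a - e\<^sub>i\<close> only differs from the true one
  if \<open>a\<^sub>i = 0\<close>, and then the coefficient vanishes.
\<close>

definition partial_deriv :: "nat \<Rightarrow> 'k::field mpoly \<Rightarrow> 'k mpoly" where
  "partial_deriv i p = (\<Sum>a\<in>Poly_Mapping.keys p.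
     Poly_Mapping.single (a - Poly_Mapping.single i 1)
       (of_nat (Poly_Mapping.lookup a i) * Poly_Mapping.lookup p a))"

text \<open>\<open>\<partial>\<^sup>a\<close>; partial derivatives commute, the order of composition is increasing in the index.\<close>

definition monomial_deriv :: "(nat \<Rightarrow>\<^sub>0 nat) \<Rightarrow> 'k::field mpoly \<Rightarrow> 'k mpoly" where
  "monomial_deriv a =
     fold (\<lambda>i. partial_deriv i ^^ Poly_Mapping.lookup a i)
       (sorted_list_of_set (Poly_Mapping.keys a))"

definition diff_action :: "'k::field mpoly \<Rightarrow> 'k mpoly \<Rightarrow> 'k mpoly" where
  "diff_action f F = (\<Sum>a\<in>Poly_Mapping.keys f.
     Const (Poly_Mapping.lookup f a) * monomial_deriv a F)"

definition Ann :: "nat \<Rightarrow> 'k::field mpoly \<Rightarrow> 'k mpoly set" where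
  "Ann n F = {f \<in> carrier (poly_ring n). diff_action f F = 0}"

definition macaulay_dual_generator ::
    "nat \<Rightarrow> nat \<Rightarrow> 'k::field mpoly \<Rightarrow> ('k, 'a) module \<Rightarrow> (nat \<Rightarrow> 'a set) \<Rightarrow> bool" where
  "macaulay_dual_generator n d F A gr \<longleftrightarrow>
     artinian_gorenstein A gr \<and> has_socle_degree A gr d \<and> F \<in> homogeneous_polys n d \<and>
     graded_algebra_iso A gr
       (quotient_algebra (poly_ring n) (Ann n F))
       (quotient_grading (poly_ring n) (homogeneous_polys n) (Ann n F)) \<noteq> {}"

definition substitute :: "(nat \<Rightarrow> 'k::field mpoly) \<Rightarrow> 'k mpoly \<Rightarrow> 'k mpoly" where
  "substitute \<sigma> F = (\<Sum>a\<in>Poly_Mapping.keys F.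
     Const (Poly_Mapping.lookup F a) *
       (\<Prod>j\<in>Poly_Mapping.keys a. \<sigma> j ^ Poly_Mapping.lookup a j))"

definition obtained_by_linear_substitution ::
    "nat \<Rightarrow> 'k::field mpoly \<Rightarrow> nat \<Rightarrow> 'k mpoly \<Rightarrow> bool" where
  "obtained_by_linear_substitution m G n F \<longleftrightarrow>
     (\<exists>M \<in> carrier_mat m n. vec_space.rank m M = min m n \<and>
        G = substitute (\<lambda>j. \<Sum>i<m. Const (M $$ (i, j)) * Var i) F)"

end

theory Submission
  imports Defs
begin

text \<open>
  Let \<open>v\<^sub>1, \<dots>, v\<^sub>m\<close> be a basis of \<open>V\<close> and let \<open>\<pi>\<close> map the polynomial ring \<open>S = K[y\<^sub>1, \<dots>, y\<^sub>m]\<close>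
  to \<open>A\<close> by \<open>y\<^sub>i \<mapsto> v\<^sub>i\<close>. Its image is \<open>B\<close>, and \<open>B \<inter> A\<^sub>i = \<pi>(S\<^sub>i)\<close>, so everything about \<open>B\<close> can be
  read off in \<open>S\<close>. The component \<open>A\<^sub>d = B\<^sub>d\<close> is the socle of \<open>A\<close>, a line, and the coordinate of
  \<open>\<pi>(s)\<close> on that line is a linear functional \<open>L\<close> on \<open>S\<close> that sees only the part of degree \<open>d\<close>
  (\<open>top_degree_coordinate\<close>). The radical \<open>I\<close> of the pairing \<open>(p, q) \<mapsto> L(pq)\<close> is a homogeneous ideal
  containing the kernel of \<open>\<pi>\<close>. The pairing on \<open>S/I\<close> is nondegenerate, which makes \<open>S/I\<close> Gorenstein
  of socle degree \<open>d\<close>: every element outside \<open>I\<close> has a multiple that is, modulo \<open>I\<close>, a nonzero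
  element of degree \<open>d\<close> (\<open>multiple_in_socle\<close>). The same fact shows that every ideal strictly above
  \<open>\<bb> = \<pi>(I)\<close> contains \<open>B\<^sub>d\<close>, whereas \<open>\<bb>\<close> does not; so \<open>\<bb>\<close> is irreducible and proves the first
  claim.

  For the second claim, \<open>\<bb>\<close> is the only ideal of this kind (\<open>gorenstein_kernel_unique\<close>). Given a dual
  generator \<open>F\<close> of \<open>A\<close>, lift the images of the \<open>v\<^sub>i\<close> under \<open>A \<cong> R/Ann(F)\<close> to linear forms \<open>l\<^sub>i\<close> in the
  \<open>x\<^sub>j\<close>, let \<open>M\<close> be the matrix of their coefficients and let \<open>G(y) = F(yM)\<close>. By the chain rule,
  \<open>s \<circ> G\<close> is obtained from \<open>s(l) \<circ> F\<close> by the same substitution. If \<open>s\<close> has degree \<open>d\<close>, both are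
  constants, hence equal, and they vanish exactly if \<open>\<pi>(s) = 0\<close>. So the functional that sends \<open>s\<close> to
  the constant term of \<open>s \<circ> G\<close> vanishes where \<open>L\<close> does, and has the same radical \<open>I\<close>. That radical is
  \<open>Ann(G)\<close>, and here the characteristic matters: the coefficient of \<open>y\<^sup>a\<close> in a polynomial is recovered
  from a constant term only up to the factor \<open>a!\<close> (\<open>Ann_eq_radical\<close>). Hence
  \<open>B/\<bb> \<cong> S/I = S/Ann(G)\<close>. The rows of \<open>M\<close> are independent because the \<open>v\<^sub>i\<close> are, so \<open>M\<close> has full rank.
\<close>

section \<open>Polynomial rings\<close>

lemma poly_ring_ops [simp]:
  "monoid.mult (poly_ring n) = (*)" "\<one>\<^bsub>poly_ring n\<^esub> = 1" "\<zero>\<^bsub>poly_ring n\<^esub> = 0"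
  "add (poly_ring n) = (+)" "c \<odot>\<^bsub>poly_ring n\<^esub> p = Const c * p"
  by (simp_all add: poly_ring_def)

lemma in_polys_iff: "p \<in> carrier (poly_ring n) \<longleftrightarrow> (\<forall>a\<in>Poly_Mapping.keys p. Poly_Mapping.keys a \<subseteq> {..<n})"
  by (simp add: poly_ring_def)

lemma keys_add_nat: "Poly_Mapping.keys (a + b) = Poly_Mapping.keys a \<union> Poly_Mapping.keys (b :: nat \<Rightarrow>\<^sub>0 nat)"
  by (auto simp: in_keys_iff lookup_add)

lemma Const_simps [simp]: "Const 0 = 0" "Const 1 = 1" "Const (c + c') = Const c + Const c'"
  "Const (c * c') = Const c * Const c'" "Const (- c) = - Const (c :: 'k::field)"
  by (simp_all add: Const_def single_add mult_single single_uminus)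

lemma lookup_Const_mult [simp]:
  "Poly_Mapping.lookup (Const c * p) a = c * Poly_Mapping.lookup p a"
  unfolding Const_def by (simp add: map.rep_eq when_def flip: mult_map_scale_conv_mult)

lemma polys_add [simp]: "p \<in> carrier (poly_ring n) \<Longrightarrow> q \<in> carrier (poly_ring n) \<Longrightarrow> p + q \<in> carrier (poly_ring n)"
  using keys_add[of p q] by (auto simp: in_polys_iff)

lemma polys_mult [simp]: "p \<in> carrier (poly_ring n) \<Longrightarrow> q \<in> carrier (poly_ring n) \<Longrightarrow> p * q \<in> carrier (poly_ring n)"
  unfolding in_polys_iff
proof
  fix x assume *: "\<forall>a\<in>Poly_Mapping.keys p. Poly_Mapping.keys a \<subseteq> {..<n}"
    "\<forall>a\<in>Poly_Mapping.keys q. Poly_Mapping.keys a \<subseteq> {..<n}" and "x \<in> Poly_Mapping.keys (p * q)"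
  then obtain a b where "x = a + b" "a \<in> Poly_Mapping.keys p" "b \<in> Poly_Mapping.keys q"
    using keys_mult[of p q] by auto
  then show "Poly_Mapping.keys x \<subseteq> {..<n}" using * by (simp add: keys_add_nat)
qed

lemma polys_single: "Poly_Mapping.keys a \<subseteq> {..<n} \<Longrightarrow> Poly_Mapping.single a c \<in> carrier (poly_ring n)"
  by (auto simp: in_polys_iff split: if_splits)

lemma polys_basic [simp]: "0 \<in> carrier (poly_ring n)" "1 \<in> carrier (poly_ring n)"
  "Const c \<in> carrier (poly_ring n)" "i < n \<Longrightarrow> Var i \<in> carrier (poly_ring n)"
  by (auto simp: in_polys_iff Const_def Var_def)

lemma polys_uminus [simp]: "p \<in> carrier (poly_ring n) \<Longrightarrow> - p \<in> carrier (poly_ring n)"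
  by (auto simp: in_polys_iff in_keys_iff)

lemma polys_diff [simp]: "p \<in> carrier (poly_ring n) \<Longrightarrow> q \<in> carrier (poly_ring n) \<Longrightarrow> p - q \<in> carrier (poly_ring n)"
  using polys_add[of p n "- q"] by simp

lemma polys_sum: "(\<And>i. i \<in> I \<Longrightarrow> f i \<in> carrier (poly_ring n)) \<Longrightarrow> sum f I \<in> carrier (poly_ring n)"
  by (induction I rule: infinite_finite_induct) auto

lemma sum_monomials: "(\<Sum>a\<in>Poly_Mapping.keys p. Poly_Mapping.single a (Poly_Mapping.lookup p a)) = p"
  by (rule poly_mapping_eqI)
     (auto simp: lookup_sum lookup_single when_def not_in_keys_iff_lookup_eq_zero)

definition mdeg :: "(nat \<Rightarrow>\<^sub>0 nat) \<Rightarrow> nat" where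
  "mdeg a = (\<Sum>i\<in>Poly_Mapping.keys a. Poly_Mapping.lookup a i)"

lemma mdeg_add [simp]: "mdeg (a + b) = mdeg a + mdeg b"
  unfolding mdeg_def by (rule setsum_keys_plus_distrib) auto

lemma mdeg_single [simp]: "mdeg (Poly_Mapping.single i k) = k"
  by (simp add: mdeg_def)

lemma mdeg_eq_0_iff [simp]: "mdeg a = 0 \<longleftrightarrow> a = 0"
  by (auto simp: mdeg_def in_keys_iff poly_mapping_eq_iff fun_eq_iff)

lemma mdeg_0 [simp]: "mdeg 0 = 0"
  by simp

lemma monomial_induct [consumes 1, case_names zero add]:
  assumes "Poly_Mapping.keys a \<subseteq> X" "P 0"
    and step: "\<And>i a. i \<in> X \<Longrightarrow> Poly_Mapping.keys a \<subseteq> X \<Longrightarrow> P a \<Longrightarrow> P (Poly_Mapping.single i 1 + a)"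
  shows "P (a :: nat \<Rightarrow>\<^sub>0 nat)"
  using assms(1)
proof (induction "mdeg a" arbitrary: a)
  case 0
  then show ?case using assms(2) by simp
next
  case (Suc k)
  then obtain i where i: "i \<in> Poly_Mapping.keys a" by (force simp: mdeg_def)
  let ?b = "a - Poly_Mapping.single i 1"
  have a: "a = Poly_Mapping.single i 1 + ?b"
    using i by (auto intro!: poly_mapping_eqI simp: lookup_add lookup_minus lookup_single in_keys_iff when_def)
  then have "mdeg a = 1 + mdeg ?b" by (metis mdeg_add mdeg_single)
  then have "k = mdeg ?b" using Suc.hyps(2) by simp
  moreover have "Poly_Mapping.keys ?b \<subseteq> X" using Suc.prems by (auto simp: in_keys_iff lookup_minus)
  ultimately have "P ?b" "Poly_Mapping.keys ?b \<subseteq> X" using Suc.hyps(1) by auto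
  then show ?case using step[of i ?b] i Suc.prems a by auto
qed

lemma single_add_monomial: "Poly_Mapping.single (Poly_Mapping.single i 1 + a) c = Var i * Poly_Mapping.single a c"
  by (simp add: Var_def mult_single)

text \<open>
  Identities between algebra homomorphisms, and the chain rule, are checked on constants and
  variables with this rule.
\<close>

lemma mpoly_induct [consumes 1, case_names Const Var add mult]:
  assumes "p \<in> carrier (poly_ring n)"
    and const: "\<And>c. P (Const c)" and var: "\<And>i. i < n \<Longrightarrow> P (Var i)"
    and add: "\<And>p q. p \<in> carrier (poly_ring n) \<Longrightarrow> q \<in> carrier (poly_ring n) \<Longrightarrow> P p \<Longrightarrow> P q \<Longrightarrow> P (p + q)"
    and mult: "\<And>p q. p \<in> carrier (poly_ring n) \<Longrightarrow> q \<in> carrier (poly_ring n) \<Longrightarrow> P p \<Longrightarrow> P q \<Longrightarrow> P (p * q)"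
  shows "P (p :: 'k::field mpoly)"
proof -
  have mono: "P (Poly_Mapping.single a c)" if "Poly_Mapping.keys a \<subseteq> {..<n}" for a c
    using that
  proof (induction a rule: monomial_induct)
    case zero
    then show ?case using const by (simp add: Const_def)
  next
    case (add i a)
    then show ?case
      unfolding single_add_monomial by (intro mult var polys_single) auto
  qed
  have "P (\<Sum>a\<in>X. Poly_Mapping.single a (Poly_Mapping.lookup p a))" if "finite X" "X \<subseteq> Poly_Mapping.keys p" for X
    using that
  proof (induction X rule: finite_induct)
    case empty
    show ?case using const[of 0] by simp
  next
    case (insert x F)
    then show ?case using assms(1)
      by (auto simp: in_polys_iff intro!: add mono polys_sum polys_single)
  qed
  from this[of "Poly_Mapping.keys p"] show ?thesis by (simp add: sum_monomials)
qed

section \<open>Homogeneous components\<close>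

lemma homogeneous_iff: "p \<in> homogeneous_polys n d \<longleftrightarrow>
    p \<in> carrier (poly_ring n) \<and> (\<forall>a\<in>Poly_Mapping.keys p. mdeg a = d)"
  by (simp add: homogeneous_polys_def mdeg_def)

definition hom_comp :: "nat \<Rightarrow> 'k::field mpoly \<Rightarrow> 'k mpoly" where
  "hom_comp k p = Poly_Mapping.mapp (\<lambda>a c. c when mdeg a = k) p"

lemma lookup_hom_comp: "Poly_Mapping.lookup (hom_comp k p) a = (Poly_Mapping.lookup p a when mdeg a = k)"
  by (auto simp: hom_comp_def lookup_mapp when_def in_keys_iff)

lemma hom_comp_linear [simp]:
  "hom_comp k 0 = 0" "hom_comp k (p + q) = hom_comp k p + hom_comp k q"
  "hom_comp k (p - q) = hom_comp k p - hom_comp k q"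
  "hom_comp k (Const c * p) = Const c * hom_comp k p"
  by (auto intro!: poly_mapping_eqI simp: lookup_hom_comp lookup_add lookup_minus when_def)

lemma hom_comp_sum: "hom_comp k (sum f I) = (\<Sum>i\<in>I. hom_comp k (f i))"
  by (induction I rule: infinite_finite_induct) auto

lemma hom_comp_single [simp]: 
  "hom_comp k (Poly_Mapping.single a c) = (Poly_Mapping.single a c when mdeg a = k)"
  by (auto intro!: poly_mapping_eqI simp: lookup_hom_comp lookup_single when_def)

lemma keys_hom_comp: "Poly_Mapping.keys (hom_comp k p) = {a \<in> Poly_Mapping.keys p. mdeg a = k}"
  by (auto simp: in_keys_iff lookup_hom_comp)

lemma hom_comp_homogeneous [simp]: "p \<in> carrier (poly_ring n) \<Longrightarrow> hom_comp k p \<in> homogeneous_polys n k"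
  by (auto simp: homogeneous_iff in_polys_iff keys_hom_comp)

lemma hom_comp_polys [simp]: "p \<in> carrier (poly_ring n) \<Longrightarrow> hom_comp k p \<in> carrier (poly_ring n)"
  by (auto simp: in_polys_iff keys_hom_comp)

lemma hom_comp_of_homogeneous: "p \<in> homogeneous_polys n d \<Longrightarrow> hom_comp k p = (p when k = d)"
  by (rule poly_mapping_eqI) (auto simp: lookup_hom_comp homogeneous_iff when_def in_keys_iff)

lemma homogeneous_polys [simp, dest]: "p \<in> homogeneous_polys n d \<Longrightarrow> p \<in> carrier (poly_ring n)"
  by (simp add: homogeneous_iff)

lemma hom_comp_eventually_0: obtains N where "\<And>k. k > N \<Longrightarrow> hom_comp k p = 0"
proof -
  obtain N where "\<forall>a\<in>Poly_Mapping.keys p. mdeg a \<le> N"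
    using finite_nat_set_iff_bounded_le[of "mdeg ` Poly_Mapping.keys p"] by auto
  then have "hom_comp k p = 0" if "k > N" for k
    using that by (intro poly_mapping_eqI) (force simp: lookup_hom_comp when_def in_keys_iff)
  then show ?thesis using that by blast
qed

lemma sum_hom_comp:
  assumes "\<And>k. k > N \<Longrightarrow> hom_comp k p = 0"
  shows "(\<Sum>k\<le>N. hom_comp k p) = p"
proof (rule poly_mapping_eqI)
  fix a
  have "Poly_Mapping.lookup p a = 0" if "mdeg a > N"
    using assms[OF that] lookup_hom_comp[of "mdeg a" p a] by simp
  then show "Poly_Mapping.lookup (\<Sum>k\<le>N. hom_comp k p) a = Poly_Mapping.lookup p a"
    by (auto simp: lookup_sum lookup_hom_comp when_def not_le)
qed

lemma homogeneous_linear [simp]: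
  "0 \<in> homogeneous_polys n d"
  "p \<in> homogeneous_polys n d \<Longrightarrow> q \<in> homogeneous_polys n d \<Longrightarrow> p + q \<in> homogeneous_polys n d"
  "p \<in> homogeneous_polys n d \<Longrightarrow> q \<in> homogeneous_polys n d \<Longrightarrow> p - q \<in> homogeneous_polys n d"
  "p \<in> homogeneous_polys n d \<Longrightarrow> Const c * p \<in> homogeneous_polys n d"
  using keys_add[of p q] keys_diff[of p q]
  by (auto simp: homogeneous_iff in_keys_iff lookup_minus lookup_add)

lemma homogeneous_sum: "(\<And>i. i \<in> I \<Longrightarrow> f i \<in> homogeneous_polys n d) \<Longrightarrow> sum f I \<in> homogeneous_polys n d"
  by (induction I rule: infinite_finite_induct) auto

lemma homogeneous_mult:
  "p \<in> homogeneous_polys n d \<Longrightarrow> q \<in> homogeneous_polys n e \<Longrightarrow> p * q \<in> homogeneous_polys n (d + e)"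
  using keys_mult[of p q] by (force simp: homogeneous_iff)

lemma homogeneous_basic [simp]: "1 \<in> homogeneous_polys n 0" "Const c \<in> homogeneous_polys n 0"
  "i < n \<Longrightarrow> Var i \<in> homogeneous_polys n 1" "i < n \<Longrightarrow> Var i \<in> homogeneous_polys n (Suc 0)"
  by (auto simp: homogeneous_iff) (auto simp: Const_def Var_def split: if_splits)

lemma homogeneous_0_iff: "p \<in> homogeneous_polys n 0 \<longleftrightarrow> (\<exists>c. p = Const c)"
proof
  assume p: "p \<in> homogeneous_polys n 0"
  have "p = Const (Poly_Mapping.lookup p 0)"
    using p by (intro poly_mapping_eqI) (auto simp: Const_def lookup_single when_def homogeneous_iff in_keys_iff)
  then show "\<exists>c. p = Const c" ..
qed auto

lemma homogeneous_1_eq: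
  assumes "p \<in> homogeneous_polys n 1"
  shows "p = (\<Sum>i<n. Const (Poly_Mapping.lookup p (Poly_Mapping.single i 1)) * Var i)"
proof (rule poly_mapping_eqI)
  fix a
  have eq: "Const c * Var i = Poly_Mapping.single (Poly_Mapping.single i 1) c" for c :: 'a and i
    by (simp add: Const_def Var_def mult_single)
  show "Poly_Mapping.lookup p a =
    Poly_Mapping.lookup (\<Sum>i<n. Const (Poly_Mapping.lookup p (Poly_Mapping.single i 1)) * Var i) a"
  proof (cases "\<exists>i<n. a = Poly_Mapping.single i 1")
    case True
    then obtain i where i: "i < n" "a = Poly_Mapping.single i 1" by auto
    have "(\<Sum>j<n. Poly_Mapping.lookup p (Poly_Mapping.single j 1) when Poly_Mapping.single j (1::nat) = a)
       = (\<Sum>j<n. if j = i then Poly_Mapping.lookup p a else 0)"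
      using i by (intro sum.cong) (auto simp: when_def dest!: arg_cong[where f=Poly_Mapping.keys])
    then show ?thesis using i by (simp add: eq lookup_sum lookup_single)
  next
    case False
    have "Poly_Mapping.lookup p a = 0"
    proof (rule ccontr)
      assume "Poly_Mapping.lookup p a \<noteq> 0"
      then have a: "mdeg a = 1" "Poly_Mapping.keys a \<subseteq> {..<n}"
        using assms by (auto simp: homogeneous_iff in_polys_iff in_keys_iff)
      then have "a \<noteq> 0" by (metis mdeg_eq_0_iff zero_neq_one)
      then obtain i where i: "i \<in> Poly_Mapping.keys a" by fastforce
      let ?b = "a - Poly_Mapping.single i 1"
      have b: "a = Poly_Mapping.single i 1 + ?b"
        using i by (auto intro!: poly_mapping_eqI simp: lookup_add lookup_minus lookup_single in_keys_iff when_def)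
      then have "mdeg a = 1 + mdeg ?b" by (metis mdeg_add mdeg_single)
      then have "a = Poly_Mapping.single i 1" using a b by simp
      then show False using False i a by auto
    qed
    moreover have "(\<Sum>j<n. Poly_Mapping.lookup p (Poly_Mapping.single j 1) when Poly_Mapping.single j (1::nat) = a) = 0"
      using False by (intro sum.neutral) (auto simp: when_def)
    ultimately show ?thesis by (simp add: eq lookup_sum lookup_single)
  qed
qed

text \<open>
  A product with a form of degree \<open>e\<close> has no component below degree \<open>e\<close>; the case distinction keeps
  the truncated \<open>k - e\<close> from producing the component of degree \<open>0\<close> there.
\<close>

lemma hom_comp_mult_homogeneous:
  assumes "q \<in> homogeneous_polys n e"
  shows "hom_comp k (p * q) = (hom_comp (k - e) p * q when e \<le> k)"
proof -
  have "hom_comp k (Poly_Mapping.single a c * q) =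
      (hom_comp (k - e) (Poly_Mapping.single a c) * q when e \<le> k)" for a c
  proof -
    have "hom_comp k (Poly_Mapping.single a c * q) =
      hom_comp k (\<Sum>b\<in>Poly_Mapping.keys q. Poly_Mapping.single a c * Poly_Mapping.single b (Poly_Mapping.lookup q b))"
      by (simp add: sum_monomials flip: sum_distrib_left)
    also have "\<dots> = (\<Sum>b\<in>Poly_Mapping.keys q. Poly_Mapping.single a c * Poly_Mapping.single b (Poly_Mapping.lookup q b) when mdeg a + e = k)"
      using assms by (auto simp: hom_comp_sum mult_single homogeneous_iff intro!: sum.cong)
    also have "\<dots> = (Poly_Mapping.single a c * q when mdeg a + e = k)"
      by (auto simp: when_def sum_monomials simp flip: sum_distrib_left)
    also have "\<dots> = (hom_comp (k - e) (Poly_Mapping.single a c) * q when e \<le> k)"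
      by (auto simp: when_def)
    finally show ?thesis .
  qed
  then have "(\<Sum>a\<in>Poly_Mapping.keys p. hom_comp k (Poly_Mapping.single a (Poly_Mapping.lookup p a) * q)) =
    (\<Sum>a\<in>Poly_Mapping.keys p. hom_comp (k - e) (Poly_Mapping.single a (Poly_Mapping.lookup p a)) * q when e \<le> k)"
    by (intro sum.cong refl)
  then show ?thesis 
    by (cases "e \<le> k") (simp_all add: sum_monomials del: hom_comp_single flip: hom_comp_sum sum_distrib_right)
qed

section \<open>Homomorphisms out of a polynomial ring\<close>

text \<open>
  The type of polynomials has variables of every index. The laws are required for polynomials in
  the first \<open>m\<close> variables, because the coset map of \<^term>\<open>poly_ring m\<close> takes values in the quotient there only.
\<close>

locale poly_hom = algebra "class_ring :: 'k::field ring" A for A :: "('k::field, 'a) module" (structure) +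
  fixes m :: nat and \<psi> :: "'k::field mpoly \<Rightarrow> 'a"
  assumes hom_closed [simp]: "p \<in> carrier (poly_ring m) \<Longrightarrow> \<psi> p \<in> carrier A"
    and hom_add: "p \<in> carrier (poly_ring m) \<Longrightarrow> q \<in> carrier (poly_ring m) \<Longrightarrow> \<psi> (p + q) = \<psi> p \<oplus> \<psi> q"
    and hom_mult: "p \<in> carrier (poly_ring m) \<Longrightarrow> q \<in> carrier (poly_ring m) \<Longrightarrow> \<psi> (p * q) = \<psi> p \<otimes> \<psi> q"
    and hom_Const: "\<psi> (Const c) = c \<odot> \<one>"
begin

lemma smult_in_carrier [simp]: "x \<in> carrier A \<Longrightarrow> c \<odot> x \<in> carrier A"
  by (rule smult_closed) auto

lemma hom_one: "\<psi> 1 = \<one>"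
  using hom_Const[of 1] smult_one[of \<one>] by simp

lemma hom_smult: "p \<in> carrier (poly_ring m) \<Longrightarrow> \<psi> (Const c * p) = c \<odot> \<psi> p"
  using smult_assoc2[of c \<one> "\<psi> p"] by (simp add: hom_mult hom_Const)

lemma hom_zero: "\<psi> 0 = \<zero>"
proof -
  have "\<psi> 0 \<oplus> \<psi> 0 = \<psi> 0" using hom_add[of 0 0] by simp
  then show ?thesis by simp
qed

lemma hom_uminus: assumes "p \<in> carrier (poly_ring m)" shows "\<psi> (- p) = \<ominus> \<psi> p"
proof -
  have "\<psi> (- p) \<oplus> \<psi> p = \<zero>" using assms hom_add[of "- p" p] by (simp add: hom_zero)
  then show ?thesis using assms by (simp add: minus_equality)
qed

lemma hom_diff: "p \<in> carrier (poly_ring m) \<Longrightarrow> q \<in> carrier (poly_ring m) \<Longrightarrow> \<psi> (p - q) = \<psi> p \<ominus> \<psi> q"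
  using hom_add[of p "- q"] by (simp add: hom_uminus minus_eq)

lemma hom_eq_iff: "p \<in> carrier (poly_ring m) \<Longrightarrow> q \<in> carrier (poly_ring m) \<Longrightarrow> \<psi> p = \<psi> q \<longleftrightarrow> \<psi> (p - q) = \<zero>"
  by (simp add: hom_diff)

lemma hom_sum:
  assumes "finite I" "\<And>i. i \<in> I \<Longrightarrow> f i \<in> carrier (poly_ring m)"
  shows "\<psi> (sum f I) = (\<Oplus>i\<in>I. \<psi> (f i))"
  using assms by (induction I rule: finite_induct) (auto simp: hom_zero hom_add polys_sum)

lemma range_subset_subalgebra_generated:
  assumes "p \<in> carrier (poly_ring m)" and "\<And>i. i < m \<Longrightarrow> \<psi> (Var i) \<in> V"
  shows "\<psi> p \<in> subalgebra_generated A V"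
  using assms(1)
proof (induction p rule: mpoly_induct)
  case (Const c)
  then show ?case by (auto simp: subalgebra_generated_def scalars_def hom_Const intro: generate_ring.incl)
next
  case (Var i)
  then show ?case by (auto simp: subalgebra_generated_def intro!: generate_ring.incl assms(2))
qed (auto simp: subalgebra_generated_def hom_add hom_mult intro: generate_ring.intros)

text \<open>
  An element of \<open>K[V]\<close> is thereby a value \<open>\<psi> p\<close>, and can be split into homogeneous components by
  splitting \<open>p\<close>.
\<close>

lemma range_eq_subalgebra_generated:
  assumes "\<And>i. i < m \<Longrightarrow> \<psi> (Var i) \<in> V" and "V \<subseteq> \<psi> ` carrier (poly_ring m)"
  shows "\<psi> ` carrier (poly_ring m) = subalgebra_generated A V"
proof
  show "\<psi> ` carrier (poly_ring m) \<subseteq> subalgebra_generated A V"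
    using range_subset_subalgebra_generated assms(1) by blast
  show "subalgebra_generated A V \<subseteq> \<psi> ` carrier (poly_ring m)"
  proof
    fix x assume "x \<in> subalgebra_generated A V"
    then show "x \<in> \<psi> ` carrier (poly_ring m)"
      unfolding subalgebra_generated_def
    proof (induction rule: generate_ring.induct)
      case one
      then show ?case using hom_one by (intro image_eqI[of _ _ 1]) simp_all
    next
      case (incl h)
      then show ?case using assms(2) hom_Const[symmetric] by (auto simp: scalars_def)
    next
      case (a_inv h)
      then show ?case using hom_uminus[symmetric] by auto
    next
      case (eng_add h1 h2)
      then show ?case using hom_add[symmetric] by auto
    next
      case (eng_mult h1 h2)
      then show ?case using hom_mult[symmetric] by auto
    qed
  qed
qed

end

lemma poly_hom_unique:
  assumes "poly_hom A m \<psi>" "poly_hom A m \<phi>" "\<And>i. i < m \<Longrightarrow> \<psi> (Var i) = \<phi> (Var i)"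
    and "p \<in> carrier (poly_ring m)"
  shows "\<psi> p = \<phi> p"
proof -
  interpret \<psi>: poly_hom A m \<psi> by fact
  interpret \<phi>: poly_hom A m \<phi> by fact
  show ?thesis using assms(4)
    by (induction p rule: mpoly_induct)
       (simp_all add: assms(3) \<psi>.hom_Const \<phi>.hom_Const \<psi>.hom_add \<phi>.hom_add \<psi>.hom_mult \<phi>.hom_mult)
qed

section \<open>Evaluation of polynomials in an algebra\<close>

lemma (in algebra) smult_mult_smult:
  assumes "c \<in> carrier R" "c' \<in> carrier R" "x \<in> carrier M" "y \<in> carrier M"
  shows "(c \<odot>\<^bsub>M\<^esub> x) \<otimes>\<^bsub>M\<^esub> (c' \<odot>\<^bsub>M\<^esub> y) = (c \<otimes> c') \<odot>\<^bsub>M\<^esub> (x \<otimes>\<^bsub>M\<^esub> y)"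
  using assms by (metis m_comm R.m_comm m_closed smult_assoc1 smult_assoc2 smult_closed)

text \<open>
  The product runs over all variables, including those with exponent \<open>0\<close>, so that the values of two
  monomials are products over the same index set and can be multiplied factor by factor.
\<close>

definition eval_poly :: "('k::field, 'a) module \<Rightarrow> nat \<Rightarrow> (nat \<Rightarrow> 'a) \<Rightarrow> 'k mpoly \<Rightarrow> 'a" where
  "eval_poly A m v p = (\<Oplus>\<^bsub>A\<^esub>a\<in>Poly_Mapping.keys p.
     Poly_Mapping.lookup p a \<odot>\<^bsub>A\<^esub> (\<Otimes>\<^bsub>A\<^esub>i\<in>{..<m}. v i [^]\<^bsub>A\<^esub> Poly_Mapping.lookup a i))"

text \<open>
  Multiplicativity is an identity between bilinear expressions. It therefore reduces to monomials,
  where it says that exponents add.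
\<close>

lemma poly_hom_eval_poly:
  fixes A :: "('k::field, 'a) module" (structure)
  assumes "algebra (class_ring :: 'k ring) A" and v: "\<And>i. i < m \<Longrightarrow> v i \<in> carrier A"
  shows "poly_hom A m (eval_poly A m v)" and "i < m \<Longrightarrow> eval_poly A m v (Var i) = v i"
proof -
  interpret algebra "class_ring :: 'k ring" A by fact
  have sm [simp]: "c \<odot> x \<in> carrier A" if "x \<in> carrier A" for c x using that by (auto intro: smult_closed)
  define \<mu> where "\<mu> a = (\<Otimes>i\<in>{..<m}. v i [^] Poly_Mapping.lookup a i)" for a :: "nat \<Rightarrow>\<^sub>0 nat"
  have \<mu>_closed [simp]: "\<mu> a \<in> carrier A" for a
    unfolding \<mu>_def by (intro finprod_closed Pi_I nat_pow_closed v) simp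
  have \<mu>_add: "\<mu> (a + b) = \<mu> a \<otimes> \<mu> b" for a b
  proof -
    have "\<mu> (a + b) = (\<Otimes>i\<in>{..<m}. v i [^] Poly_Mapping.lookup a i \<otimes> v i [^] Poly_Mapping.lookup b i)"
      unfolding \<mu>_def using v by (intro finprod_cong') (simp_all add: lookup_add nat_pow_mult)
    also have "\<dots> = \<mu> a \<otimes> \<mu> b"
      unfolding \<mu>_def using v by (intro finprod_multf) auto
    finally show ?thesis .
  qed
  have \<mu>_0: "\<mu> 0 = \<one>"
    unfolding \<mu>_def by (rule finprod_one_eqI) simp
  let ?e = "eval_poly A m v"
  have e: "?e p = (\<Oplus>a\<in>X. Poly_Mapping.lookup p a \<odot> \<mu> a)" if "finite X" "Poly_Mapping.keys p \<subseteq> X" for p X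
    unfolding eval_poly_def \<mu>_def[symmetric] using that
    by (intro M.add.finprod_mono_neutral_cong_left) (auto simp: in_keys_iff smult_l_null[simplified])
  have closed [simp]: "?e p \<in> carrier A" for p
    unfolding eval_poly_def \<mu>_def[symmetric] by (auto intro!: M.finsum_closed)
  have e_add: "?e (p + q) = ?e p \<oplus> ?e q" for p q
  proof -
    let ?X = "Poly_Mapping.keys p \<union> Poly_Mapping.keys q"
    have "?e (p + q) = (\<Oplus>a\<in>?X. Poly_Mapping.lookup p a \<odot> \<mu> a \<oplus> Poly_Mapping.lookup q a \<odot> \<mu> a)"
      by (subst e[of ?X]) (use keys_add[of p q] in \<open>auto simp: lookup_add smult_l_distr[simplified] intro!: M.finsum_cong'\<close>)
    also have "\<dots> = ?e p \<oplus> ?e q"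
      by (subst M.finsum_addf) (auto simp: e[of ?X])
    finally show ?thesis .
  qed
  have e_single: "?e (Poly_Mapping.single a c) = c \<odot> \<mu> a" for a c
    by (subst e[of "{a}"]) auto
  have e_sum: "?e (sum f X) = (\<Oplus>x\<in>X. ?e (f x))" if "finite X" for f and X :: "(nat \<Rightarrow>\<^sub>0 nat) set"
    using that by (induction X rule: finite_induct) (auto simp: e_add eval_poly_def[of A m v 0])
  have e_single_mult: "?e (Poly_Mapping.single a c * Poly_Mapping.single b c') =
      ?e (Poly_Mapping.single a c) \<otimes> ?e (Poly_Mapping.single b c')" for a b c c'
    using smult_mult_smult[of c c' "\<mu> a" "\<mu> b"] by (simp add: mult_single e_single \<mu>_add)
  have e_mult1: "?e (Poly_Mapping.single a c * q) = ?e (Poly_Mapping.single a c) \<otimes> ?e q" for a c q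
  proof -
    have "?e (Poly_Mapping.single a c * q) =
        ?e (\<Sum>b\<in>Poly_Mapping.keys q. Poly_Mapping.single a c * Poly_Mapping.single b (Poly_Mapping.lookup q b))"
      by (simp add: sum_monomials flip: sum_distrib_left)
    also have "\<dots> = (\<Oplus>b\<in>Poly_Mapping.keys q. ?e (Poly_Mapping.single a c) \<otimes> ?e (Poly_Mapping.single b (Poly_Mapping.lookup q b)))"
      by (simp add: e_sum e_single_mult)
    also have "\<dots> = ?e (Poly_Mapping.single a c) \<otimes> (\<Oplus>b\<in>Poly_Mapping.keys q. ?e (Poly_Mapping.single b (Poly_Mapping.lookup q b)))"
      by (subst finsum_rdistr) auto
    also have "\<dots> = ?e (Poly_Mapping.single a c) \<otimes> ?e q"
      by (simp add: sum_monomials flip: e_sum)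
    finally show ?thesis .
  qed
  have e_mult: "?e (p * q) = ?e p \<otimes> ?e q" for p q
  proof -
    have "?e (p * q) = ?e (\<Sum>a\<in>Poly_Mapping.keys p. Poly_Mapping.single a (Poly_Mapping.lookup p a) * q)"
      by (simp add: sum_monomials flip: sum_distrib_right)
    also have "\<dots> = (\<Oplus>a\<in>Poly_Mapping.keys p. ?e (Poly_Mapping.single a (Poly_Mapping.lookup p a)) \<otimes> ?e q)"
      by (simp add: e_sum e_mult1)
    also have "\<dots> = (\<Oplus>a\<in>Poly_Mapping.keys p. ?e (Poly_Mapping.single a (Poly_Mapping.lookup p a))) \<otimes> ?e q"
      by (subst finsum_ldistr) auto
    also have "\<dots> = ?e p \<otimes> ?e q"
      by (simp add: sum_monomials flip: e_sum)
    finally show ?thesis .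
  qed
  show "poly_hom A m ?e"
    by unfold_locales (simp_all add: e_add e_mult, simp add: Const_def e_single \<mu>_0)
  show "?e (Var i) = v i" if "i < m"
  proof -
    have "\<mu> (Poly_Mapping.single i 1) = (\<Otimes>j\<in>{..<m}. if i = j then v j else \<one>)"
      unfolding \<mu>_def using v by (intro finprod_cong') (auto simp: lookup_single when_def)
    also have "\<dots> = v i"
      using finprod_singleton[of i "{..<m}" v] v that by auto
    finally show ?thesis using v[OF that] smult_one[of "v i"] by (simp add: Var_def e_single)
  qed
qed

section \<open>Quotients, images and isomorphisms\<close>

lemma quotient_algebra_simps:
  "carrier (quotient_algebra A I) = (\<lambda>a. I +>\<^bsub>A\<^esub> a) ` carrier A"
  "monoid.mult (quotient_algebra A I) = rcoset_mult A I"
  "\<one>\<^bsub>quotient_algebra A I\<^esub> = I +>\<^bsub>A\<^esub> \<one>\<^bsub>A\<^esub>"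
  "\<zero>\<^bsub>quotient_algebra A I\<^esub> = I"
  "add (quotient_algebra A I) = set_add A"
  by (auto simp: quotient_algebra_def FactRing_def A_RCOSETS_def' a_r_coset_def)

locale quotient_alg = algebra "class_ring :: 'k::field ring" A + ideal I A
    for A :: "('k::field, 'a) module" (structure) and I
begin

lemma coset_eq_iff:
  assumes "x \<in> carrier A" "y \<in> carrier A"
  shows "I +> x = I +> y \<longleftrightarrow> x \<ominus> y \<in> I"
  using assms a_rcos_module[of y x] by (metis a_rcos_self a_repr_independence minus_eq is_abelian_group a_repr_independence')

lemma coset_zero_iff: "x \<in> carrier A \<Longrightarrow> I +> x = I \<longleftrightarrow> x \<in> I"
  using a_coset_join1 a_coset_join2 additive_subgroup_axioms by (metis a_rcos_const a_rcos_self)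

lemma coset_add: "x \<in> carrier A \<Longrightarrow> y \<in> carrier A \<Longrightarrow>
    (I +> x) \<oplus>\<^bsub>quotient_algebra A I\<^esub> (I +> y) = I +> (x \<oplus> y)"
  by (simp add: quotient_algebra_simps a_rcos_sum)

lemma coset_mult: "x \<in> carrier A \<Longrightarrow> y \<in> carrier A \<Longrightarrow>
    (I +> x) \<otimes>\<^bsub>quotient_algebra A I\<^esub> (I +> y) = I +> (x \<otimes> y)"
  by (simp add: quotient_algebra_simps rcoset_mult_add)

lemma ideal_smult: assumes "x \<in> I" shows "c \<odot> x \<in> I"
proof -
  have x: "x \<in> carrier A" using assms by (rule a_Hcarr)
  have "c \<odot> x = (c \<odot> \<one>) \<otimes> x" using x smult_assoc2[of c \<one> x] by simp
  moreover have "c \<odot> \<one> \<in> carrier A" by (rule smult_closed) auto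
  ultimately show ?thesis using assms I_l_closed by simp
qed

text \<open>
  The quotient defines \<open>k \<odot> (I +> x)\<close> as a union over the coset. All sets in this union agree since
  \<open>I\<close> is closed under scalars, by \<open>k \<odot> h = (k \<odot> 1) \<otimes> h\<close>.
\<close>

lemma coset_smult:
  assumes "x \<in> carrier A"
  shows "c \<odot>\<^bsub>quotient_algebra A I\<^esub> (I +> x) = I +> (c \<odot> x)"
proof -
  have cl: "c \<odot> y \<in> carrier A" if "y \<in> carrier A" for y using that by (auto intro: smult_closed)
  have same: "I +> (c \<odot> y) = I +> (c \<odot> x)" if yx: "y \<in> I +> x" for y
  proof -
    obtain h where h: "h \<in> I" "y = h \<oplus> x" using yx by (auto simp: a_r_coset_def r_coset_def)
    then have hc: "h \<in> carrier A" by (auto intro: a_Hcarr)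
    have "c \<odot> y = c \<odot> h \<oplus> c \<odot> x"
      using h(2) hc assms smult_r_distr[of c h x] by simp
    then have "c \<odot> y \<ominus> c \<odot> x = c \<odot> h"
      using cl[OF hc] cl[OF assms] by (simp add: M.minus_eq M.a_assoc M.r_neg)
    moreover have "y \<in> carrier A" using h(2) hc assms by simp
    ultimately show ?thesis using ideal_smult[OF h(1), of c] coset_eq_iff[OF cl cl] assms by metis
  qed
  have "(\<Union>y\<in>I +> x. I +> (c \<odot> y)) = (\<Union>y\<in>I +> x. I +> (c \<odot> x))"
    by (intro SUP_cong refl same)
  also have "\<dots> = I +> (c \<odot> x)"
    using a_rcos_self[OF assms] by (simp only: UN_constant) auto
  finally show ?thesis by (simp only: quotient_algebra_def module.simps)
qed

lemma algebra_quotient: "algebra (class_ring :: 'k ring) (quotient_algebra A I)"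
proof -
  let ?Q = "quotient_algebra A I"
  have cr: "cring (A Quot I)" by (rule quotient_is_cring) unfold_locales
  have cQ: "cring ?Q"
  proof -
    interpret Q: cring "A Quot I" by (rule cr)
    have [simp]: "carrier ?Q = carrier (A Quot I)" "monoid.mult ?Q = monoid.mult (A Quot I)" "one ?Q = one (A Quot I)"
      "zero ?Q = zero (A Quot I)" "add ?Q = add (A Quot I)"
      by (simp_all add: quotient_algebra_def)
    show ?thesis
    proof (intro cringI abelian_groupI comm_monoidI, goal_cases)
      case (6 x)
      then show ?case by (intro bexI[of _ "\<ominus>\<^bsub>A Quot I\<^esub> x"]) (simp_all add: Q.l_neg)
    next
      case (12 x y z)
      then show ?case by (simp add: Q.l_distr)
    qed (simp_all add: Q.a_ac Q.m_ac)
  qed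
  have cl [simp]: "c \<odot> y \<in> carrier A" if "y \<in> carrier A" for c y using that by (auto intro: smult_closed)
  show ?thesis
    by (rule algebraI[OF R_cring cQ])
       (auto simp: quotient_algebra_simps(1) coset_add coset_mult coset_smult smult_l_distr[simplified]
         smult_r_distr[simplified] smult_assoc1[simplified] smult_assoc2[simplified] smult_one[simplified])
qed

lemma poly_hom_quotient:
  assumes "poly_hom A m \<psi>"
  shows "poly_hom (quotient_algebra A I) m (\<lambda>p. I +> \<psi> p)"
proof -
  interpret h: poly_hom A m \<psi> by fact
  interpret Q: algebra "class_ring :: 'k ring" "quotient_algebra A I" by (rule algebra_quotient)
  show ?thesis
    by unfold_locales
       (auto simp: coset_add coset_mult coset_smult h.hom_add h.hom_mult h.hom_Const quotient_algebra_simps(1,3))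
qed

end

lemma (in poly_hom) poly_hom_image:
  "poly_hom (A\<lparr>carrier := \<psi> ` carrier (poly_ring m)\<rparr>) m \<psi>"
proof -
  let ?B = "A\<lparr>carrier := \<psi> ` carrier (poly_ring m)\<rparr>"
  have cB: "cring ?B"
  proof (intro cringI abelian_groupI comm_monoidI, goal_cases)
    case (6 x)
    then obtain p where "p \<in> carrier (poly_ring m)" "x = \<psi> p" by auto
    then show ?case by (auto intro!: bexI[of _ "- p"] simp: hom_uminus M.l_neg)
  next
    case 1 then show ?case by (auto simp flip: hom_add)
  next
    case 2 then show ?case using hom_zero by (auto intro!: image_eqI[of _ _ 0])
  next
    case 7 then show ?case by (auto simp flip: hom_mult)
  next
    case 8 then show ?case using hom_one by (auto intro!: image_eqI[of _ _ 1])
  qed (auto simp: M.a_assoc m_assoc l_distr intro: M.a_comm m_comm)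
  have "c \<odot> x \<in> \<psi> ` carrier (poly_ring m)" if "x \<in> \<psi> ` carrier (poly_ring m)" for c x
    using that by (auto simp flip: hom_smult)
  then have "algebra (class_ring :: 'k ring) ?B"
    by (intro algebraI[OF R_cring cB])
       (auto simp: smult_l_distr[simplified]
         smult_r_distr[simplified] smult_assoc1[simplified] smult_assoc2[simplified] smult_one[simplified])
  then interpret B: algebra "class_ring :: 'k ring" ?B .
  show ?thesis
    by unfold_locales (auto simp: hom_add hom_mult hom_Const)
qed

lemma algebra_poly_ring: "algebra (class_ring :: 'k::field ring) (poly_ring n)"
proof -
  have c: "cring (poly_ring n :: ('k, 'k mpoly) module)"
    by (intro cringI abelian_groupI comm_monoidI) (auto simp: algebra_simps intro: bexI[of _ "- _"])
  show ?thesis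
    by (rule algebraI[OF class_cring.is_cring c]) (auto simp: algebra_simps)
qed

lemma poly_hom_id: "poly_hom (poly_ring n) n id"
proof -
  interpret algebra "class_ring :: 'k::field ring" "poly_ring n" by (rule algebra_poly_ring)
  show "poly_hom (poly_ring n :: ('k, 'k mpoly) module) n id" by unfold_locales auto
qed

text \<open>
  Both algebras are \<open>K[y\<^sub>1, \<dots>, y\<^sub>m]\<close> modulo the same ideal: the isomorphism is \<open>\<psi> p \<mapsto> \<phi> p\<close>, which is
  well defined and injective by the two directions of the assumption on the kernels.
\<close>

lemma graded_algebra_iso_exists:
  fixes C :: "('k::field, 'b) module" and D :: "('k, 'c) module"
  assumes "poly_hom C m \<psi>" "poly_hom D m \<phi>"
    and surj: "\<psi> ` carrier (poly_ring m) = carrier C" "\<phi> ` carrier (poly_ring m) = carrier D"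
    and ker: "\<And>p. p \<in> carrier (poly_ring m) \<Longrightarrow> \<psi> p = \<zero>\<^bsub>C\<^esub> \<longleftrightarrow> \<phi> p = \<zero>\<^bsub>D\<^esub>"
    and grC: "\<And>i. grC i = \<psi> ` homogeneous_polys m i" and grD: "\<And>i. grD i = \<phi> ` homogeneous_polys m i"
  shows "graded_algebra_iso C grC D grD \<noteq> {}"
proof -
  interpret \<psi>: poly_hom C m \<psi> by fact
  interpret \<phi>: poly_hom D m \<phi> by fact
  let ?S = "carrier (poly_ring m) :: 'k mpoly set"
  have same: "\<psi> p = \<psi> q \<longleftrightarrow> \<phi> p = \<phi> q" if "p \<in> ?S" "q \<in> ?S" for p q
    using that ker[of "p - q"] by (simp add: \<psi>.hom_eq_iff \<phi>.hom_eq_iff)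
  define h where "h x = \<phi> (SOME p. p \<in> ?S \<and> \<psi> p = x)" for x
  have h: "h (\<psi> p) = \<phi> p" if "p \<in> ?S" for p
  proof -
    define q where "q = (SOME q. q \<in> ?S \<and> \<psi> q = \<psi> p)"
    have "q \<in> ?S \<and> \<psi> q = \<psi> p"
      unfolding q_def using that by (intro someI[of "\<lambda>q. q \<in> ?S \<and> \<psi> q = \<psi> p" p]) simp
    then show ?thesis using same[of q p] that unfolding h_def q_def by blast
  qed
  have "h \<in> ring_iso C D"
  proof (rule ring_iso_memI)
    show "bij_betw h (carrier C) (carrier D)"
      unfolding bij_betw_def inj_on_def surj[symmetric] using h same by (auto simp: image_iff)
  qed (use h \<psi>.hom_one \<phi>.hom_one h[of 1] in \<open>auto simp: surj[symmetric] \<phi>.hom_mult \<phi>.hom_add simp flip: \<psi>.hom_mult \<psi>.hom_add\<close>)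
  moreover have "h (k \<odot>\<^bsub>C\<^esub> a) = k \<odot>\<^bsub>D\<^esub> h a" if a: "a \<in> carrier C" for k a
  proof -
    obtain p where "p \<in> ?S" "a = \<psi> p" using a surj by auto
    then show ?thesis using h[of p] h[of "Const k * p"] by (simp add: \<psi>.hom_smult \<phi>.hom_smult)
  qed
  moreover have "h ` grC i = grD i" for i
    unfolding grC grD image_image using h by (intro image_cong) auto
  ultimately show ?thesis unfolding graded_algebra_iso_def by blast
qed

section \<open>Gradings\<close>

lemma graded_algebra_zero: "graded_algebra A gr \<Longrightarrow> \<zero>\<^bsub>A\<^esub> \<in> gr i"
  unfolding graded_algebra_def subspace_def submodule_def by blast

lemma graded_algebra_carrier: "graded_algebra A gr \<Longrightarrow> gr i \<subseteq> carrier A"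
  unfolding graded_algebra_def subspace_def submodule_def by blast

text \<open>
  The definition of a grading sums a family over its exact support. Two families are compared more
  easily over a common finite index set.
\<close>

lemma graded_algebra_finsum_unique:
  assumes "graded_algebra A gr" and "\<And>i. f i \<in> gr i" "\<And>i. g i \<in> gr i"
    and "finite X" "\<And>i. i \<notin> X \<Longrightarrow> f i = \<zero>\<^bsub>A\<^esub>" "\<And>i. i \<notin> X \<Longrightarrow> g i = \<zero>\<^bsub>A\<^esub>"
    and eq: "finsum A f X = finsum A g X"
  shows "f = g"
proof -
  interpret algebra "class_ring" A using assms(1) by (simp add: graded_algebra_def)
  have fg: "f i \<in> carrier A" "g i \<in> carrier A" for i using assms graded_algebra_carrier by blast+
  have *: "finite {i. e i \<noteq> \<zero>\<^bsub>A\<^esub>} \<and> finsum A e X = finsum A e {i. e i \<noteq> \<zero>\<^bsub>A\<^esub>}"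
    if "\<And>i. i \<notin> X \<Longrightarrow> e i = \<zero>\<^bsub>A\<^esub>" "\<And>i. e i \<in> carrier A" for e
  proof
    have sub: "{i. e i \<noteq> \<zero>\<^bsub>A\<^esub>} \<subseteq> X" using that by auto
    then show "finite {i. e i \<noteq> \<zero>\<^bsub>A\<^esub>}" using assms(4) finite_subset by blast
    show "finsum A e X = finsum A e {i. e i \<noteq> \<zero>\<^bsub>A\<^esub>}"
      using that sub assms(4) by (intro M.add.finprod_mono_neutral_cong_right) auto
  qed
  have "finsum A f X \<in> carrier A" using fg by (auto intro: M.finsum_closed)
  then have "\<exists>!e. (\<forall>i. e i \<in> gr i) \<and> finite {i. e i \<noteq> \<zero>\<^bsub>A\<^esub>} \<and>
        finsum A f X = (\<Oplus>\<^bsub>A\<^esub>i\<in>{i. e i \<noteq> \<zero>\<^bsub>A\<^esub>}. e i)"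
    using assms(1) unfolding graded_algebra_def by blast
  then have unique: "e = e'"
    if "(\<forall>i. e i \<in> gr i) \<and> finite {i. e i \<noteq> \<zero>\<^bsub>A\<^esub>} \<and> finsum A f X = (\<Oplus>\<^bsub>A\<^esub>i\<in>{i. e i \<noteq> \<zero>\<^bsub>A\<^esub>}. e i)"
      "(\<forall>i. e' i \<in> gr i) \<and> finite {i. e' i \<noteq> \<zero>\<^bsub>A\<^esub>} \<and> finsum A f X = (\<Oplus>\<^bsub>A\<^esub>i\<in>{i. e' i \<noteq> \<zero>\<^bsub>A\<^esub>}. e' i)"
    for e e'
    using that by blast
  show ?thesis
    using *[of f] *[of g] assms(2,3,5,6) fg eq by (intro unique conjI allI) auto
qed

text \<open>
  The components of \<open>s\<close> and the element \<open>\<psi> s\<close> alone give two decompositions of \<open>\<psi> s\<close>. For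
  \<open>\<psi> s = 0\<close> this yields homogeneity of the kernel; for \<open>\<psi> s\<close> in a component \<open>A\<^sub>j\<close> it yields that
  the elements of degree \<open>j\<close> in the image come from forms of degree \<open>j\<close>.
\<close>

lemma (in poly_hom) hom_component:
  assumes "graded_algebra A gr" "\<And>i. \<psi> ` homogeneous_polys m i \<subseteq> gr i"
    and s: "s \<in> carrier (poly_ring m)" "\<psi> s \<in> gr j"
  shows "\<psi> (hom_comp j s) = \<psi> s"
proof -
  obtain N where N: "\<And>k. k > N \<Longrightarrow> hom_comp k s = 0" using hom_comp_eventually_0[of s] by blast
  define f where "f i = \<psi> (hom_comp i s)" for i
  define g where "g i = (if i = j then \<psi> s else \<zero>)" for i
  have "\<psi> s = \<psi> (\<Sum>k\<le>max N j. hom_comp k s)"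
    using N by (subst sum_hom_comp) auto
  also have "\<dots> = finsum A f {..max N j}"
    using s by (simp add: hom_sum f_def[abs_def])
  finally have "finsum A f {..max N j} = \<psi> s" ..
  also have "\<dots> = finsum A g {..max N j}"
    using M.add.finprod_singleton[of j "{..max N j}" "\<lambda>_. \<psi> s"] s by (simp add: g_def[abs_def] eq_commute)
  finally have sums: "finsum A f {..max N j} = finsum A g {..max N j}" .
  have "\<psi> (hom_comp i s) \<in> gr i" for i
    using assms(2)[of i] hom_comp_homogeneous[OF s(1)] by blast
  then have "f = g"
    using sums s graded_algebra_zero[OF assms(1)] N
    by (intro graded_algebra_finsum_unique[OF assms(1), where X = "{..max N j}"])
       (auto simp: f_def g_def hom_zero)
  then show ?thesis by (simp add: f_def g_def fun_eq_iff split: if_splits)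
qed

lemma (in poly_hom) hom_component_zero:
  assumes "graded_algebra A gr" "\<And>i. \<psi> ` homogeneous_polys m i \<subseteq> gr i"
    and "s \<in> carrier (poly_ring m)" "\<psi> s = \<zero>"
  shows "\<psi> (hom_comp j s) = \<zero>"
  using hom_component[of gr s j] assms graded_algebra_zero[OF assms(1)] by simp

text \<open>
  With \<open>A\<close> a polynomial ring this also gives the degree of a substitution by linear forms.
\<close>

lemma (in poly_hom) hom_homogeneous:
  assumes sub: "\<And>i. subspace (class_ring :: 'k ring) (gr i) A" and one: "\<one> \<in> gr 0"
    and mult: "\<And>i j a b. a \<in> gr i \<Longrightarrow> b \<in> gr j \<Longrightarrow> a \<otimes> b \<in> gr (i + j)"
    and v: "\<And>i. i < m \<Longrightarrow> \<psi> (Var i) \<in> gr 1"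
  shows "\<psi> ` homogeneous_polys m i \<subseteq> gr i"
proof -
  have add: "x \<oplus> y \<in> gr i" if "x \<in> gr i" "y \<in> gr i" for x y i
    using sub[of i] that by (auto simp: subspace_def submodule_def)
  have sm: "c \<odot> y \<in> gr i" if "y \<in> gr i" for c y i
    using sub[of i] that by (auto simp: subspace_def submodule_def)
  have mono: "\<psi> (Poly_Mapping.single a c) \<in> gr (mdeg a)" if "Poly_Mapping.keys a \<subseteq> {..<m}" for a c
    using that
  proof (induction a rule: monomial_induct)
    case zero
    then show ?case using hom_Const[of c] sm[OF one, of c] by (simp add: Const_def)
  next
    case (add i a)
    have "\<psi> (Var i) \<otimes> \<psi> (Poly_Mapping.single a c) \<in> gr (1 + mdeg a)"
      using v[of i] add by (intro mult) auto
    then show ?case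
      unfolding single_add_monomial mdeg_add mdeg_single
      using add by (subst hom_mult) (auto intro: polys_single)
  qed
  have "\<psi> p \<in> gr i" if p: "p \<in> homogeneous_polys m i" for p
  proof -
    have "\<psi> (\<Sum>a\<in>X. Poly_Mapping.single a (Poly_Mapping.lookup p a)) \<in> gr i"
      if "finite X" "X \<subseteq> Poly_Mapping.keys p" for X
      using that
    proof (induction X rule: finite_induct)
      case empty
      show ?case using sub[of i] by (simp add: hom_zero subspace_def submodule_def)
    next
      case (insert x F)
      have keys: "Poly_Mapping.keys a \<subseteq> {..<m}" "mdeg a = i" if "a \<in> Poly_Mapping.keys p" for a
        using p that by (auto simp: in_polys_iff homogeneous_iff)
      have "\<psi> (Poly_Mapping.single x (Poly_Mapping.lookup p x) + (\<Sum>a\<in>F. Poly_Mapping.single a (Poly_Mapping.lookup p a))) =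
        \<psi> (Poly_Mapping.single x (Poly_Mapping.lookup p x)) \<oplus> \<psi> (\<Sum>a\<in>F. Poly_Mapping.single a (Poly_Mapping.lookup p a))"
        using insert.prems keys by (intro hom_add polys_sum polys_single) auto
      then show ?case using insert mono[of x] keys[of x] by (auto intro!: add)
    qed
    from this[of "Poly_Mapping.keys p"] show ?thesis by (simp add: sum_monomials)
  qed
  then show ?thesis by auto
qed

section \<open>Finite-dimensional subspaces\<close>

lemma algebra_vectorspace: "algebra (class_ring :: 'k::field ring) A \<Longrightarrow> vectorspace (class_ring :: 'k ring) A"
  by (intro vectorspace.intro class_field algebra.module)

lemma algebra_subspaceI:
  assumes "algebra (class_ring :: 'k::field ring) A" "W \<subseteq> carrier A" "\<zero>\<^bsub>A\<^esub> \<in> W"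
    "\<And>x y. x \<in> W \<Longrightarrow> y \<in> W \<Longrightarrow> x \<oplus>\<^bsub>A\<^esub> y \<in> W" "\<And>c x. x \<in> W \<Longrightarrow> c \<odot>\<^bsub>A\<^esub> x \<in> W"
  shows "subspace (class_ring :: 'k ring) W A"
  using assms by (intro subspace.intro LinearCombinations.submodule.intro algebra_vectorspace algebra.module) auto

lemma subspace_span_not_depend:
  assumes "subspace K W A" "S \<subseteq> W"
  shows "LinearCombinations.module.span K (A\<lparr>carrier := W\<rparr>) S = LinearCombinations.module.span K A S"
    and "LinearCombinations.module.lin_dep K (A\<lparr>carrier := W\<rparr>) S = LinearCombinations.module.lin_dep K A S"
proof -
  interpret vectorspace K A using assms(1) by (simp add: subspace_def)
  have sub: "LinearCombinations.submodule K W A" using assms(1) by (simp add: subspace_def)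
  show "LinearCombinations.module.span K (A\<lparr>carrier := W\<rparr>) S = span S"
    "LinearCombinations.module.lin_dep K (A\<lparr>carrier := W\<rparr>) S = lin_dep S"
    using span_li_not_depend[OF assms(2) sub] by auto
qed

lemma subspace_fin_dimI:
  assumes W: "subspace K W A" and S: "finite S" "S \<subseteq> W"
    and gen: "\<And>W'. subspace K W' A \<Longrightarrow> S \<subseteq> W' \<Longrightarrow> W \<subseteq> W'"
  shows "vectorspace.fin_dim K (A\<lparr>carrier := W\<rparr>)"
proof -
  interpret vectorspace K A using W by (simp add: subspace_def)
  have sub: "LinearCombinations.submodule K W A" using W by (simp add: subspace_def)
  interpret W: vectorspace K "A\<lparr>carrier := W\<rparr>" using W by (rule subspace_is_vs)
  have SA: "S \<subseteq> carrier A" using S(2) sub by (auto simp: LinearCombinations.submodule_def)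
  have "subspace K (span S) A"
    using span_is_submodule[OF SA] by (intro subspace.intro vectorspace_axioms)
  then have "W \<subseteq> span S" by (rule gen) (rule in_own_span[OF SA])
  moreover have "span S \<subseteq> W" by (rule span_is_subset[OF S(2) sub])
  ultimately show ?thesis
    unfolding W.fin_dim_def using S subspace_span_not_depend(1)[OF W S(2)] by (intro exI[of _ S]) auto
qed

lemma (in vectorspace) lin_indpt_singleton:
  assumes "w \<in> carrier V" "w \<noteq> \<zero>\<^bsub>V\<^esub>" shows "lin_indpt {w}"
proof (rule finite_lin_indpt2)
  fix a assume a: "a \<in> {w} \<rightarrow> carrier K" "lincomb a {w} = \<zero>\<^bsub>V\<^esub>"
  then have aw: "a w \<in> carrier K" "a w \<odot>\<^bsub>V\<^esub> w = \<zero>\<^bsub>V\<^esub>" using assms by (auto simp: lincomb_def)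
  have "a w = \<zero>\<^bsub>K\<^esub>"
  proof (rule ccontr)
    assume "a w \<noteq> \<zero>\<^bsub>K\<^esub>"
    then have inv: "inv\<^bsub>K\<^esub> a w \<in> carrier K" "inv\<^bsub>K\<^esub> a w \<otimes>\<^bsub>K\<^esub> a w = \<one>\<^bsub>K\<^esub>"
      using aw(1) by (simp_all add: field_Units)
    have "w = (inv\<^bsub>K\<^esub> a w \<otimes>\<^bsub>K\<^esub> a w) \<odot>\<^bsub>V\<^esub> w" using inv(2) assms(1) by simp
    also have "\<dots> = \<zero>\<^bsub>V\<^esub>" using inv(1) aw assms(1) by (simp add: smult_assoc1)
    finally show False using assms(2) by simp
  qed
  then show "\<forall>v\<in>{w}. a v = \<zero>\<^bsub>K\<^esub>" by simp
qed (use assms in auto)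

lemma subspace_dim_1I:
  assumes W: "subspace K W A" and w: "w \<in> W" "w \<noteq> \<zero>\<^bsub>A\<^esub>"
    and gen: "\<And>x. x \<in> W \<Longrightarrow> \<exists>k\<in>carrier K. x = k \<odot>\<^bsub>A\<^esub> w"
  shows "vectorspace.fin_dim K (A\<lparr>carrier := W\<rparr>)" "vectorspace.dim K (A\<lparr>carrier := W\<rparr>) = 1"
proof -
  interpret vectorspace K A using W by (simp add: subspace_def)
  interpret W: vectorspace K "A\<lparr>carrier := W\<rparr>" using W by (rule subspace_is_vs)
  have WA: "y \<in> carrier A" if "y \<in> W" for y
    using W that by (auto simp: subspace_def LinearCombinations.submodule_def)
  have "W.gen_set {w}"
  proof -
    have "x \<in> W.span {w}" if x: "x \<in> W" for x
    proof -
      obtain k where k: "k \<in> carrier K" "x = k \<odot>\<^bsub>A\<^esub> w" using gen[OF x] by blast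
      have "W.lincomb (\<lambda>_. k) {w} = x" using k w x WA[OF x] by (simp add: W.lincomb_def)
      then show ?thesis unfolding W.span_def using k by (auto intro!: exI[of _ "\<lambda>_. k"] exI[of _ "{w}"])
    qed
    then show ?thesis using w W.span_is_subset2[of "{w}"] by auto
  qed
  then have b: "W.basis {w}" using w W.lin_indpt_singleton[of w] by (auto simp: W.basis_def)
  then show "W.fin_dim" unfolding W.fin_dim_def W.basis_def by blast
  show "W.dim = 1" using W.dim_basis[OF _ b] by simp
qed

lemma subspace_dim_1D:
  assumes W: "subspace K W A" and "vectorspace.fin_dim K (A\<lparr>carrier := W\<rparr>)"
    "vectorspace.dim K (A\<lparr>carrier := W\<rparr>) = 1"
    and w: "w \<in> W" "w \<noteq> \<zero>\<^bsub>A\<^esub>" and x: "x \<in> W"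
  shows "\<exists>k\<in>carrier K. x = k \<odot>\<^bsub>A\<^esub> w"
proof -
  interpret vectorspace K A using W by (simp add: subspace_def)
  interpret W: vectorspace K "A\<lparr>carrier := W\<rparr>" using W by (rule subspace_is_vs)
  have WA: "y \<in> carrier A" if "y \<in> W" for y
    using W that by (auto simp: subspace_def LinearCombinations.submodule_def)
  have "W.basis {w}" using assms W.lin_indpt_singleton[of w] by (intro W.dim_li_is_basis) auto
  then have "x \<in> W.span {w}" using x by (auto simp: W.basis_def)
  then obtain a where a: "a \<in> {w} \<rightarrow> carrier K" "x = W.lincomb a {w}"
    using W.finite_in_span[of "{w}" x] w by auto
  then have "x = a w \<odot>\<^bsub>A\<^esub> w" using w W.smult_closed[of "a w" w] WA[of "a w \<odot>\<^bsub>A\<^esub> w"] by (simp add: W.lincomb_def)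
  then show ?thesis using a by auto
qed

text \<open>
  A maximal independent subset of \<open>V\<close> exists, since independent subsets of \<open>W\<close> have bounded size.
  The basis is indexed by \<open>{..<m}\<close> because its elements become the values of the variables.
\<close>

lemma subspace_basis:
  fixes A :: "('k::field, 'a) module" (structure)
  assumes alg: "algebra (class_ring :: 'k ring) A"
    and W: "subspace (class_ring :: 'k ring) W A" "vectorspace.fin_dim (class_ring :: 'k ring) (A\<lparr>carrier := W\<rparr>)"
    and V: "subspace (class_ring :: 'k ring) V A" "V \<subseteq> W"
  obtains m :: nat and v :: "nat \<Rightarrow> 'a" where "\<And>i. i < m \<Longrightarrow> v i \<in> V"
    "\<And>x. x \<in> V \<Longrightarrow> \<exists>c :: nat \<Rightarrow> 'k. x = (\<Oplus>i\<in>{..<m}. c i \<odot> v i)"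
    "\<And>(c :: nat \<Rightarrow> 'k) i. (\<Oplus>i\<in>{..<m}. c i \<odot> v i) = \<zero> \<Longrightarrow> i < m \<Longrightarrow> c i = 0"
proof -
  interpret A: vectorspace "class_ring :: 'k ring" A by (rule algebra_vectorspace[OF alg])
  interpret W: vectorspace "class_ring :: 'k ring" "A\<lparr>carrier := W\<rparr>" by (rule A.subspace_is_vs[OF W(1)])
  have WA: "W \<subseteq> carrier A" using W(1) by (auto simp: subspace_def LinearCombinations.submodule_def)
  have smult: "c \<odot> x \<in> carrier A" if "x \<in> carrier A" for c x using that by (auto intro: A.smult_closed)
  let ?P = "\<lambda>S. S \<subseteq> V \<and> A.lin_indpt S"
  have bound: "finite S \<and> card S \<le> W.dim" if "?P S" for S
  proof -
    have SW: "S \<subseteq> W" using that V(2) by blast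
    have "W.lin_indpt S" using subspace_span_not_depend(2)[OF W(1) SW] that by simp
    then show ?thesis using W.li_le_dim[OF W(2), of S] SW by simp
  qed
  have "?P {}" by (simp add: A.lin_dep_def)
  then obtain S where S: "maximal S ?P" using maximal_exists[of ?P W.dim "{}"] bound by blast
  then have SV: "S \<subseteq> V" "A.lin_indpt S" by (auto simp: maximal_def)
  have fin: "finite S" using bound SV by blast
  have SC: "S \<subseteq> carrier A" using SV V WA by blast
  have VS: "x \<in> A.span S" if x: "x \<in> V" for x
  proof (rule ccontr)
    assume nx: "x \<notin> A.span S"
    have "x \<notin> S" using nx A.in_own_span[OF SC] by blast
    then have "A.lin_indpt (S \<union> {x})"
      using A.lin_dep_iff_in_span[OF SC SV(2) _ \<open>x \<notin> S\<close>] nx x V(2) WA by blast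
    then have "S \<union> {x} = S" using S x SV(1) unfolding maximal_def by blast
    then show False using \<open>x \<notin> S\<close> by blast
  qed
  define m where "m = card S"
  obtain v where v: "bij_betw v {..<m} S"
    using ex_bij_betw_nat_finite[OF fin] unfolding m_def lessThan_atLeast0 by blast
  then have vS: "v ` {..<m} = S" and inj: "inj_on v {..<m}" by (auto simp: bij_betw_def)
  have reindex: "A.lincomb a S = (\<Oplus>i\<in>{..<m}. a (v i) \<odot> v i)" for a
    unfolding A.lincomb_def vS[symmetric]
    using vS SC smult by (intro A.add.finprod_reindex inj) auto
  show ?thesis
  proof (rule that)
    show "v i \<in> V" if "i < m" for i using that vS SV(1) by blast
    show "\<exists>c. x = (\<Oplus>i\<in>{..<m}. c i \<odot> v i)" if x: "x \<in> V" for x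
    proof -
      obtain a where "x = A.lincomb a S" using VS[OF x] A.finite_in_span[OF fin SC] by metis
      then show ?thesis using reindex by (intro exI[of _ "\<lambda>i. a (v i)"]) simp
    qed
    fix c :: "nat \<Rightarrow> 'k" and i assume c: "(\<Oplus>i\<in>{..<m}. c i \<odot> v i) = \<zero>" and i: "i < m"
    define a where "a s = c (inv_into {..<m} v s)" for s
    have av: "a (v i) = c i" if "i < m" for i using that inj by (simp add: a_def)
    have vC: "v j \<in> carrier A" if "j < m" for j using that vS SC by blast
    have "A.lincomb a S = (\<Oplus>i\<in>{..<m}. c i \<odot> v i)"
      unfolding reindex using av vC smult by (intro A.finsum_cong') auto
    then have "A.lincomb a S = \<zero>" using c by simp
    show "c i = 0"
    proof (rule ccontr)
      assume "c i \<noteq> 0"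
      then have "A.lin_dep S"
        unfolding A.lin_dep_def using fin \<open>A.lincomb a S = \<zero>\<close> i vS av[OF i]
        by (intro exI[of _ S] exI[of _ a] exI[of _ "v i"]) auto
      then show False using SV by blast
    qed
  qed
qed

text \<open>
  Induction on the set \<open>T\<close> of monomials. When a monomial \<open>a\<close> is added, either some \<open>U k\<close> has no
  element supported on \<open>insert a T\<close> that involves \<open>a\<close>, and then \<open>T\<close> decides from there on; or every
  \<open>U k\<close> has such an element, and subtracting a multiple of it removes \<open>a\<close> from any given element.
\<close>

lemma descending_subspaces_stabilize:
  fixes U :: "nat \<Rightarrow> 'k::field mpoly set"
  assumes "finite T" and decr: "\<And>k. U (Suc k) \<subseteq> U k"
    and diff: "\<And>k p q. p \<in> U k \<Longrightarrow> q \<in> U k \<Longrightarrow> p - q \<in> U k"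
    and smult: "\<And>k c p. p \<in> U k \<Longrightarrow> Const c * p \<in> U k"
  shows "\<exists>N. \<forall>k\<ge>N. U k \<inter> {p. Poly_Mapping.keys p \<subseteq> T} = U N \<inter> {p. Poly_Mapping.keys p \<subseteq> T}"
  using assms(1)
proof (induction T rule: finite_induct)
  case empty
  have zero: "0 \<in> U k" if "U k \<noteq> {}" for k using that diff[of _ k] by fastforce
  show ?case
  proof (cases "\<exists>N. U N = {}")
    case True
    then obtain N where "U N = {}" by blast
    moreover have "U k \<subseteq> U N" if "k \<ge> N" for k by (rule lift_Suc_antimono_le[of U, OF decr that])
    ultimately show ?thesis by (intro exI[of _ N]) auto
  next
    case False
    then show ?thesis using zero by auto
  qed
next
  case (insert a T)
  let ?W = "\<lambda>T. {p :: 'k mpoly. Poly_Mapping.keys p \<subseteq> T}"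
  have anti: "U k \<subseteq> U j" if "j \<le> k" for j k by (rule lift_Suc_antimono_le[of U, OF decr that])
  obtain N where N: "\<And>k. k \<ge> N \<Longrightarrow> U k \<inter> ?W T = U N \<inter> ?W T" using insert by blast
  show ?case
  proof (cases "\<exists>k. \<forall>p\<in>U k \<inter> ?W (insert a T). Poly_Mapping.lookup p a = 0")
    case True
    then obtain j where j: "\<And>p. p \<in> U j \<inter> ?W (insert a T) \<Longrightarrow> Poly_Mapping.lookup p a = 0" by blast
    have "U k \<inter> ?W (insert a T) = U k \<inter> ?W T" if "k \<ge> j" for k
    proof -
      have "a \<notin> Poly_Mapping.keys p" if "p \<in> U k \<inter> ?W (insert a T)" for p
        using j[of p] that anti[OF \<open>k \<ge> j\<close>] by (auto simp: in_keys_iff)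
      then show ?thesis by blast
    qed
    then have "U k \<inter> ?W (insert a T) = U (max j N) \<inter> ?W (insert a T)" if "k \<ge> max j N" for k
      using that N[of k] N[of "max j N"] by simp
    then show ?thesis by blast
  next
    case False
    have "U k \<inter> ?W (insert a T) = U N \<inter> ?W (insert a T)" if k: "k \<ge> N" for k
    proof
      show "U k \<inter> ?W (insert a T) \<subseteq> U N \<inter> ?W (insert a T)" using anti[OF k] by blast
      show "U N \<inter> ?W (insert a T) \<subseteq> U k \<inter> ?W (insert a T)"
      proof
        fix x assume x: "x \<in> U N \<inter> ?W (insert a T)"
        obtain p where p: "p \<in> U k" "p \<in> ?W (insert a T)" "Poly_Mapping.lookup p a \<noteq> 0" using False by blast
        define q where "q = Const (Poly_Mapping.lookup x a / Poly_Mapping.lookup p a) * p"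
        have q: "q \<in> U k" "Poly_Mapping.lookup q a = Poly_Mapping.lookup x a" "q \<in> ?W (insert a T)"
          using p smult by (auto simp: q_def in_keys_iff)
        have "x - q \<in> U N" using x q anti[OF k] diff by blast
        moreover have "x - q \<in> ?W T"
        proof -
          have "Poly_Mapping.keys (x - q) \<subseteq> insert a T" using keys_diff[of x q] x q by blast
          moreover have "a \<notin> Poly_Mapping.keys (x - q)" using q by (simp add: in_keys_iff lookup_minus)
          ultimately show ?thesis by blast
        qed
        ultimately have "x - q \<in> U k" using N[OF k] by blast
        moreover have "0 - q \<in> U k" using diff[OF diff[OF q(1) q(1)] q(1)] by simp
        ultimately have "(x - q) - (0 - q) \<in> U k" by (rule diff)
        then show "x \<in> U k \<inter> ?W (insert a T)" using x by simp
      qed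
    qed
    then show ?thesis by blast
  qed
qed

section \<open>Rank of a matrix with independent rows\<close>

text \<open>
  If the rank were smaller than the number of rows, fewer than \<open>n\<close> columns would span the column space.
  Written as rows and padded with zero rows they form a singular square matrix, and a vector in its
  kernel is orthogonal to all columns, contrary to the independence of the rows.
\<close>

lemma (in vec_space) rank_eq_rows_if_rows_independent:
  assumes M: "M \<in> carrier_mat n nc"
    and indep: "\<And>x. x \<in> carrier_vec n \<Longrightarrow> (\<And>j. j < nc \<Longrightarrow> (\<Sum>i<n. x $ i * M $$ (i, j)) = 0) \<Longrightarrow> x = 0\<^sub>v n"
  shows "rank M = n"
proof (rule ccontr)
  assume "rank M \<noteq> n"
  obtain S where S: "finite S" "maximal S (\<lambda>T. T \<subseteq> set (cols M) \<and> lin_indpt T)"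
    using maximal_exists_superset[of "set (cols M)" "\<lambda>T. T \<subseteq> set (cols M) \<and> lin_indpt T" "{}"]
    by (metis (no_types, lifting) List.finite_set empty_subsetI finite_lin_indpt2 empty_iff finite.emptyI)
  have SM: "S \<subseteq> set (cols M)" "lin_indpt S" using S(2) by (auto simp: maximal_def)
  have cM: "set (cols M) \<subseteq> carrier_vec n" using M cols_dim by blast
  have SC: "S \<subseteq> carrier_vec n" using SM cM by blast
  have "rank M = card S" by (rule rank_card_indpt[OF M S(2)])
  moreover have "card S \<le> n" using li_le_dim(2)[OF fin_dim] SC SM dim_is_n by auto
  ultimately have less: "card S < n" using \<open>rank M \<noteq> n\<close> by simp
  obtain vs where vs: "set vs = S" "length vs = card S" using S(1) finite_distinct_list distinct_card by metis
  \<comment> \<open>The chosen columns as rows, padded by zero rows to a square matrix.\<close>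
  define N where "N = mat_of_rows n (vs @ replicate (n - card S) (0\<^sub>v n))"
  have N: "N \<in> carrier_mat n n" using less vs by (auto simp: N_def)
  have "det N = 0"
  proof -
    have "(vs @ replicate (n - card S) (0\<^sub>v n)) ! (n - 1) = 0\<^sub>v n" using less vs(2) by (auto simp: nth_append)
    then have row: "row N (n - 1) = 0\<^sub>v n"
      unfolding N_def using less vs(2) by (subst mat_of_rows_row) auto
    have "N $$ (n - 1, j) = 0" if "j < n" for j
      using arg_cong[OF row, of "\<lambda>v. v $ j"] that N less by simp
    then have "mat\<^sub>r n n (\<lambda>i. if i = n - 1 then 0\<^sub>v n else row N i) = N"
      using N by (intro eq_matI) auto
    moreover have "det (mat\<^sub>r n n (\<lambda>i. if i = n - 1 then 0\<^sub>v n else row N i)) = 0"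
      using N less by (intro det_row_0) auto
    ultimately show ?thesis by simp
  qed
  then obtain x where x: "x \<in> carrier_vec n" "x \<noteq> 0\<^sub>v n" "N *\<^sub>v x = 0\<^sub>v n"
    using det_0_iff_vec_prod_zero[OF N] by blast
  have perp: "v \<bullet> x = 0" if "v \<in> S" for v
  proof -
    obtain i where i: "i < card S" "v = vs ! i" using \<open>v \<in> S\<close> vs by (metis in_set_conv_nth)
    have "(N *\<^sub>v x) $ i = row N i \<bullet> x" using N i less by (intro index_mult_mat_vec) auto
    moreover have "row N i = v"
    proof -
      have "(vs @ replicate (n - card S) (0\<^sub>v n)) ! i = v" using i vs(2) by (simp add: nth_append)
      moreover have "v \<in> carrier_vec n" using SC \<open>v \<in> S\<close> by blast
      ultimately show ?thesis unfolding N_def using i(1) vs(2) by (subst mat_of_rows_row) auto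
    qed
    ultimately show ?thesis using x(3) i less by simp
  qed
  let ?W = "{v \<in> carrier_vec n. v \<bullet> x = 0}"
  have "Module.module class_ring V" by (rule module_axioms)
  then have "LinearCombinations.submodule class_ring ?W V"
    using x by (intro LinearCombinations.submodule.intro)
      (auto simp: module_vec_simps add_scalar_prod_distrib[of _ n] smult_scalar_prod_distrib[of _ n])
  then have span: "span S \<subseteq> ?W" using perp SC by (intro span_is_subset) auto
  have cols_span: "c \<in> span S" if c: "c \<in> set (cols M)" for c
  proof (rule ccontr)
    assume nc: "c \<notin> span S"
    then have "c \<notin> S" using in_own_span[of S] SC by auto
    then have "lin_indpt (S \<union> {c})"
      using lin_dep_iff_in_span[of S c] SC SM c cM nc by auto
    then have "S \<union> {c} = S" using S(2) SM c unfolding maximal_def by blast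
    then show False using \<open>c \<notin> S\<close> by blast
  qed
  have "col M j \<bullet> x = 0" if "j < nc" for j
  proof -
    have "col M j \<in> set (cols M)" using that M by (auto simp: cols_def)
    then show ?thesis using cols_span span by blast
  qed
  then have "(\<Sum>i<n. x $ i * M $$ (i, j)) = 0" if "j < nc" for j
    using that x M by (force simp: scalar_prod_def mult.commute lessThan_atLeast0)
  then show False using indep[OF x(1)] x(2) by blast
qed

section \<open>Functionals of a single degree and their radical\<close>

text \<open>
  The model is the coordinate of the top component of a Gorenstein algebra, pulled back to a
  polynomial ring.
\<close>

locale graded_functional =
  fixes m d :: nat and L :: "'k::field mpoly \<Rightarrow> 'k"
  assumes L_add: "p \<in> carrier (poly_ring m) \<Longrightarrow> q \<in> carrier (poly_ring m) \<Longrightarrow> L (p + q) = L p + L q"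
    and L_smult: "p \<in> carrier (poly_ring m) \<Longrightarrow> L (Const c * p) = c * L p"
    and L_hom_comp: "p \<in> carrier (poly_ring m) \<Longrightarrow> L (hom_comp d p) = L p"
    and L_nonzero: "\<exists>u\<in>carrier (poly_ring m). L u \<noteq> 0"
begin

text \<open>
  The radical of the symmetric bilinear form \<open>(p, q) \<mapsto> L (p * q)\<close>.
\<close>

definition radical :: "'k mpoly set" where
  "radical = {p \<in> carrier (poly_ring m). \<forall>q\<in>carrier (poly_ring m). L (p * q) = 0}"

lemma L_zero [simp]: "L 0 = 0"
  using L_smult[of 0 0] by simp

lemma L_uminus: "p \<in> carrier (poly_ring m) \<Longrightarrow> L (- p) = - L p"
  using L_smult[of p "-1"] by simp

lemma L_diff: "p \<in> carrier (poly_ring m) \<Longrightarrow> q \<in> carrier (poly_ring m) \<Longrightarrow> L (p - q) = L p - L q"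
  using L_add[of p "- q"] by (simp add: L_uminus)

lemma L_sum: "(\<And>i. i \<in> I \<Longrightarrow> f i \<in> carrier (poly_ring m)) \<Longrightarrow> L (sum f I) = (\<Sum>i\<in>I. L (f i))"
  by (induction I rule: infinite_finite_induct) (auto simp: L_add polys_sum)

lemma L_homogeneous: "p \<in> homogeneous_polys m e \<Longrightarrow> e \<noteq> d \<Longrightarrow> L p = 0"
  using L_hom_comp[of p] hom_comp_of_homogeneous[of p m e d] by simp

lemma radical_polys [simp, dest]: "p \<in> radical \<Longrightarrow> p \<in> carrier (poly_ring m)"
  unfolding radical_def by blast

lemma radicalD: "p \<in> radical \<Longrightarrow> q \<in> carrier (poly_ring m) \<Longrightarrow> L (p * q) = 0"
  unfolding radical_def by blast

lemma in_radicalI: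
  "p \<in> carrier (poly_ring m) \<Longrightarrow> (\<And>q. q \<in> carrier (poly_ring m) \<Longrightarrow> L (p * q) = 0) \<Longrightarrow> p \<in> radical"
  unfolding radical_def by blast

lemma radical_L: "p \<in> radical \<Longrightarrow> L p = 0"
  using radicalD[of p 1] by simp

lemma radical_zero: "0 \<in> radical"
  by (rule in_radicalI) simp_all

lemma radical_add: "p \<in> radical \<Longrightarrow> q \<in> radical \<Longrightarrow> p + q \<in> radical"
  by (rule in_radicalI) (simp_all add: L_add distrib_right radicalD)

lemma radical_diff: "p \<in> radical \<Longrightarrow> q \<in> radical \<Longrightarrow> p - q \<in> radical"
  by (rule in_radicalI) (simp_all add: L_diff left_diff_distrib radicalD)

lemma radical_mult: "p \<in> radical \<Longrightarrow> q \<in> carrier (poly_ring m) \<Longrightarrow> p * q \<in> radical"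
  by (rule in_radicalI) (simp_all add: mult.assoc radicalD)

lemma radicalI:
  assumes "p \<in> carrier (poly_ring m)" "\<And>i e. e \<in> homogeneous_polys m i \<Longrightarrow> L (p * e) = 0"
  shows "p \<in> radical"
proof (rule in_radicalI)
  fix q :: "'k mpoly" assume q: "q \<in> carrier (poly_ring m)"
  obtain N where N: "\<And>k. k > N \<Longrightarrow> hom_comp k q = 0" using hom_comp_eventually_0[of q] by blast
  have "L (p * q) = L (\<Sum>k\<le>N. p * hom_comp k q)" using sum_hom_comp[OF N] by (simp flip: sum_distrib_left)
  also have "\<dots> = (\<Sum>k\<le>N. L (p * hom_comp k q))" using assms(1) q by (intro L_sum) auto
  also have "\<dots> = 0" by (intro sum.neutral ballI assms(2)[OF hom_comp_homogeneous[OF q]])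
  finally show "L (p * q) = 0" .
qed (fact assms(1))

text \<open>
  As \<open>L\<close> sees degree \<open>d\<close> only, pairing with a form of degree \<open>j\<close> singles out the component of degree
  \<open>d - j\<close>.
\<close>

lemma radical_hom_comp: assumes "p \<in> radical" shows "hom_comp i p \<in> radical"
proof (rule radicalI)
  fix j and e :: "'k mpoly" assume e: "e \<in> homogeneous_polys m j"
  show "L (hom_comp i p * e) = 0"
  proof (cases "i + j = d")
    case True
    then have "hom_comp d (p * e) = hom_comp i p * e"
      using hom_comp_mult_homogeneous[OF e, of d p] by auto
    then have "L (hom_comp i p * e) = L (p * e)" using L_hom_comp[of "p * e"] assms e by simp
    then show ?thesis using assms e by (simp add: radicalD)
  next
    case False
    have "hom_comp i p * e \<in> homogeneous_polys m (i + j)"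
      using assms e by (intro homogeneous_mult hom_comp_homogeneous) auto
    then show ?thesis using False by (rule L_homogeneous)
  qed
qed (use assms in auto)

lemma radical_degree_gt: assumes "p \<in> homogeneous_polys m e" "e > d" shows "p \<in> radical"
proof (rule radicalI)
  fix i and q :: "'k mpoly" assume "q \<in> homogeneous_polys m i"
  then show "L (p * q) = 0" using homogeneous_mult[OF assms(1)] assms(2) by (intro L_homogeneous) auto
qed (use assms in auto)

lemma obtain_socle_generator: obtains u where "u \<in> homogeneous_polys m d" "L u = 1"
proof -
  obtain p where p: "p \<in> carrier (poly_ring m)" "L p \<noteq> 0" using L_nonzero by blast
  show ?thesis
    by (rule that[of "Const (1 / L p) * hom_comp d p"]) (use p in \<open>simp_all add: L_smult L_hom_comp\<close>)
qed

text \<open>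
  Take a form \<open>t\<close> of the largest degree \<open>j\<close> with \<open>L (s * t) \<noteq> 0\<close>. Then \<open>s * t\<close> pairs to zero with every
  form of positive degree, by the choice of \<open>j\<close>, and so does \<open>u\<close>, for reasons of degree. Their
  pairings with constants agree after scaling \<open>u\<close>. This lemma yields both the one-dimensional
  socle and the irreducibility.
\<close>

lemma multiple_in_socle:
  assumes u: "u \<in> homogeneous_polys m d" "L u = 1"
    and s: "s \<in> carrier (poly_ring m)" "s \<notin> radical"
  obtains j t k where "t \<in> homogeneous_polys m j" "k \<noteq> 0" "s * t - Const k * u \<in> radical"
proof -
  \<comment> \<open>The degrees \<open>j\<close> with a form that pairs nontrivially with \<open>s\<close>; they are bounded by \<open>d\<close>.\<close>
  let ?P = "\<lambda>j. \<exists>t\<in>homogeneous_polys m j. L (s * t) \<noteq> 0"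
  have ex: "\<exists>j. ?P j" using radicalI[of s] s by blast
  have bound: "j \<le> d" if "?P j" for j
  proof (rule ccontr)
    assume "\<not> j \<le> d"
    then have "t * s \<in> radical" if "t \<in> homogeneous_polys m j" for t
      using radical_degree_gt[OF that] radical_mult s by simp
    then show False using \<open>?P j\<close> radical_L by (metis mult.commute)
  qed
  define j where "j = Greatest ?P"
  have j: "?P j" unfolding j_def by (rule GreatestI_ex_nat[of ?P, OF ex bound])
  have j_max: "i \<le> j" if "?P i" for i unfolding j_def by (rule Greatest_le_nat[of ?P, OF that bound])
  obtain t where t: "t \<in> homogeneous_polys m j" "L (s * t) \<noteq> 0" using j by blast
  let ?k = "L (s * t)"
  have "s * t - Const ?k * u \<in> radical"
  proof (rule radicalI)
    fix i and e :: "'k mpoly" assume e: "e \<in> homogeneous_polys m i"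
    show "L ((s * t - Const ?k * u) * e) = 0"
    proof (cases "i = 0")
      case True
      then obtain c where c: "e = Const c" using e homogeneous_0_iff by blast
      have "(s * t - Const ?k * u) * e = Const c * (s * t) - Const c * (Const ?k * u)"
        unfolding c by (simp add: algebra_simps)
      also have "L \<dots> = 0" using s t u by (simp add: L_diff L_smult)
      finally show ?thesis .
    next
      case False
      have "t * e \<in> homogeneous_polys m (j + i)" using t(1) e by (rule homogeneous_mult)
      then have "L (s * (t * e)) = 0" using j_max[of "j + i"] False by auto
      moreover have "L (u * e) = 0" using homogeneous_mult[OF u(1) e] False by (intro L_homogeneous) auto
      moreover have "(s * t - Const ?k * u) * e = s * (t * e) - Const ?k * (u * e)"
        by (simp add: algebra_simps)
      ultimately show ?thesis using s t u e by (simp add: L_diff L_smult)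
    qed
  qed (use s t u in auto)
  then show ?thesis using t by (intro that)
qed

end

section \<open>Gorenstein algebras presented by a functional\<close>

text \<open>
  Up to isomorphism, \<open>C\<close> is the polynomial ring modulo the radical of \<open>L\<close>.
\<close>

locale functional_presentation = poly_hom C m \<psi> + graded_functional m d L
  for C :: "('k::field, 'c) module" (structure)
    and m and \<psi> :: "'k::field mpoly \<Rightarrow> 'c" and d and L :: "'k::field mpoly \<Rightarrow> 'k" +
  assumes surj: "\<psi> ` carrier (poly_ring m) = carrier C"
    and ker: "s \<in> carrier (poly_ring m) \<Longrightarrow> \<psi> s = \<zero> \<longleftrightarrow> s \<in> radical"
begin

abbreviation gr :: "nat \<Rightarrow> 'c set" where "gr i \<equiv> \<psi> ` homogeneous_polys m i"

lemma eq_iff: "s \<in> carrier (poly_ring m) \<Longrightarrow> t \<in> carrier (poly_ring m) \<Longrightarrow> \<psi> s = \<psi> t \<longleftrightarrow> s - t \<in> radical"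
  by (simp add: hom_eq_iff ker)

lemma subspace_gr: "subspace (class_ring :: 'k ring) (gr i) C"
proof (rule algebra_subspaceI[OF algebra_axioms])
  show "\<zero> \<in> gr i" using hom_zero by (intro image_eqI[of _ _ 0]) simp_all
  fix x y c assume x: "x \<in> gr i"
  then show "c \<odot> x \<in> gr i" by (auto simp flip: hom_smult)
  assume "y \<in> gr i"
  then show "x \<oplus> y \<in> gr i" using x by (auto simp flip: hom_add)
qed auto

text \<open>
  A second decomposition lifts to forms whose sum differs from \<open>s\<close> by an element of the radical. As
  the radical is homogeneous, the components differ by elements of the radical, too.
\<close>

lemma unique_decomposition:
  assumes "a \<in> carrier C"
  shows "\<exists>!f. (\<forall>i. f i \<in> gr i) \<and> finite {i. f i \<noteq> \<zero>} \<and> a = (\<Oplus>i\<in>{i. f i \<noteq> \<zero>}. f i)"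
proof -
  obtain s where s: "s \<in> carrier (poly_ring m)" "a = \<psi> s" using assms surj by blast
  obtain N where N: "\<And>k. k > N \<Longrightarrow> hom_comp k s = 0" using hom_comp_eventually_0[of s] by blast
  define f where "f i = \<psi> (hom_comp i s)" for i
  have sub: "{i. f i \<noteq> \<zero>} \<subseteq> {..N}" using N hom_zero by (force simp: f_def not_less[symmetric])
  have "a = (\<Oplus>i\<in>{..N}. f i)"
    using s sum_hom_comp[OF N] hom_sum[of "{..N}" "\<lambda>i. hom_comp i s"] by (simp add: f_def[abs_def])
  also have "\<dots> = (\<Oplus>i\<in>{i. f i \<noteq> \<zero>}. f i)"
    using sub s by (intro add.finprod_mono_neutral_cong_right) (auto simp: f_def)
  finally have a: "a = (\<Oplus>i\<in>{i. f i \<noteq> \<zero>}. f i)" .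
  have f: "f i \<in> gr i" for i using s hom_comp_homogeneous[OF s(1)] by (auto simp: f_def)
  show ?thesis
  proof (rule ex1I[of _ f])
    show "(\<forall>i. f i \<in> gr i) \<and> finite {i. f i \<noteq> \<zero>} \<and> a = (\<Oplus>i\<in>{i. f i \<noteq> \<zero>}. f i)"
      using f a finite_subset[OF sub] by simp
    fix g assume g: "(\<forall>i. g i \<in> gr i) \<and> finite {i. g i \<noteq> \<zero>} \<and> a = (\<Oplus>i\<in>{i. g i \<noteq> \<zero>}. g i)"
    then have "\<forall>i. \<exists>p\<in>homogeneous_polys m i. g i = \<psi> p" by blast
    then obtain p where p: "\<And>i. p i \<in> homogeneous_polys m i" "\<And>i. g i = \<psi> (p i)" by metis
    let ?X = "{i. g i \<noteq> \<zero>}"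
    have pS: "p i \<in> carrier (poly_ring m)" for i using p(1)[of i] by simp
    have "\<psi> (sum p ?X) = (\<Oplus>i\<in>?X. \<psi> (p i))" using g pS by (intro hom_sum) auto
    also have "\<dots> = a" using g by (simp only: p(2)[symmetric])
    finally have "\<psi> (sum p ?X) = a" .
    then have "s - sum p ?X \<in> radical" using s pS by (simp add: polys_sum flip: eq_iff)
    then have *: "hom_comp i s - hom_comp i (sum p ?X) \<in> radical" for i
      using radical_hom_comp[of _ i] by (metis hom_comp_linear(3))
    have comp: "hom_comp i (sum p ?X) = (p i when g i \<noteq> \<zero>)" for i
    proof -
      have "hom_comp i (sum p ?X) = (\<Sum>j\<in>?X. if i = j then p j else 0)"
        unfolding hom_comp_sum hom_comp_of_homogeneous[OF p(1)] by (intro sum.cong refl) (auto simp: when_def)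
      then show ?thesis using g by (simp add: when_def)
    qed
    have "f i = g i" for i
    proof -
      have "f i = \<psi> (p i when g i \<noteq> \<zero>)"
        using *[of i] s pS unfolding comp f_def by (subst eq_iff) (auto simp: when_def)
      then show ?thesis using p(2)[of i] by (auto simp: when_def hom_zero)
    qed
    then show "g = f" by auto
  qed
qed

lemma graded: "graded_algebra C gr"
  unfolding graded_algebra_def
proof (intro conjI allI ballI)
  show "\<one> \<in> gr 0" using hom_one by (intro image_eqI[of _ _ 1]) simp_all
  fix i j a b assume "a \<in> gr i" "b \<in> gr j"
  then obtain p q where pq: "p \<in> homogeneous_polys m i" "q \<in> homogeneous_polys m j" "a = \<psi> p" "b = \<psi> q" by blast
  then have "a \<otimes> b = \<psi> (p * q)" by (simp add: hom_mult)
  then show "a \<otimes> b \<in> gr (i + j)" using homogeneous_mult[OF pq(1,2)] by blast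
qed (fact algebra_axioms subspace_gr unique_decomposition)+

lemma standard: "standard_graded C gr"
  unfolding standard_graded_def
proof (intro conjI graded)
  obtain u where u: "u \<in> homogeneous_polys m d" "L u = 1" by (rule obtain_socle_generator)
  show "\<one> \<noteq> \<zero>"
  proof
    assume "\<one> = \<zero>"
    then have "1 \<in> radical" using ker[of 1] hom_one by simp
    then have "1 * u \<in> radical" using u by (intro radical_mult) auto
    then show False using radical_L u by force
  qed
  show "gr 0 = scalars C"
  proof -
    have "homogeneous_polys m 0 = range (Const :: 'k \<Rightarrow> 'k mpoly)" by (auto simp: homogeneous_0_iff)
    then show ?thesis by (simp only: scalars_def image_image hom_Const)
  qed
  show "subalgebra_generated C (gr 1) = carrier C"
  proof -
    have "\<psi> ` carrier (poly_ring m) = subalgebra_generated C (gr 1)"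
      by (rule range_eq_subalgebra_generated) auto
    then show ?thesis using surj by simp
  qed
  show "vectorspace.fin_dim (class_ring :: 'k ring) (C\<lparr>carrier := gr 1\<rparr>)"
  proof (rule subspace_fin_dimI[OF subspace_gr])
    let ?S = "(\<lambda>i. \<psi> (Var i)) ` {..<m}"
    show "finite ?S" "?S \<subseteq> gr 1" by auto
    fix W assume W: "subspace (class_ring :: 'k ring) W C" "?S \<subseteq> W"
    have zero: "\<zero> \<in> W" and add: "\<And>x y. x \<in> W \<Longrightarrow> y \<in> W \<Longrightarrow> x \<oplus> y \<in> W" and smult: "\<And>c x. x \<in> W \<Longrightarrow> c \<odot> x \<in> W"
      using W(1) by (auto simp: subspace_def LinearCombinations.submodule_def)
    have "\<psi> (\<Sum>i\<in>X. Const (c i) * Var i) \<in> W" if "finite X" "X \<subseteq> {..<m}" for X and c :: "nat \<Rightarrow> 'k"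
      using that
    proof (induction X rule: finite_induct)
      case (insert x F)
      then have "\<psi> (Const (c x) * Var x) \<in> W" using smult W(2) by (auto simp: hom_smult)
      moreover have "\<psi> (Const (c x) * Var x + (\<Sum>i\<in>F. Const (c i) * Var i)) =
          \<psi> (Const (c x) * Var x) \<oplus> \<psi> (\<Sum>i\<in>F. Const (c i) * Var i)"
        using insert by (intro hom_add polys_sum) auto
      ultimately show ?case using insert add by simp
    qed (simp add: hom_zero zero)
    then have "\<psi> p \<in> W" if "p \<in> homogeneous_polys m 1" for p
      by (subst homogeneous_1_eq[OF that]) simp
    then show "gr 1 \<subseteq> W" by blast
  qed
qed

text \<open>
  Forms of degree above \<open>d\<close> lie in the radical. So an ideal of \<open>C\<close> is determined by the polynomials in
  its preimage that involve only the finitely many monomials of degree at most \<open>d\<close>.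
\<close>

lemma artinian: "artinian C"
  unfolding artinian_def
proof (intro allI impI)
  fix I :: "nat \<Rightarrow> 'c set" assume I: "\<forall>i. ideal (I i) C \<and> I (Suc i) \<subseteq> I i"
  define U where "U k = {p \<in> carrier (poly_ring m). \<psi> p \<in> I k}" for k
  define T where "T = {a :: nat \<Rightarrow>\<^sub>0 nat. Poly_Mapping.keys a \<subseteq> {..<m} \<and> mdeg a \<le> d}"
  have "finite T"
  proof -
    have "T \<subseteq> (\<lambda>xs. Poly_Mapping.nth xs) ` {xs. set xs \<subseteq> {..d} \<and> length xs = m}"
    proof
      fix a assume a: "a \<in> T"
      let ?xs = "map (Poly_Mapping.lookup a) [0..<m]"
      have "Poly_Mapping.lookup a i \<le> mdeg a" for i
        unfolding mdeg_def by (cases "i \<in> Poly_Mapping.keys a") (auto intro: member_le_sum simp: in_keys_iff)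
      then have "set ?xs \<subseteq> {..d}" using a by (auto simp: T_def intro: order_trans)
      moreover have "a = Poly_Mapping.nth ?xs"
        using a by (intro poly_mapping_eqI) (force simp: T_def nth_default_def in_keys_iff)
      ultimately show "a \<in> (\<lambda>xs. Poly_Mapping.nth xs) ` {xs. set xs \<subseteq> {..d} \<and> length xs = m}" by force
    qed
    then show ?thesis using finite_lists_length_eq[of "{..d}" m] finite_surj by blast
  qed
  moreover have "U (Suc k) \<subseteq> U k" for k using I by (auto simp: U_def)
  moreover have "p - q \<in> U k" if "p \<in> U k" "q \<in> U k" for p q k
  proof -
    interpret I: ideal "I k" C using I by blast
    have "\<psi> p \<oplus> \<ominus> \<psi> q \<in> I k" using that by (intro I.a_closed I.a_inv_closed) (auto simp: U_def)
    then show ?thesis using that by (simp add: U_def hom_diff M.minus_eq)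
  qed
  moreover have "Const c * p \<in> U k" if "p \<in> U k" for p k c
  proof -
    interpret I: ideal "I k" C using I by blast
    show ?thesis using that I.I_l_closed[of "\<psi> p" "\<psi> (Const c)"] by (simp add: U_def hom_mult)
  qed
  ultimately have "\<exists>N. \<forall>k\<ge>N. U k \<inter> {p. Poly_Mapping.keys p \<subseteq> T} = U N \<inter> {p. Poly_Mapping.keys p \<subseteq> T}"
    by (rule descending_subspaces_stabilize)
  then obtain N where N: "\<And>k. k \<ge> N \<Longrightarrow> U k \<inter> {p. Poly_Mapping.keys p \<subseteq> T} = U N \<inter> {p. Poly_Mapping.keys p \<subseteq> T}"
    by blast
  have "I N \<subseteq> I k" if k: "k \<ge> N" for k
  proof
    fix x assume x: "x \<in> I N"
    interpret I: ideal "I N" C using I by blast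
    obtain s where s: "s \<in> carrier (poly_ring m)" "x = \<psi> s" using x I.a_Hcarr surj by blast
    \<comment> \<open>The truncation of \<open>s\<close> represents the same element and involves only monomials in \<open>T\<close>.\<close>
    define t where "t = (\<Sum>i\<le>d. hom_comp i s)"
    have t: "t \<in> carrier (poly_ring m)" using s by (auto simp: t_def intro: polys_sum)
    have "s - t \<in> radical"
    proof -
      obtain M where M: "\<And>k. k > M \<Longrightarrow> hom_comp k s = 0" using hom_comp_eventually_0[of s] by blast
      have "s = (\<Sum>i\<le>max d M. hom_comp i s)" using M by (subst sum_hom_comp) auto
      also have "\<dots> = t + (\<Sum>i\<in>{d<..max d M}. hom_comp i s)"
        unfolding t_def by (subst sum.union_disjoint[symmetric]) (auto intro!: sum.cong)
      finally have "s - t = (\<Sum>i\<in>{d<..max d M}. hom_comp i s)" by (simp add: algebra_simps)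
      also have "\<dots> \<in> radical"
      proof -
        have sum: "sum f X \<in> radical" if "finite X" "\<And>i. i \<in> X \<Longrightarrow> f i \<in> radical" for f and X :: "nat set"
          using that by (induction X rule: finite_induct) (auto simp: radical_add radical_zero)
        show ?thesis using radical_degree_gt[OF hom_comp_homogeneous[OF s(1)]] by (intro sum) auto
      qed
      finally show ?thesis .
    qed
    then have xt: "x = \<psi> t" using s t by (simp add: eq_iff)
    have "Poly_Mapping.keys t \<subseteq> T"
    proof
      fix a assume a: "a \<in> Poly_Mapping.keys t"
      then obtain i where "i \<le> d" "a \<in> Poly_Mapping.keys (hom_comp i s)"
        using keys_sum[of "\<lambda>i. hom_comp i s" "{..d}"] unfolding t_def by blast
      then show "a \<in> T" using s by (auto simp: T_def keys_hom_comp in_polys_iff)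
    qed
    then have "t \<in> U k" using N[OF k] x xt t by (auto simp: U_def)
    then show "x \<in> I k" using xt by (simp add: U_def)
  qed
  moreover have "I k \<subseteq> I N" if "k \<ge> N" for k
  proof -
    have "I (Suc i) \<subseteq> I i" for i using I by blast
    then show ?thesis using that by (rule lift_Suc_antimono_le)
  qed
  ultimately show "\<exists>N. \<forall>i\<ge>N. I i = I N" by blast
qed

text \<open>
  Some multiple \<open>s * t\<close> of a representative \<open>s\<close> of a nonzero socle element is congruent to a nonzero
  multiple of \<open>u\<close>. Forms of positive degree kill the socle, so \<open>t\<close> is a constant.
\<close>

lemma socle_eq:
  assumes u: "u \<in> homogeneous_polys m d" "L u = 1"
  shows "socle C gr = range (\<lambda>k. k \<odot> \<psi> u)"
proof
  show "socle C gr \<subseteq> range (\<lambda>k. k \<odot> \<psi> u)"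
  proof
    fix x assume x: "x \<in> socle C gr"
    then have "x \<in> carrier C" unfolding socle_def by blast
    then obtain s where s: "s \<in> carrier (poly_ring m)" "x = \<psi> s" unfolding surj[symmetric] by blast
    have "\<exists>k. s - Const k * u \<in> radical"
    proof (cases "s \<in> radical")
      case True
      then show ?thesis by (intro exI[of _ 0]) simp
    next
      case False
      then obtain j t k where t: "t \<in> homogeneous_polys m j" "k \<noteq> 0" "s * t - Const k * u \<in> radical"
        using multiple_in_socle[OF u s(1)] by metis
      have "j = 0"
      proof (rule ccontr)
        assume "j \<noteq> 0"
        then have "\<psi> t \<otimes> x = \<zero>" using x t by (auto simp: socle_def)
        then have "s * t \<in> radical" using s t ker[of "s * t"] by (simp add: hom_mult m_comm)
        then have "s * t - (s * t - Const k * u) \<in> radical" using t(3) by (rule radical_diff)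
        then have "L (Const k * u) = 0" using radical_L[of "Const k * u"] by simp
        then show False using u t by (simp add: L_smult)
      qed
      then obtain c where c: "t = Const c" using t homogeneous_0_iff by blast
      have "c \<noteq> 0"
      proof
        assume "c = 0"
        then have "- (Const k * u) \<in> radical" using t c by simp
        then have "L (- (Const k * u)) = 0" by (rule radical_L)
        then show False using u t by (simp add: L_smult L_uminus)
      qed
      have "(s * t - Const k * u) * Const (1 / c) \<in> radical" using t by (intro radical_mult) auto
      also have "(s * t - Const k * u) * Const (1 / c) = Const (c * (1 / c)) * s - Const (k * (1 / c)) * u"
        unfolding c by (simp only: Const_simps algebra_simps)
      also have "\<dots> = s - Const (k * (1 / c)) * u" using \<open>c \<noteq> 0\<close> by simp
      finally show ?thesis by blast
    qed
    then show "x \<in> range (\<lambda>k. k \<odot> \<psi> u)" using s u by (auto simp: eq_iff simp flip: hom_smult)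
  qed
  show "range (\<lambda>k. k \<odot> \<psi> u) \<subseteq> socle C gr"
  proof -
    have "\<psi> t \<otimes> (k \<odot> \<psi> u) = \<zero>" if "t \<in> homogeneous_polys m i" "i > 0" for t i k
    proof -
      have "t * (Const k * u) \<in> homogeneous_polys m (i + d)" using that u by (intro homogeneous_mult) auto
      then have "t * (Const k * u) \<in> radical" using that by (intro radical_degree_gt) auto
      then show ?thesis using that u by (simp add: ker flip: hom_mult hom_smult)
    qed
    then show ?thesis using u by (auto simp: socle_def)
  qed
qed

lemma socle_generator_nonzero: "u \<in> homogeneous_polys m d \<Longrightarrow> L u = 1 \<Longrightarrow> \<psi> u \<noteq> \<zero>"
  using radical_L by (force simp: ker)

theorem gorenstein: "artinian_gorenstein C gr"
proof -
  obtain u where u: "u \<in> homogeneous_polys m d" "L u = 1" by (rule obtain_socle_generator)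
  have W: "subspace (class_ring :: 'k ring) (socle C gr) C"
  proof (rule algebra_subspaceI[OF algebra_axioms])
    show "\<zero> \<in> socle C gr" using u hom_smult[of u 0] hom_zero by (auto simp: socle_eq[OF u] intro!: image_eqI[of _ _ 0])
    fix x y c assume x: "x \<in> socle C gr"
    then show "c \<odot> x \<in> socle C gr" using u smult_assoc1[of c _ "\<psi> u"] by (auto simp: socle_eq[OF u] simp flip: smult_assoc1)
    assume "y \<in> socle C gr"
    then show "x \<oplus> y \<in> socle C gr" using x u smult_l_distr[of _ _ "\<psi> u"] by (auto simp: socle_eq[OF u] simp flip: smult_l_distr)
  qed (auto simp: socle_def)
  have w: "\<psi> u \<in> socle C gr" using u smult_one[of "\<psi> u"] by (auto simp: socle_eq[OF u] intro!: image_eqI[of _ _ 1])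
  show ?thesis
    unfolding artinian_gorenstein_def
    using standard artinian subspace_dim_1I[OF W w socle_generator_nonzero[OF u]] socle_eq[OF u] by auto
qed

theorem socle_degree: "has_socle_degree C gr d"
proof -
  obtain u where u: "u \<in> homogeneous_polys m d" "L u = 1" by (rule obtain_socle_generator)
  have "gr i = {\<zero>}" if "i > d" for i
  proof -
    have "\<psi> p = \<zero>" if "p \<in> homogeneous_polys m i" for p
      using radical_degree_gt[OF that \<open>i > d\<close>] that by (simp add: ker)
    moreover have "\<zero> \<in> gr i" using graded_algebra_zero[OF graded] .
    ultimately show ?thesis by blast
  qed
  then show ?thesis
    unfolding has_socle_degree_def using socle_generator_nonzero[OF u] u by blast
qed

end

section \<open>Uniqueness of the kernel of a Gorenstein presentation\<close>

lemma socle_multiple: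
  fixes C :: "('k::field, 'c) module"
  assumes g: "artinian_gorenstein C gr" and "x \<in> socle C gr" "y \<in> socle C gr" "y \<noteq> \<zero>\<^bsub>C\<^esub>"
  shows "\<exists>k. x = k \<odot>\<^bsub>C\<^esub> y"
proof -
  interpret algebra "class_ring :: 'k ring" C
    using g by (simp add: artinian_gorenstein_def standard_graded_def graded_algebra_def)
  have gc: "gr i \<subseteq> carrier C" for i
    using g graded_algebra_carrier by (auto simp: artinian_gorenstein_def standard_graded_def)
  have "subspace (class_ring :: 'k ring) (socle C gr) C"
  proof (rule algebra_subspaceI[OF algebra_axioms])
    show "\<zero>\<^bsub>C\<^esub> \<in> socle C gr" using gc by (auto simp: socle_def intro!: r_null)
    fix x y c assume x: "x \<in> socle C gr"
    have "z \<otimes>\<^bsub>C\<^esub> (c \<odot>\<^bsub>C\<^esub> x) = c \<odot>\<^bsub>C\<^esub> (z \<otimes>\<^bsub>C\<^esub> x)" if "z \<in> carrier C" for z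
      using that x smult_assoc2[of c x z] smult_closed[of c x] by (simp add: m_comm socle_def)
    then show "c \<odot>\<^bsub>C\<^esub> x \<in> socle C gr"
      using x gc smult_closed[of c x] smult_r_null[of c] by (auto simp: socle_def subset_iff)
    assume "y \<in> socle C gr"
    then show "x \<oplus>\<^bsub>C\<^esub> y \<in> socle C gr" using x gc by (auto simp: socle_def r_distr subset_iff)
  qed (auto simp: socle_def)
  from subspace_dim_1D[OF this _ _ assms(3,4,2)] g show ?thesis
    by (auto simp: artinian_gorenstein_def)
qed

lemma top_degree_in_socle:
  assumes g: "graded_algebra C gr" and "has_socle_degree C gr d" and x: "x \<in> gr d"
  shows "x \<in> socle C gr"
proof -
  have "y \<otimes>\<^bsub>C\<^esub> x = \<zero>\<^bsub>C\<^esub>" if "i > 0" "y \<in> gr i" for i y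
  proof -
    have "y \<otimes>\<^bsub>C\<^esub> x \<in> gr (i + d)" using g that x unfolding graded_algebra_def by blast
    then show ?thesis using assms(2) that(1) by (auto simp: has_socle_degree_def)
  qed
  then show ?thesis using graded_algebra_carrier[OF g, of d] x by (auto simp: socle_def)
qed

text \<open>
  The kernel lies in the radical: if \<open>\<psi> p = 0\<close> then the component of degree \<open>d\<close> of any multiple of
  \<open>p\<close> is in the kernel, which does not contain the forms of degree \<open>d\<close> outside the kernel of \<open>L\<close>.
  Conversely, suppose that a form in the radical is not in the kernel, and take one of the highest
  degree. Its multiples by forms of positive degree are in the kernel, so its image is in the socle,
  hence a multiple of \<open>\<psi> u\<close> for a form \<open>u\<close> with \<open>L u = 1\<close>; but then that multiple of \<open>u\<close> would lie
  in the radical.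
\<close>

lemma gorenstein_kernel_unique:
  fixes C :: "('k::field, 'c) module"
  assumes "poly_hom C m \<psi>" "graded_functional m d L"
    and g: "artinian_gorenstein C (\<lambda>i. \<psi> ` homogeneous_polys m i)"
      "has_socle_degree C (\<lambda>i. \<psi> ` homogeneous_polys m i) d"
    and top: "\<And>s. s \<in> homogeneous_polys m d \<Longrightarrow> L s = 0 \<Longrightarrow> \<psi> s = \<zero>\<^bsub>C\<^esub>"
    and s: "s \<in> carrier (poly_ring m)"
  shows "\<psi> s = \<zero>\<^bsub>C\<^esub> \<longleftrightarrow> s \<in> graded_functional.radical m L"
proof -
  interpret poly_hom C m \<psi> by fact
  interpret graded_functional m d L by fact
  let ?gr = "\<lambda>i. \<psi> ` homogeneous_polys m i"
  have gr: "graded_algebra C ?gr" using g by (simp add: artinian_gorenstein_def standard_graded_def)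
  obtain u where u: "u \<in> homogeneous_polys m d" "L u = 1" by (rule obtain_socle_generator)
  have top_eq: "\<psi> p = L p \<odot>\<^bsub>C\<^esub> \<psi> u" if p: "p \<in> homogeneous_polys m d" for p
  proof -
    have "\<psi> (p - Const (L p) * u) = \<zero>\<^bsub>C\<^esub>" using p u by (intro top) (auto simp: L_diff L_smult)
    then have "\<psi> p = \<psi> (Const (L p) * u)" using p u by (simp add: hom_eq_iff)
    then show ?thesis using u by (simp add: hom_smult)
  qed
  have u0: "\<psi> u \<noteq> \<zero>\<^bsub>C\<^esub>"
  proof
    assume 0: "\<psi> u = \<zero>\<^bsub>C\<^esub>"
    have "?gr d = {\<zero>\<^bsub>C\<^esub>}"
      using top_eq smult_r_null[of "L _"] graded_algebra_zero[OF gr, of d] by (auto simp: 0)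
    then show False using g(2) by (simp add: has_socle_degree_def)
  qed
  have ker_radical: "p \<in> radical" if p: "p \<in> carrier (poly_ring m)" "\<psi> p = \<zero>\<^bsub>C\<^esub>" for p
  proof (rule in_radicalI[OF p(1)])
    fix q :: "'k mpoly" assume q: "q \<in> carrier (poly_ring m)"
    have pq: "p * q \<in> carrier (poly_ring m)" "\<psi> (p * q) = \<zero>\<^bsub>C\<^esub>" using p q by (auto simp: hom_mult)
    have "L (p * q) \<odot>\<^bsub>C\<^esub> \<psi> u = \<psi> (hom_comp d (p * q))"
      using top_eq[OF hom_comp_homogeneous[OF pq(1)]] pq by (simp add: L_hom_comp)
    also have "\<dots> = \<zero>\<^bsub>C\<^esub>" using hom_component_zero[OF gr _ pq] by simp
    finally have 0: "L (p * q) \<odot>\<^bsub>C\<^esub> \<psi> u = \<zero>\<^bsub>C\<^esub>" .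
    show "L (p * q) = 0"
    proof (rule ccontr)
      assume nz: "L (p * q) \<noteq> 0"
      have "\<psi> u = (inverse (L (p * q)) * L (p * q)) \<odot>\<^bsub>C\<^esub> \<psi> u" using nz u smult_one[of "\<psi> u"] by simp
      also have "\<dots> = \<zero>\<^bsub>C\<^esub>"
        using smult_assoc1[of "inverse (L (p * q))" "L (p * q)" "\<psi> u"] u 0 smult_r_null[of "inverse (L (p * q))"] by simp
      finally show False using u0 by simp
    qed
  qed
  have gt: "\<psi> p = \<zero>\<^bsub>C\<^esub>" if "p \<in> homogeneous_polys m i" "i > d" for p i
    using that g(2) by (auto simp: has_socle_degree_def)
  have hom_rad: "\<psi> p = \<zero>\<^bsub>C\<^esub>" if "p \<in> radical" "p \<in> homogeneous_polys m i" for p i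
    using that
  proof (induction "Suc d - i" arbitrary: i p rule: less_induct)
    case less
    show ?case
    proof (cases "i > d")
      case True
      then show ?thesis using gt less.prems by blast
    next
      case False
      have "\<psi> p \<in> socle C ?gr"
      proof -
        have "\<psi> t \<otimes>\<^bsub>C\<^esub> \<psi> p = \<zero>\<^bsub>C\<^esub>" if t: "t \<in> homogeneous_polys m j" "j > 0" for t j
        proof -
          have "p * t \<in> radical" using less.prems t by (intro radical_mult) auto
          moreover have "p * t \<in> homogeneous_polys m (i + j)" using less.prems t by (intro homogeneous_mult)
          ultimately have "\<psi> (p * t) = \<zero>\<^bsub>C\<^esub>" using False t by (intro less.hyps[of "i + j"]) auto
          then show ?thesis using less.prems t by (simp add: hom_mult m_comm)
        qed
        then show ?thesis using less.prems by (auto simp: socle_def)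
      qed
      moreover have "\<psi> u \<in> socle C ?gr" using u by (intro top_degree_in_socle[OF gr g(2)]) auto
      ultimately obtain k where k: "\<psi> p = k \<odot>\<^bsub>C\<^esub> \<psi> u" using socle_multiple[OF g(1)] u0 by blast
      then have "\<psi> (p - Const k * u) = \<zero>\<^bsub>C\<^esub>" using less.prems u by (simp add: hom_smult flip: hom_eq_iff)
      then have "p - Const k * u \<in> radical" using less.prems u by (intro ker_radical) auto
      then have "L (p - Const k * u) = 0" by (rule radical_L)
      then have "k = 0" using less.prems u radical_L[of p] by (simp add: L_diff L_smult)
      then show ?thesis using k u smult_l_null[of "\<psi> u"] by simp
    qed
  qed
  show ?thesis
  proof
    assume r: "s \<in> radical"
    obtain N where N: "\<And>k. k > N \<Longrightarrow> hom_comp k s = 0" using hom_comp_eventually_0[of s] by blast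
    have "\<psi> s = (\<Oplus>\<^bsub>C\<^esub>i\<in>{..N}. \<psi> (hom_comp i s))"
      using s sum_hom_comp[OF N] hom_sum[of "{..N}" "\<lambda>i. hom_comp i s"] by simp
    also have "\<dots> = \<zero>\<^bsub>C\<^esub>"
      using hom_rad[OF radical_hom_comp[OF r] hom_comp_homogeneous[OF s]] by (intro add.finprod_one_eqI) auto
    finally show "\<psi> s = \<zero>\<^bsub>C\<^esub>" .
  qed (use s ker_radical in blast)
qed

section \<open>The Gorenstein quotient of a presented algebra\<close>

text \<open>
  Here \<open>B\<close> is the polynomial ring modulo a possibly smaller ideal than the radical of \<open>L\<close>. The image
  \<open>\<bb>\<close> of the radical is what remains to be divided out.
\<close>

locale presented_functional = poly_hom B m \<pi> + graded_functional m d L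
  for B :: "('k::field, 'c) module" (structure)
    and m and \<pi> :: "'k::field mpoly \<Rightarrow> 'c" and d and L :: "'k::field mpoly \<Rightarrow> 'k" +
  assumes surj: "\<pi> ` carrier (poly_ring m) = carrier B"
    and ker_radical: "s \<in> carrier (poly_ring m) \<Longrightarrow> \<pi> s = \<zero> \<Longrightarrow> s \<in> radical"
begin

abbreviation "\<bb> \<equiv> \<pi> ` radical"
abbreviation grB :: "nat \<Rightarrow> 'c set" where "grB i \<equiv> \<pi> ` homogeneous_polys m i"

lemma in_radical_ideal_iff: "s \<in> carrier (poly_ring m) \<Longrightarrow> \<pi> s \<in> \<bb> \<longleftrightarrow> s \<in> radical"
proof
  assume s: "s \<in> carrier (poly_ring m)" and "\<pi> s \<in> \<bb>"
  then obtain r where r: "r \<in> radical" "\<pi> s = \<pi> r" by blast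
  then have "s - r \<in> radical" using s by (intro ker_radical) (auto simp flip: hom_eq_iff)
  then show "s \<in> radical" using radical_add[OF _ r(1), of "s - r"] by simp
qed auto

lemma ideal_radical: "ideal \<bb> B"
proof (rule idealI)
  show "ring B" using M_cring by (rule cring.axioms(1))
  show "subgroup \<bb> (add_monoid B)"
  proof (rule add.subgroupI)
    show "\<bb> \<noteq> {}" using radical_zero by blast
    fix x assume x: "x \<in> \<bb>"
    then obtain r where r: "r \<in> radical" "x = \<pi> r" by blast
    then have "\<ominus> x = \<pi> (0 - r)" by (simp add: hom_uminus)
    then show "\<ominus> x \<in> \<bb>" using radical_diff[OF radical_zero r(1)] by blast
    fix y assume "y \<in> \<bb>"
    then show "x \<oplus> y \<in> \<bb>"
      using x radical_add by (auto simp flip: hom_add)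
  qed auto
  fix a x assume "a \<in> \<bb>" "x \<in> carrier B"
  then obtain r s where "r \<in> radical" "a = \<pi> r" "s \<in> carrier (poly_ring m)" "x = \<pi> s"
    unfolding surj[symmetric] by blast
  then have "a \<otimes> x = \<pi> (r * s)" "r * s \<in> radical" "a \<in> carrier B" "x \<in> carrier B" 
    by (auto simp: hom_mult intro: radical_mult)
  then show "a \<otimes> x \<in> \<bb>" "x \<otimes> a \<in> \<bb>" by (auto simp: m_comm)
qed

sublocale Q: quotient_alg B \<bb>
  by (intro quotient_alg.intro algebra_axioms ideal_radical)

lemma presentation_quotient:
  "functional_presentation (quotient_algebra B \<bb>) m (\<lambda>p. \<bb> +> \<pi> p) d L"
proof -
  interpret h: poly_hom "quotient_algebra B \<bb>" m "\<lambda>p. \<bb> +> \<pi> p"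
    by (rule Q.poly_hom_quotient) (rule poly_hom_axioms)
  show ?thesis
  proof
    show "(\<lambda>p. \<bb> +> \<pi> p) ` carrier (poly_ring m) = carrier (quotient_algebra B \<bb>)"
      unfolding quotient_algebra_simps surj[symmetric] image_image ..
    fix s :: "'k mpoly" assume s: "s \<in> carrier (poly_ring m)"
    then show "\<bb> +> \<pi> s = \<zero>\<^bsub>quotient_algebra B \<bb>\<^esub> \<longleftrightarrow> s \<in> radical"
      using Q.coset_zero_iff[of "\<pi> s"] in_radical_ideal_iff[of s] by (simp add: quotient_algebra_simps)
  qed
qed

text \<open>
  An element of \<open>J\<close> outside \<open>\<bb>\<close> has a multiple that differs from a nonzero multiple of \<open>\<pi> u\<close> by an
  element of \<open>\<bb>\<close>, hence of \<open>J\<close>.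
\<close>

lemma ideal_above_radical_contains_socle:
  assumes u: "u \<in> homogeneous_polys m d" "L u = 1" and J: "ideal J B" "\<bb> \<subset> J"
  shows "\<pi> u \<in> J"
proof -
  interpret J: ideal J B by fact
  interpret Jq: quotient_alg B J by (intro quotient_alg.intro algebra_axioms J)
  obtain x where x: "x \<in> J" "x \<notin> \<bb>" using J by blast
  then obtain s where s: "s \<in> carrier (poly_ring m)" "x = \<pi> s" using J.a_Hcarr surj by blast
  then have "s \<notin> radical" using x by blast
  then obtain j t k where t: "t \<in> homogeneous_polys m j" "k \<noteq> 0" "s * t - Const k * u \<in> radical"
    using multiple_in_socle[OF u s(1)] by metis
  have "\<pi> (s * t) \<in> J" using s x(1) t by (auto simp: hom_mult intro: J.I_r_closed)
  moreover have "\<pi> (s * t - Const k * u) \<in> J" using t J(2) by blast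
  ultimately have "\<pi> (s * t) \<ominus> \<pi> (s * t - Const k * u) \<in> J"
    unfolding M.minus_eq by (intro J.a_closed J.a_inv_closed)
  also have "\<pi> (s * t) \<ominus> \<pi> (s * t - Const k * u) = k \<odot> \<pi> u"
    using s t u by (simp flip: hom_diff hom_smult)
  finally have "(1 / k) \<odot> (k \<odot> \<pi> u) \<in> J" by (rule Jq.ideal_smult)
  then show ?thesis using u t smult_assoc1[of "1 / k" k "\<pi> u"] smult_one[of "\<pi> u"] by simp
qed

lemma irreducible_radical: "irreducible_ideal \<bb> B"
proof -
  obtain u where u: "u \<in> homogeneous_polys m d" "L u = 1" by (rule obtain_socle_generator)
  have "\<pi> u \<notin> \<bb>" using u radical_L[of u] in_radical_ideal_iff[of u] by auto
  moreover have "\<pi> u \<in> carrier B" using u by simp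
  ultimately show ?thesis
    unfolding irreducible_ideal_def
    using ideal_radical ideal_above_radical_contains_socle[OF u] by blast
qed

lemma homogeneous_radical: "homogeneous_ideal \<bb> B grB"
  unfolding homogeneous_ideal_def
proof (intro conjI ideal_radical equalityI)
  let ?S = "\<bb> \<inter> (\<Union>i. grB i)"
  show "genideal B ?S \<subseteq> \<bb>" by (rule genideal_minimal[OF ideal_radical]) simp
  interpret G: ideal "genideal B ?S" B by (rule genideal_ideal) auto
  have self: "?S \<subseteq> genideal B ?S" by (rule genideal_self) auto
  show "\<bb> \<subseteq> genideal B ?S"
  proof
    fix x assume "x \<in> \<bb>"
    then obtain s where s: "s \<in> radical" "x = \<pi> s" by blast
    then have sS: "s \<in> carrier (poly_ring m)" by simp
    obtain N where N: "\<And>k. k > N \<Longrightarrow> hom_comp k s = 0" using hom_comp_eventually_0[of s] by blast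
    have comp: "\<pi> (hom_comp i s) \<in> genideal B ?S" for i
      using radical_hom_comp[OF s(1), of i] hom_comp_homogeneous[OF sS, of i] self by blast
    have "\<pi> (\<Sum>i\<le>k. hom_comp i s) \<in> genideal B ?S" for k
    proof (induction k)
      case 0
      then show ?case using comp[of 0] by simp
    next
      case (Suc k)
      then show ?case using comp[of "Suc k"] sS by (simp add: hom_add polys_sum)
    qed
    then show "x \<in> genideal B ?S" using s sum_hom_comp[OF N] by metis
  qed
qed

theorem gorenstein_quotient_radical: "gorenstein_quotient_ideal \<bb> B grB d"
proof -
  interpret Q: functional_presentation "quotient_algebra B \<bb>" m "\<lambda>p. \<bb> +> \<pi> p" d L
    by (rule presentation_quotient)
  have "quotient_grading B grB \<bb> = Q.gr"
    by (rule ext) (simp add: quotient_grading_def image_image)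
  then show ?thesis
    unfolding gorenstein_quotient_ideal_def
    using homogeneous_radical irreducible_radical Q.gorenstein Q.socle_degree by simp
qed

end

section \<open>Polynomials as differential operators\<close>

text \<open>
  Additive identities between polynomials reduce to monomials; bilinear ones by two nested
  applications.
\<close>

lemma poly_mapping_additive_induct [case_names single add]:
  assumes single: "\<And>a c. P (Poly_Mapping.single a c)" and add: "\<And>p q. P p \<Longrightarrow> P q \<Longrightarrow> P (p + q)"
  shows "P (p :: 'a \<Rightarrow>\<^sub>0 'b::comm_monoid_add)"
proof -
  have zero: "P 0" using single[of _ 0] by simp
  have "P (\<Sum>a\<in>X. Poly_Mapping.single a (Poly_Mapping.lookup p a))" if "finite X" for X
    using that by (induction X rule: finite_induct) (auto simp: zero intro: single add)
  from this[of "Poly_Mapping.keys p"] show ?thesis by (simp add: sum_monomials)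
qed

lemma partial_deriv_superset:
  assumes "finite X" "Poly_Mapping.keys p \<subseteq> X"
  shows "partial_deriv i p = (\<Sum>a\<in>X. Poly_Mapping.single (a - Poly_Mapping.single i 1)
       (of_nat (Poly_Mapping.lookup a i) * Poly_Mapping.lookup p a))"
  unfolding partial_deriv_def using assms by (intro sum.mono_neutral_left) (auto simp: in_keys_iff)

lemma partial_deriv_add [simp]: "partial_deriv i (p + q) = partial_deriv i p + partial_deriv i q"
proof -
  let ?X = "Poly_Mapping.keys p \<union> Poly_Mapping.keys q"
  show ?thesis
    using partial_deriv_superset[of ?X p i] partial_deriv_superset[of ?X q i]
      partial_deriv_superset[of ?X "p + q" i] keys_add[of p q]
    by (simp add: lookup_add distrib_left single_add sum.distrib)
qed

lemma partial_deriv_single [simp]: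
  "partial_deriv i (Poly_Mapping.single b c) =
    Poly_Mapping.single (b - Poly_Mapping.single i 1) (of_nat (Poly_Mapping.lookup b i) * c)"
  by (subst partial_deriv_superset[of "{b}"]) auto

lemma partial_deriv_zero [simp]: "partial_deriv i 0 = 0"
  by (simp add: partial_deriv_def)

lemma partial_deriv_sum: "partial_deriv i (sum f X) = (\<Sum>x\<in>X. partial_deriv i (f x))"
  by (induction X rule: infinite_finite_induct) auto

lemma partial_deriv_mult:
  "partial_deriv i (p * q) = partial_deriv i p * q + p * partial_deriv i q"
proof (induction p rule: poly_mapping_additive_induct)
  case (single a c)
  show ?case
  proof (induction q rule: poly_mapping_additive_induct)
    case (single b e)
    \<comment> \<open>For exponent \<open>0\<close> the truncated exponents of the two sides may differ, but both coefficients vanish.\<close>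
    have l: "Poly_Mapping.single (a + b - Poly_Mapping.single i 1) (of_nat (Poly_Mapping.lookup a i) * (c * e)) =
        Poly_Mapping.single (a - Poly_Mapping.single i 1 + b) (of_nat (Poly_Mapping.lookup a i) * (c * e))"
    proof (cases "Poly_Mapping.lookup a i = 0")
      case False
      then have "a + b - Poly_Mapping.single i 1 = a - Poly_Mapping.single i 1 + b"
        by (intro poly_mapping_eqI) (auto simp: lookup_add lookup_minus lookup_single when_def)
      then show ?thesis by simp
    qed simp
    have r: "Poly_Mapping.single (a + b - Poly_Mapping.single i 1) (of_nat (Poly_Mapping.lookup b i) * (c * e)) =
        Poly_Mapping.single (a + (b - Poly_Mapping.single i 1)) (of_nat (Poly_Mapping.lookup b i) * (c * e))"
    proof (cases "Poly_Mapping.lookup b i = 0")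
      case False
      then have "a + b - Poly_Mapping.single i 1 = a + (b - Poly_Mapping.single i 1)"
        by (intro poly_mapping_eqI) (auto simp: lookup_add lookup_minus lookup_single when_def)
      then show ?thesis by simp
    qed simp
    have "partial_deriv i (Poly_Mapping.single a c * Poly_Mapping.single b e) =
      Poly_Mapping.single (a + b - Poly_Mapping.single i 1) (of_nat (Poly_Mapping.lookup a i) * (c * e)) +
      Poly_Mapping.single (a + b - Poly_Mapping.single i 1) (of_nat (Poly_Mapping.lookup b i) * (c * e))"
      by (simp add: mult_single lookup_add distrib_right flip: single_add)
    then show ?case unfolding l r by (simp add: mult_single ac_simps)
  qed (simp add: algebra_simps)
qed (simp add: algebra_simps)

text \<open>
  The product over all variables of the falling factorials \<open>b\<^sub>i (b\<^sub>i - 1) \<dots> (b\<^sub>i - a\<^sub>i + 1)\<close>, which is the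
  coefficient of \<open>\<partial>\<^sup>a x\<^sup>b\<close>. Truncated subtraction is harmless: if \<open>a\<^sub>i > b\<^sub>i\<close>, then the factor with
  \<open>l = b\<^sub>i\<close> is zero.
\<close>

definition deriv_coeff :: "(nat \<Rightarrow>\<^sub>0 nat) \<Rightarrow> (nat \<Rightarrow>\<^sub>0 nat) \<Rightarrow> 'k::field" where
  "deriv_coeff a b = (\<Prod>i\<in>Poly_Mapping.keys a. \<Prod>l<Poly_Mapping.lookup a i. of_nat (Poly_Mapping.lookup b i - l))"

lemma deriv_coeff_superset:
  assumes "finite X" "Poly_Mapping.keys a \<subseteq> X"
  shows "deriv_coeff a b = (\<Prod>i\<in>X. \<Prod>l<Poly_Mapping.lookup a i. of_nat (Poly_Mapping.lookup b i - l))"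
  unfolding deriv_coeff_def using assms by (intro prod.mono_neutral_left) (auto simp: in_keys_iff)

lemma deriv_coeff_0 [simp]: "deriv_coeff 0 b = 1"
  by (simp add: deriv_coeff_def)

lemma deriv_coeff_add: "deriv_coeff (a + a') b = (deriv_coeff a' b * deriv_coeff a (b - a') :: 'k::field)"
proof -
  let ?X = "Poly_Mapping.keys a \<union> Poly_Mapping.keys a'"
  have split: "(\<Prod>l<x + y. of_nat (n - l)) = (\<Prod>l<y. of_nat (n - l)) * (\<Prod>l<x. of_nat (n - y - l) :: 'k::field)" for x y n :: nat
    by (induction x) (simp_all add: ac_simps)
  have "deriv_coeff (a + a') b = (\<Prod>i\<in>?X. (\<Prod>l<Poly_Mapping.lookup a' i. of_nat (Poly_Mapping.lookup b i - l)) *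
       (\<Prod>l<Poly_Mapping.lookup a i. of_nat (Poly_Mapping.lookup b i - Poly_Mapping.lookup a' i - l) :: 'k))"
    by (subst deriv_coeff_superset[of ?X]) (auto simp: keys_add_nat lookup_add split)
  then show ?thesis by (simp add: deriv_coeff_superset[of ?X] prod.distrib lookup_minus)
qed

lemma deriv_coeff_nonzero_le:
  assumes nz: "deriv_coeff a b \<noteq> (0 :: 'k::field)"
  shows "Poly_Mapping.lookup a i \<le> Poly_Mapping.lookup b i"
proof (rule ccontr)
  assume less: "\<not> Poly_Mapping.lookup a i \<le> Poly_Mapping.lookup b i"
  have zero: "(\<Prod>l<Poly_Mapping.lookup a i. of_nat (Poly_Mapping.lookup b i - l) :: 'k) = 0"
    using less by (intro prod_zero bexI[of _ "Poly_Mapping.lookup b i"]) auto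
  then have "deriv_coeff a b = (0 :: 'k)"
    unfolding deriv_coeff_def using less by (intro prod_zero[OF finite_keys] bexI[of _ i] zero) (simp add: in_keys_iff)
  then show False using nz by simp
qed

text \<open>
  The value is \<open>a!\<close>, a product of integers between \<open>1\<close> and \<open>d\<close>. None of them is divisible by the
  characteristic.
\<close>

lemma deriv_coeff_self_nonzero:
  assumes "CHAR('k) = 0 \<or> CHAR('k) > d" "mdeg a \<le> d"
  shows "deriv_coeff a a \<noteq> (0 :: 'k::field)"
proof -
  have "of_nat (Poly_Mapping.lookup a i - l) \<noteq> (0 :: 'k)"
    if "i \<in> Poly_Mapping.keys a" "l < Poly_Mapping.lookup a i" for i l
  proof
    let ?k = "Poly_Mapping.lookup a i - l"
    assume "of_nat ?k = (0 :: 'k)"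
    then have "CHAR('k) dvd ?k" by (simp add: of_nat_eq_0_iff_char_dvd)
    moreover have "?k > 0" "?k \<le> mdeg a"
    proof -
      have "Poly_Mapping.lookup a i \<le> mdeg a"
        unfolding mdeg_def using that by (intro member_le_sum) auto
      then show "?k > 0" "?k \<le> mdeg a" using that by auto
    qed
    ultimately show False using assms by (auto dest: dvd_imp_le)
  qed
  then show ?thesis by (auto simp: deriv_coeff_def)
qed

lemma partial_deriv_pow_single:
  "(partial_deriv i ^^ k) (Poly_Mapping.single b c) =
    Poly_Mapping.single (b - Poly_Mapping.single i k) ((\<Prod>l<k. of_nat (Poly_Mapping.lookup b i - l)) * c)"
proof (induction k)
  case (Suc k)
  have "b - Poly_Mapping.single i k - Poly_Mapping.single i 1 = b - Poly_Mapping.single i (Suc k)"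
    by (intro poly_mapping_eqI) (auto simp: lookup_minus lookup_single when_def)
  then show ?case by (simp add: Suc lookup_minus ac_simps)
qed simp

text \<open>
  Derivatives in distinct variables act on distinct exponents, so each factor of the coefficient
  can be computed from the original exponent, whatever the order of composition.
\<close>

lemma monomial_deriv_single:
  fixes c :: "'k::field"
  shows "monomial_deriv a (Poly_Mapping.single b c) = Poly_Mapping.single (b - a) (deriv_coeff a b * c)"
proof -
  have "fold (\<lambda>i. partial_deriv i ^^ Poly_Mapping.lookup a i) xs (Poly_Mapping.single b c) =
      Poly_Mapping.single (b - (\<Sum>i\<in>set xs. Poly_Mapping.single i (Poly_Mapping.lookup a i)))
        ((\<Prod>i\<in>set xs. \<Prod>l<Poly_Mapping.lookup a i. of_nat (Poly_Mapping.lookup b i - l)) * c)"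
    if "distinct xs" for xs
    using that
  proof (induction xs arbitrary: b c)
    case (Cons x xs)
    let ?b = "b - Poly_Mapping.single x (Poly_Mapping.lookup a x)"
    have *: "(\<Prod>i\<in>set xs. \<Prod>l<Poly_Mapping.lookup a i. of_nat (Poly_Mapping.lookup ?b i - l)) =
      (\<Prod>i\<in>set xs. \<Prod>l<Poly_Mapping.lookup a i. of_nat (Poly_Mapping.lookup b i - l) :: 'k)"
      using Cons.prems by (intro prod.cong) (auto simp: lookup_minus lookup_single when_def)
    have "?b - (\<Sum>i\<in>set xs. Poly_Mapping.single i (Poly_Mapping.lookup a i)) =
      b - (\<Sum>i\<in>set (x # xs). Poly_Mapping.single i (Poly_Mapping.lookup a i))"
      using Cons.prems by (intro poly_mapping_eqI) (simp add: lookup_minus lookup_add)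
    then show ?case using Cons by (simp add: partial_deriv_pow_single * ac_simps)
  qed simp
  from this[of "sorted_list_of_set (Poly_Mapping.keys a)"] show ?thesis
    by (simp add: monomial_deriv_def deriv_coeff_def sum_monomials)
qed

lemma additive_power:
  fixes f :: "'a::plus \<Rightarrow> 'a"
  assumes "\<And>p q. f (p + q) = f p + f q"
  shows "(f ^^ k) (p + q) = (f ^^ k) p + (f ^^ k) q"
  by (induction k) (simp_all add: assms)

lemma monomial_deriv_add [simp]: "monomial_deriv a (p + q) = monomial_deriv a p + monomial_deriv a q"
proof -
  have "fold (\<lambda>i. partial_deriv i ^^ Poly_Mapping.lookup a i) xs (p + q) =
      fold (\<lambda>i. partial_deriv i ^^ Poly_Mapping.lookup a i) xs p +
      fold (\<lambda>i. partial_deriv i ^^ Poly_Mapping.lookup a i) xs q" for xs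
    by (induction xs arbitrary: p q) (simp_all add: additive_power)
  then show ?thesis by (simp add: monomial_deriv_def)
qed

lemma monomial_deriv_zero [simp]: "monomial_deriv a 0 = 0"
  using monomial_deriv_single[of a 0 0] by simp

lemma diff_action_superset:
  assumes "finite X" "Poly_Mapping.keys f \<subseteq> X"
  shows "diff_action f F = (\<Sum>a\<in>X. Const (Poly_Mapping.lookup f a) * monomial_deriv a F)"
  unfolding diff_action_def using assms by (intro sum.mono_neutral_left) (auto simp: in_keys_iff)

lemma diff_action_add_left [simp]: "diff_action (f + g) F = diff_action f F + diff_action g F"
proof -
  let ?X = "Poly_Mapping.keys f \<union> Poly_Mapping.keys g"
  show ?thesis
    using diff_action_superset[of ?X f F] diff_action_superset[of ?X g F]
      diff_action_superset[of ?X "f + g" F] keys_add[of f g]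
    by (simp add: lookup_add distrib_right sum.distrib)
qed

lemma diff_action_add_right [simp]: "diff_action f (F + G) = diff_action f F + diff_action f G"
  by (simp add: diff_action_def distrib_left sum.distrib)

lemma diff_action_zero [simp]: "diff_action 0 F = 0" "diff_action f 0 = 0"
  by (simp_all add: diff_action_def)

lemma diff_action_single:
  "diff_action (Poly_Mapping.single a c) (Poly_Mapping.single b e) =
    Poly_Mapping.single (b - a) (c * (deriv_coeff a b * e))"
  by (subst diff_action_superset[of "{a}"]) (auto simp: monomial_deriv_single Const_def mult_single)

lemma diff_action_Const: "diff_action (Const c) F = Const c * F"
proof (induction F rule: poly_mapping_additive_induct)
  case (single b e)
  then show ?case by (simp add: Const_def diff_action_single mult_single)
qed (simp add: distrib_left)

lemma diff_action_Var: "diff_action (Var i) F = partial_deriv i F"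
proof (induction F rule: poly_mapping_additive_induct)
  case (single b e)
  then show ?case by (simp add: Var_def diff_action_single deriv_coeff_def)
qed simp

text \<open>
  Multiplication of polynomials becomes composition of operators. On monomials this is the splitting
  of the falling factorials.
\<close>

lemma diff_action_mult: "diff_action (f * g) F = diff_action f (diff_action g F)"
proof (induction f rule: poly_mapping_additive_induct)
  case (single a c)
  show ?case
  proof (induction g rule: poly_mapping_additive_induct)
    case (single a' c')
    show ?case
    proof (induction F rule: poly_mapping_additive_induct)
      case (single b e)
      have "b - (a + a') = b - a' - a"
        by (intro poly_mapping_eqI) (simp add: lookup_minus lookup_add)
      then have "diff_action (Poly_Mapping.single a c * Poly_Mapping.single a' c') (Poly_Mapping.single b e) =
          Poly_Mapping.single (b - a' - a) (c * c' * (deriv_coeff a' b * deriv_coeff a (b - a') * e))"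
        by (simp add: mult_single diff_action_single deriv_coeff_add)
      then show ?case by (simp add: diff_action_single mult.assoc mult.left_commute)
    qed simp
  qed (simp add: distrib_left)
qed (simp add: distrib_right)

lemma diff_action_diff_left: "diff_action (f - g) F = diff_action f F - diff_action g F"
  using diff_action_add_left[of "f - g" g F] by (simp add: algebra_simps)

lemma diff_action_sum_left: "diff_action (sum f X) F = (\<Sum>x\<in>X. diff_action (f x) F)"
  by (induction X rule: infinite_finite_induct) auto

lemma keys_diff_action:
  fixes f :: "'k::field mpoly"
  assumes "b \<in> Poly_Mapping.keys (diff_action f F)"
  shows "\<exists>a\<in>Poly_Mapping.keys f. \<exists>c\<in>Poly_Mapping.keys F. b = c - a \<and> deriv_coeff a c \<noteq> (0 :: 'k)"
proof -
  have "diff_action f F = (\<Sum>a\<in>Poly_Mapping.keys f. \<Sum>c\<in>Poly_Mapping.keys F.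
      Poly_Mapping.single (c - a) (Poly_Mapping.lookup f a * (deriv_coeff a c * Poly_Mapping.lookup F c)))"
  proof -
    have "diff_action g F = (\<Sum>c\<in>Poly_Mapping.keys F. diff_action g (Poly_Mapping.single c (Poly_Mapping.lookup F c)))" for g
    proof -
      have "diff_action g (sum h X) = (\<Sum>x\<in>X. diff_action g (h x))" for h :: "(nat \<Rightarrow>\<^sub>0 nat) \<Rightarrow> 'k mpoly" and X
        by (induction X rule: infinite_finite_induct) auto
      then show ?thesis by (metis sum_monomials)
    qed
    moreover have "diff_action f F = (\<Sum>a\<in>Poly_Mapping.keys f. diff_action (Poly_Mapping.single a (Poly_Mapping.lookup f a)) F)"
      by (metis sum_monomials diff_action_sum_left)
    ultimately show ?thesis by (simp add: diff_action_single)
  qed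
  then obtain a where a: "a \<in> Poly_Mapping.keys f" "b \<in> Poly_Mapping.keys (\<Sum>c\<in>Poly_Mapping.keys F.
      Poly_Mapping.single (c - a) (Poly_Mapping.lookup f a * (deriv_coeff a c * Poly_Mapping.lookup F c)))"
    using assms subsetD[OF keys_sum] by fastforce
  then obtain c where "c \<in> Poly_Mapping.keys F" "b \<in> Poly_Mapping.keys
      (Poly_Mapping.single (c - a) (Poly_Mapping.lookup f a * (deriv_coeff a c * Poly_Mapping.lookup F c)))"
    using subsetD[OF keys_sum] by fastforce
  then show ?thesis using a by (auto split: if_splits)
qed

lemma diff_action_polys [simp]:
  assumes "F \<in> carrier (poly_ring n)" shows "diff_action f F \<in> carrier (poly_ring n)"
proof -
  have "Poly_Mapping.keys (c - a) \<subseteq> Poly_Mapping.keys c" for a c :: "nat \<Rightarrow>\<^sub>0 nat"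
    by (auto simp: in_keys_iff lookup_minus)
  then show ?thesis using assms keys_diff_action[of _ f F] by (fastforce simp: in_polys_iff)
qed

text \<open>
  A monomial \<open>x\<^sup>c\<close> survives \<open>\<partial>\<^sup>a\<close> only if \<open>x\<^sup>a\<close> divides it, which in equal degrees forces \<open>a = c\<close>.
\<close>

lemma diff_action_same_degree:
  assumes "f \<in> homogeneous_polys n d" "F \<in> homogeneous_polys n' d"
  shows "diff_action f F = Const (Poly_Mapping.lookup (diff_action f F) 0)"
proof (rule poly_mapping_eqI)
  fix b
  have "b = 0" if b: "b \<in> Poly_Mapping.keys (diff_action f F)"
  proof -
    obtain a c where ac: "a \<in> Poly_Mapping.keys f" "c \<in> Poly_Mapping.keys F" "b = c - a" "deriv_coeff a c \<noteq> (0 :: 'a)"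
      using keys_diff_action[OF b] by blast
    have "c = a + (c - a)" using deriv_coeff_nonzero_le[OF ac(4)] by (intro poly_mapping_eqI) (simp add: lookup_add lookup_minus)
    then have "mdeg c = mdeg a + mdeg b" using ac(3) by (metis mdeg_add)
    then show "b = 0" using ac assms by (simp add: homogeneous_iff)
  qed
  then show "Poly_Mapping.lookup (diff_action f F) b =
      Poly_Mapping.lookup (Const (Poly_Mapping.lookup (diff_action f F) 0)) b"
    by (auto simp: Const_def lookup_single when_def in_keys_iff)
qed

text \<open>
  In the constant term, \<open>\<partial>\<^sup>a\<close> meets only \<open>x\<^sup>a\<close>, and the pairing of polynomials is diagonal in the
  monomials.
\<close>

lemma lookup_diff_action_0:
  "Poly_Mapping.lookup (diff_action f F) 0 =
    (\<Sum>a\<in>Poly_Mapping.keys f. Poly_Mapping.lookup f a * deriv_coeff a a * Poly_Mapping.lookup F a)"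
proof -
  have single: "Poly_Mapping.lookup (diff_action (Poly_Mapping.single a c) F) 0 = c * deriv_coeff a a * Poly_Mapping.lookup F a" for a c
  proof (induction F rule: poly_mapping_additive_induct)
    case (single b e)
    have "a = b" if "b - a = 0" "deriv_coeff a b \<noteq> (0 :: 'a)"
    proof (rule poly_mapping_eqI)
      fix i
      have "Poly_Mapping.lookup (b - a) i = 0" using that(1) by simp
      then show "Poly_Mapping.lookup a i = Poly_Mapping.lookup b i"
        using deriv_coeff_nonzero_le[OF that(2), of i] by (simp add: lookup_minus)
    qed
    then show ?case
      by (auto simp: diff_action_single lookup_single when_def)
  qed (simp add: lookup_add distrib_left)
  have "diff_action f F = (\<Sum>a\<in>Poly_Mapping.keys f. diff_action (Poly_Mapping.single a (Poly_Mapping.lookup f a)) F)"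
    by (metis sum_monomials diff_action_sum_left)
  then show ?thesis by (simp add: lookup_sum single)
qed

section \<open>Linear substitutions and the chain rule\<close>

lemma finsum_poly_ring:
  fixes f :: "'i \<Rightarrow> 'k::field mpoly"
  assumes "\<And>x. x \<in> X \<Longrightarrow> f x \<in> carrier (poly_ring n)"
  shows "finsum (poly_ring n) f X = sum f X"
proof -
  interpret algebra "class_ring :: 'k ring" "poly_ring n" by (rule algebra_poly_ring)
  show ?thesis using assms
    by (induction X rule: infinite_finite_induct) (auto simp: finsum_infinite)
qed

lemma finprod_poly_ring:
  fixes f :: "'i \<Rightarrow> 'k::field mpoly"
  assumes "\<And>x. x \<in> X \<Longrightarrow> f x \<in> carrier (poly_ring n)"
  shows "finprod (poly_ring n) f X = prod f X"
proof -
  interpret algebra "class_ring :: 'k ring" "poly_ring n" by (rule algebra_poly_ring)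
  show ?thesis using assms
    by (induction X rule: infinite_finite_induct) (auto simp: finprod_infinite)
qed

lemma nat_pow_poly_ring: "p [^]\<^bsub>poly_ring n\<^esub> (k :: nat) = (p :: 'k::field mpoly) ^ k"
  by (induction k) (simp_all add: nat_pow_def ac_simps)

lemma polys_power [simp]: "p \<in> carrier (poly_ring n) \<Longrightarrow> p ^ k \<in> carrier (poly_ring n)"
  by (induction k) auto

lemma polys_prod: "(\<And>i. i \<in> I \<Longrightarrow> f i \<in> carrier (poly_ring n)) \<Longrightarrow> prod f I \<in> carrier (poly_ring n)"
  by (induction I rule: infinite_finite_induct) auto

lemma substitute_eq_eval_poly:
  assumes \<sigma>: "\<And>j. j < n \<Longrightarrow> \<sigma> j \<in> carrier (poly_ring m)" and F: "F \<in> carrier (poly_ring n)"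
  shows "substitute \<sigma> F = eval_poly (poly_ring m) n \<sigma> F"
proof -
  have "(\<Otimes>\<^bsub>poly_ring m\<^esub>i\<in>{..<n}. \<sigma> i [^]\<^bsub>poly_ring m\<^esub> Poly_Mapping.lookup a i) =
      (\<Prod>i<n. \<sigma> i ^ Poly_Mapping.lookup a i)" for a :: "nat \<Rightarrow>\<^sub>0 nat"
    unfolding nat_pow_poly_ring using \<sigma> by (intro finprod_poly_ring) auto
  also have "(\<Prod>i<n. \<sigma> i ^ Poly_Mapping.lookup a i) = (\<Prod>i\<in>Poly_Mapping.keys a. \<sigma> i ^ Poly_Mapping.lookup a i)"
    if "a \<in> Poly_Mapping.keys F" for a
    using F that by (intro prod.mono_neutral_right) (auto simp: in_polys_iff in_keys_iff)
  finally have *: "(\<Otimes>\<^bsub>poly_ring m\<^esub>i\<in>{..<n}. \<sigma> i [^]\<^bsub>poly_ring m\<^esub> Poly_Mapping.lookup a i) =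
      (\<Prod>i\<in>Poly_Mapping.keys a. \<sigma> i ^ Poly_Mapping.lookup a i)" if "a \<in> Poly_Mapping.keys F" for a
    using that .
  have mem: "(\<Prod>i\<in>Poly_Mapping.keys a. \<sigma> i ^ Poly_Mapping.lookup a i) \<in> carrier (poly_ring m)"
    if "a \<in> Poly_Mapping.keys F" for a
  proof (intro polys_prod polys_power \<sigma>)
    show "i < n" if "i \<in> Poly_Mapping.keys a" for i using F \<open>a \<in> Poly_Mapping.keys F\<close> that by (auto simp: in_polys_iff)
  qed
  have "eval_poly (poly_ring m) n \<sigma> F = (\<Sum>a\<in>Poly_Mapping.keys F. Const (Poly_Mapping.lookup F a) *
       (\<Otimes>\<^bsub>poly_ring m\<^esub>i\<in>{..<n}. \<sigma> i [^]\<^bsub>poly_ring m\<^esub> Poly_Mapping.lookup a i))"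
    unfolding eval_poly_def poly_ring_ops using * mem by (intro finsum_poly_ring) simp
  then show ?thesis unfolding substitute_def using * by simp
qed

lemma poly_hom_substitute:
  assumes \<sigma>: "\<And>j. j < n \<Longrightarrow> \<sigma> j \<in> carrier (poly_ring m)"
  shows "poly_hom (poly_ring m) n (substitute \<sigma>)"
    and "j < n \<Longrightarrow> substitute \<sigma> (Var j) = \<sigma> j"
proof -
  interpret e: poly_hom "poly_ring m" n "eval_poly (poly_ring m) n \<sigma>"
    by (rule poly_hom_eval_poly(1)[OF algebra_poly_ring \<sigma>])
  have eq: "substitute \<sigma> p = eval_poly (poly_ring m) n \<sigma> p" if "p \<in> carrier (poly_ring n)" for p
    using substitute_eq_eval_poly[OF \<sigma> that] by simp
  show "poly_hom (poly_ring m) n (substitute \<sigma>)"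
  proof
    show "substitute \<sigma> p \<in> carrier (poly_ring m)" if "p \<in> carrier (poly_ring n)" for p
      using that by (simp add: eq)
  qed (simp_all only: eq polys_add polys_mult polys_basic e.hom_add e.hom_mult e.hom_Const)
  show "substitute \<sigma> (Var j) = \<sigma> j" if "j < n"
    using that eq[of "Var j"] poly_hom_eval_poly(2)[OF algebra_poly_ring \<sigma> that] by simp
qed

lemma substitute_homogeneous:
  assumes \<sigma>: "\<And>j. j < n \<Longrightarrow> \<sigma> j \<in> homogeneous_polys m 1" and p: "p \<in> homogeneous_polys n d"
  shows "substitute \<sigma> p \<in> homogeneous_polys m d"
proof -
  interpret poly_hom "poly_ring m" n "substitute \<sigma>" using \<sigma> by (intro poly_hom_substitute) auto
  have "substitute \<sigma> ` homogeneous_polys n d \<subseteq> homogeneous_polys m d"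
  proof (rule hom_homogeneous)
    show "subspace class_ring (homogeneous_polys m i) (poly_ring m)" for i
      by (rule algebra_subspaceI[OF algebra_poly_ring]) auto
    show "substitute \<sigma> (Var j) \<in> homogeneous_polys m 1" if "j < n" for j
      using \<sigma>[OF that] poly_hom_substitute(2)[of n \<sigma> m j, OF homogeneous_polys[OF \<sigma>] that] by simp
  qed (auto intro: homogeneous_mult)
  then show ?thesis using p by blast
qed

text \<open>
  The matrix \<open>c\<close> defines a substitution in each direction: \<open>\<sigma>\<close> replaces \<open>x\<^sub>j\<close> by the linear form in \<open>y\<close>
  with the entries of column \<open>j\<close>, and \<open>\<tau>\<close> replaces \<open>y\<^sub>i\<close> by the linear form in \<open>x\<close> with the entries of row
  \<open>i\<close>. The first acts on dual generators, the second on differential operators.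
\<close>

locale linear_substitution =
  fixes m n :: nat and c :: "nat \<Rightarrow> nat \<Rightarrow> 'k::field"
begin

definition \<sigma> :: "nat \<Rightarrow> 'k mpoly" where "\<sigma> j = (\<Sum>i<m. Const (c i j) * Var i)"
definition \<tau> :: "nat \<Rightarrow> 'k mpoly" where "\<tau> i = (\<Sum>j<n. Const (c i j) * Var j)"

lemma \<sigma>_homogeneous: "\<sigma> j \<in> homogeneous_polys m 1"
  unfolding \<sigma>_def by (intro homogeneous_sum) auto

lemma \<tau>_homogeneous: "\<tau> i \<in> homogeneous_polys n 1"
  unfolding \<tau>_def by (intro homogeneous_sum) auto

sublocale S: poly_hom "poly_ring m" n "substitute \<sigma>"
  using \<sigma>_homogeneous by (intro poly_hom_substitute) auto

sublocale T: poly_hom "poly_ring n" m "substitute \<tau>"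
  using \<tau>_homogeneous by (intro poly_hom_substitute) auto

lemma substitute_\<sigma>_Var: "j < n \<Longrightarrow> substitute \<sigma> (Var j) = \<sigma> j"
  using \<sigma>_homogeneous by (intro poly_hom_substitute) auto

lemma substitute_\<tau>_Var: "i < m \<Longrightarrow> substitute \<tau> (Var i) = \<tau> i"
  using \<tau>_homogeneous by (intro poly_hom_substitute) auto

lemma partial_deriv_linear_form:
  fixes f :: "nat \<Rightarrow> 'k"
  shows "partial_deriv i (\<Sum>j\<in>X. Const (f j) * Var j) = (\<Sum>j\<in>X. Const (f j) when i = j)"
proof -
  have "partial_deriv i (Const e * Var j) = (Const e when i = j)" for e :: 'k and j
    by (auto simp: Const_def Var_def mult_single lookup_single when_def)
  then show ?thesis unfolding partial_deriv_sum by (intro sum.cong) simp_all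
qed

text \<open>
  The chain rule for a linear substitution. Both sides are derivations along the homomorphism
  \<open>substitute \<sigma>\<close>, so they agree once they agree on variables.
\<close>

lemma partial_deriv_substitute:
  assumes "F \<in> carrier (poly_ring n)" "i < m"
  shows "partial_deriv i (substitute \<sigma> F) = (\<Sum>j<n. Const (c i j) * substitute \<sigma> (partial_deriv j F))"
  using assms(1)
proof (induction F rule: mpoly_induct)
  case (Const e)
  have "partial_deriv j (Const e) = 0" for j and e :: 'k by (simp add: Const_def)
  then show ?case by (simp add: S.hom_Const S.hom_zero)
next
  case (Var j)
  have v: "partial_deriv j' (Var j :: 'k mpoly) = (1 when j' = j)" for j'
    using partial_deriv_linear_form[of j' "\<lambda>_. 1" "{j}"] by simp
  have "(\<Sum>j'<n. Const (c i j') * substitute \<sigma> (1 when j' = j)) = (\<Sum>j'<n. if j' = j then Const (c i j') else 0)"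
    by (intro sum.cong) (auto simp: when_def S.hom_one S.hom_zero)
  also have "\<dots> = Const (c i j)" using Var by simp
  finally have r: "(\<Sum>j'<n. Const (c i j') * substitute \<sigma> (1 when j' = j)) = Const (c i j)" .
  have "partial_deriv i (\<sigma> j) = (\<Sum>i'<m. Const (c i' j) when i = i')"
    unfolding \<sigma>_def by (rule partial_deriv_linear_form)
  also have "\<dots> = (\<Sum>i'<m. if i' = i then Const (c i' j) else 0)" by (intro sum.cong) (auto simp: when_def)
  also have "\<dots> = Const (c i j)" using assms(2) by simp
  finally show ?case using Var r by (simp add: v substitute_\<sigma>_Var)
next
  case (add p q)
  have pd: "partial_deriv j p \<in> carrier (poly_ring n)" "partial_deriv j q \<in> carrier (poly_ring n)" for j
    using add diff_action_polys[of _ n "Var j"] by (simp_all add: diff_action_Var)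
  show ?case using add pd by (simp add: S.hom_add distrib_left sum.distrib)
next
  case (mult p q)
  have pd: "partial_deriv j p \<in> carrier (poly_ring n)" "partial_deriv j q \<in> carrier (poly_ring n)" for j
    using mult diff_action_polys[of _ n "Var j"] by (simp_all add: diff_action_Var)
  show ?case
    using mult pd
    by (simp add: S.hom_mult S.hom_add partial_deriv_mult distrib_left sum.distrib sum_distrib_left sum_distrib_right ac_simps)
qed

text \<open>
  The chain rule passes from first derivatives to all operators, since products of operators are
  compositions.
\<close>

lemma diff_action_substitute:
  assumes "s \<in> carrier (poly_ring m)" "F \<in> carrier (poly_ring n)"
  shows "diff_action s (substitute \<sigma> F) = substitute \<sigma> (diff_action (substitute \<tau> s) F)"
  using assms
proof (induction s arbitrary: F rule: mpoly_induct)
  case (Const e)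
  have "substitute \<sigma> (Const e * F) = Const e * substitute \<sigma> F" using Const S.hom_smult[of F e] by simp
  then show ?case using T.hom_Const[of e] by (simp add: diff_action_Const)
next
  case (Var i)
  have pd: "partial_deriv j F \<in> carrier (poly_ring n)" for j
    using Var diff_action_polys[of F n "Var j"] by (simp add: diff_action_Var)
  have "substitute \<sigma> (diff_action (\<tau> i) F) = substitute \<sigma> (\<Sum>j<n. Const (c i j) * partial_deriv j F)"
    by (simp add: \<tau>_def diff_action_sum_left diff_action_mult diff_action_Const diff_action_Var)
  also have "\<dots> = (\<Sum>j<n. substitute \<sigma> (Const (c i j) * partial_deriv j F))"
    using pd by (subst S.hom_sum) (auto intro!: finsum_poly_ring)
  also have "\<dots> = (\<Sum>j<n. Const (c i j) * substitute \<sigma> (partial_deriv j F))"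
    using pd by (simp add: S.hom_smult)
  finally show ?case using Var by (simp add: substitute_\<tau>_Var diff_action_Var partial_deriv_substitute)
next
  case (add p q)
  then show ?case by (simp add: T.hom_add S.hom_add)
next
  case (mult p q)
  then show ?case by (simp add: T.hom_mult diff_action_mult)
qed

text \<open>
  In the top degree the right hand side of the chain rule is a constant, on which the substitution
  does nothing.
\<close>

lemma diff_action_substitute_top:
  assumes "s \<in> homogeneous_polys m d" "F \<in> homogeneous_polys n d"
  shows "diff_action s (substitute \<sigma> F) = diff_action (substitute \<tau> s) F"
proof -
  have "substitute \<tau> s \<in> homogeneous_polys n d"
    using \<tau>_homogeneous assms(1) by (intro substitute_homogeneous) auto
  then obtain e where e: "diff_action (substitute \<tau> s) F = Const e"
    using diff_action_same_degree assms(2) by blast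
  then show ?thesis using assms diff_action_substitute[of s F] S.hom_Const[of e] by simp
qed

end

section \<open>Annihilators as radicals\<close>

text \<open>
  For a form \<open>G\<close> and forms \<open>p\<close> of the same degree this is the apolarity pairing.
\<close>

definition apolar :: "'k::field mpoly \<Rightarrow> 'k mpoly \<Rightarrow> 'k" where
  "apolar G p = Poly_Mapping.lookup (diff_action p G) 0"

lemma graded_functional_apolar:
  assumes G: "G \<in> homogeneous_polys m d" and "\<exists>u\<in>carrier (poly_ring m). apolar G u \<noteq> 0"
  shows "graded_functional m d (apolar G)"
proof
  fix p q :: "'a mpoly" and e
  show "apolar G (p + q) = apolar G p + apolar G q" by (simp add: apolar_def lookup_add)
  show "apolar G (Const e * p) = e * apolar G p"
    by (simp add: apolar_def diff_action_mult diff_action_Const)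
  have "(\<Sum>a\<in>Poly_Mapping.keys (hom_comp d p). Poly_Mapping.lookup (hom_comp d p) a * deriv_coeff a a * Poly_Mapping.lookup G a) =
     (\<Sum>a\<in>Poly_Mapping.keys p. Poly_Mapping.lookup p a * deriv_coeff a a * Poly_Mapping.lookup G a)"
    using G by (intro sum.mono_neutral_cong_left)
      (auto simp: keys_hom_comp lookup_hom_comp homogeneous_iff when_def in_keys_iff)
  then show "apolar G (hom_comp d p) = apolar G p" by (simp add: apolar_def lookup_diff_action_0)
qed fact

text \<open>
  If \<open>p\<close> is in the radical, then all derivatives of \<open>P = p \<circ> G\<close> have constant term zero. The constant
  term of \<open>\<partial>\<^sup>a P\<close> is \<open>a!\<close> times a coefficient of \<open>P\<close>, and \<open>a!\<close> is invertible because \<open>P\<close> has degree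
  at most \<open>d\<close>.
\<close>

lemma Ann_eq_radical:
  fixes G :: "'k::field mpoly"
  assumes char: "CHAR('k) = 0 \<or> CHAR('k) > d" and G: "G \<in> homogeneous_polys m d"
    and gf: "graded_functional m d (apolar G)"
  shows "Ann m G = graded_functional.radical m (apolar G)"
proof -
  interpret graded_functional m d "apolar G" by (rule gf)
  show ?thesis
  proof (intro equalityI subsetI)
    fix p assume p: "p \<in> Ann m G"
    show "p \<in> radical"
    proof (rule in_radicalI)
      show "p \<in> carrier (poly_ring m)" using p by (simp add: Ann_def)
      fix q :: "'k mpoly"
      show "apolar G (p * q) = 0"
        using p by (simp add: apolar_def Ann_def mult.commute[of p] diff_action_mult)
    qed
  next
    fix p assume p: "p \<in> radical"
    let ?P = "diff_action p G"
    have "Poly_Mapping.lookup ?P a = 0" for a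
    proof (rule ccontr)
      assume "Poly_Mapping.lookup ?P a \<noteq> 0"
      then have a: "a \<in> Poly_Mapping.keys ?P" by (simp add: in_keys_iff)
      have keys: "Poly_Mapping.keys a \<subseteq> {..<m}"
        using a diff_action_polys[OF homogeneous_polys[OF G], of p] by (auto simp: in_polys_iff)
      obtain b e where be: "b \<in> Poly_Mapping.keys p" "e \<in> Poly_Mapping.keys G" "a = e - b" "deriv_coeff b e \<noteq> (0::'k)"
        using keys_diff_action[OF a] by blast
      have "e = b + (e - b)" using deriv_coeff_nonzero_le[OF be(4)] by (intro poly_mapping_eqI) (simp add: lookup_add lookup_minus)
      then have "mdeg e = mdeg b + mdeg a" using be(3) by (metis mdeg_add)
      moreover have "mdeg e = d" using G be(2) by (simp add: homogeneous_iff)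
      ultimately have "mdeg a \<le> d" by simp
      let ?q = "Poly_Mapping.single a (1::'k)"
      have "apolar G (p * ?q) = Poly_Mapping.lookup (diff_action ?q ?P) 0"
        by (simp add: apolar_def mult.commute[of p] diff_action_mult)
      also have "\<dots> = deriv_coeff a a * Poly_Mapping.lookup ?P a"
        by (simp add: lookup_diff_action_0)
      finally have "apolar G (p * ?q) = deriv_coeff a a * Poly_Mapping.lookup ?P a" .
      moreover have "apolar G (p * ?q) = 0" using p keys by (intro radicalD polys_single)
      moreover have "deriv_coeff a a \<noteq> (0::'k)" using char \<open>mdeg a \<le> d\<close> by (rule deriv_coeff_self_nonzero)
      ultimately show False using \<open>Poly_Mapping.lookup ?P a \<noteq> 0\<close> by simp
    qed
    then have "?P = 0" by (intro poly_mapping_eqI) simp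
    then show "p \<in> Ann m G" using p by (simp add: Ann_def)
  qed
qed

lemma ideal_Ann:
  fixes F :: "'k::field mpoly"
  shows "ideal (Ann n F) (poly_ring n)"
proof (rule idealI)
  interpret algebra "class_ring :: 'k ring" "poly_ring n :: ('k, 'k mpoly) module" by (rule algebra_poly_ring)
  show "ring (poly_ring n :: ('k, 'k mpoly) module)" using M_cring by (rule cring.axioms(1))
  show "subgroup (Ann n F) (add_monoid (poly_ring n))"
  proof (rule add.subgroupI)
    show "Ann n F \<noteq> {}" by (auto simp: Ann_def intro: exI[of _ 0])
    fix x assume x: "x \<in> Ann n F"
    have "\<ominus>\<^bsub>poly_ring n\<^esub> x = - x"
      using x by (intro minus_equality) (auto simp: Ann_def)
    then show "\<ominus>\<^bsub>poly_ring n\<^esub> x \<in> Ann n F"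
      using x diff_action_diff_left[of 0 x F] by (simp add: Ann_def)
    fix y assume "y \<in> Ann n F"
    then show "x \<oplus>\<^bsub>poly_ring n\<^esub> y \<in> Ann n F" using x by (simp add: Ann_def)
  qed (auto simp: Ann_def)
  fix a x :: "'k mpoly" assume "a \<in> Ann n F" "x \<in> carrier (poly_ring n)"
  then show "x \<otimes>\<^bsub>poly_ring n\<^esub> a \<in> Ann n F" "a \<otimes>\<^bsub>poly_ring n\<^esub> x \<in> Ann n F"
    by (simp_all add: Ann_def diff_action_mult mult.commute[of a x])
qed

section \<open>Dual generators under linear substitution\<close>

text \<open>
  The component \<open>A\<^sub>d\<close> lies in the socle, a line spanned by any \<open>w \<noteq> 0\<close> in \<open>A\<^sub>d\<close>. The functional is
  given by \<open>\<pi> s\<^sub>d = L s \<odot> w\<close>.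
\<close>

lemma top_degree_coordinate:
  fixes A :: "('k::field, 'a) module" (structure)
  assumes A: "artinian_gorenstein A gr" "has_socle_degree A gr d"
    and "poly_hom A m \<pi>" "\<And>i. \<pi> ` homogeneous_polys m i \<subseteq> gr i" and top: "\<pi> ` homogeneous_polys m d = gr d"
  obtains L where "graded_functional m d L"
    "\<And>s. s \<in> carrier (poly_ring m) \<Longrightarrow> L s = 0 \<longleftrightarrow> \<pi> (hom_comp d s) = \<zero>"
proof -
  interpret poly_hom A m \<pi> by fact
  have gr: "graded_algebra A gr" using A(1) by (simp add: artinian_gorenstein_def standard_graded_def)
  have "\<zero> \<in> gr d" by (rule graded_algebra_zero[OF gr])
  then obtain w where w: "w \<in> gr d" "w \<noteq> \<zero>" using A(2) by (auto simp: has_socle_degree_def)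
  have wC: "w \<in> carrier A" using w(1) graded_algebra_carrier[OF gr] by blast
  have "\<exists>k. x = k \<odot> w" if "x \<in> gr d" for x
    using that w by (intro socle_multiple[OF A(1)] top_degree_in_socle[OF gr A(2)])
  then have "\<forall>s. \<exists>k. s \<in> carrier (poly_ring m) \<longrightarrow> \<pi> (hom_comp d s) = k \<odot> w"
    using assms(4)[of d] hom_comp_homogeneous[of _ m d] by blast
  then obtain L where L: "\<And>s. s \<in> carrier (poly_ring m) \<Longrightarrow> \<pi> (hom_comp d s) = L s \<odot> w" by metis
  have zero: "k = 0" if "k \<odot> w = \<zero>" for k
  proof (rule ccontr)
    assume "k \<noteq> 0"
    then have "w = (inverse k * k) \<odot> w" using wC smult_one[of w] by simp
    also have "\<dots> = inverse k \<odot> (k \<odot> w)" using smult_assoc1[of "inverse k" k w] wC by simp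
    also have "\<dots> = \<zero>" using that smult_r_null[of "inverse k"] by simp
    finally show False using w(2) by simp
  qed
  have inj: "k = k'" if "k \<odot> w = k' \<odot> w" for k k'
  proof -
    have "(k + - k') \<odot> w = k \<odot> w \<oplus> \<ominus> (k' \<odot> w)"
      using smult_l_distr[of k "- k'" w] smult_l_minus[of k' w] wC by (simp add: class_ring_simps)
    then have "(k + - k') \<odot> w = \<zero>" using wC that by (simp add: M.r_neg)
    then show ?thesis using zero by fastforce
  qed
  show ?thesis
  proof (rule that)
    show "graded_functional m d L"
    proof
      fix p q :: "'k mpoly" and c assume p: "p \<in> carrier (poly_ring m)"
      show "L (Const c * p) = c * L p"
      proof (rule inj)
        have "L (Const c * p) \<odot> w = c \<odot> \<pi> (hom_comp d p)"
          using p L[of "Const c * p"] by (simp add: hom_smult)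
        also have "\<dots> = (c * L p) \<odot> w" using p wC smult_assoc1[of c "L p" w] L[of p] by simp
        finally show "L (Const c * p) \<odot> w = (c * L p) \<odot> w" .
      qed
      show "L (hom_comp d p) = L p"
      proof (rule inj)
        have "hom_comp d (hom_comp d p) = hom_comp d p"
          using hom_comp_of_homogeneous[OF hom_comp_homogeneous[OF p], of d d] by simp
        then show "L (hom_comp d p) \<odot> w = L p \<odot> w" using L[of p] L[of "hom_comp d p"] p by simp
      qed
      assume q: "q \<in> carrier (poly_ring m)"
      show "L (p + q) = L p + L q"
      proof (rule inj)
        have "L (p + q) \<odot> w = \<pi> (hom_comp d p) \<oplus> \<pi> (hom_comp d q)"
          using p q L[of "p + q"] by (simp add: hom_add)
        then show "L (p + q) \<odot> w = (L p + L q) \<odot> w"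
          using p q wC smult_l_distr[of "L p" "L q" w] L[of p] L[of q] by simp
      qed
    next
      obtain u where u: "u \<in> homogeneous_polys m d" "\<pi> u = w" using w(1) unfolding top[symmetric] by blast
      have "L u \<odot> w = \<pi> (hom_comp d u)" using L[of u] u(1) by simp
      also have "\<dots> = w" using u hom_comp_of_homogeneous[OF u(1), of d] by simp
      finally have "L u \<noteq> 0" using w(2) wC smult_l_null[of w] by auto
      then show "\<exists>u\<in>carrier (poly_ring m). L u \<noteq> 0" using u by auto
    qed
    show "L s = 0 \<longleftrightarrow> \<pi> (hom_comp d s) = \<zero>" if "s \<in> carrier (poly_ring m)" for s
      using that zero wC smult_l_null[of w] by (auto simp: L)
  qed
qed

lemma poly_hom_graded_iso:
  assumes h: "h \<in> graded_algebra_iso A gr Q grQ" and "poly_hom A m \<pi>" and Q: "algebra class_ring Q"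
  shows "poly_hom Q m (\<lambda>p. h (\<pi> p))"
    and "p \<in> carrier (poly_ring m) \<Longrightarrow> h (\<pi> p) = \<zero>\<^bsub>Q\<^esub> \<longleftrightarrow> \<pi> p = \<zero>\<^bsub>A\<^esub>"
proof -
  interpret poly_hom A m \<pi> by fact
  interpret Q: algebra class_ring Q by fact
  have iso: "h \<in> ring_iso A Q" and sm: "\<And>k a. a \<in> carrier A \<Longrightarrow> h (k \<odot>\<^bsub>A\<^esub> a) = k \<odot>\<^bsub>Q\<^esub> h a"
    using h by (auto simp: graded_algebra_iso_def)
  note hom = ring_iso_memE[OF iso]
  show hp: "poly_hom Q m (\<lambda>p. h (\<pi> p))"
    by unfold_locales (auto simp: hom_add hom_mult hom_Const hom sm)
  show "h (\<pi> p) = \<zero>\<^bsub>Q\<^esub> \<longleftrightarrow> \<pi> p = \<zero>\<^bsub>A\<^esub>" if "p \<in> carrier (poly_ring m)"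
  proof -
    have "h (\<pi> 0) = \<zero>\<^bsub>Q\<^esub>" by (rule poly_hom.hom_zero[OF hp])
    then have "h \<zero>\<^bsub>A\<^esub> = \<zero>\<^bsub>Q\<^esub>" by (simp add: hom_zero)
    then show ?thesis using hom(5) that inj_on_eq_iff[of h "carrier A" "\<pi> p" "\<zero>\<^bsub>A\<^esub>"] by (simp add: bij_betw_def)
  qed
qed

text \<open>
  The rows of \<open>M\<close> are linear forms \<open>l\<^sub>i\<close> whose classes modulo \<open>Ann(F)\<close> correspond to \<open>\<pi> y\<^sub>i\<close>, so that
  \<open>\<pi> p = 0\<close> means \<open>p(l) \<in> Ann(F)\<close>. By the chain rule, for \<open>p\<close> of degree \<open>d\<close> this means \<open>p \<circ> G = 0\<close>. So
  the apolar functional of \<open>G\<close> and \<open>L\<close> vanish on the same polynomials and have the same radical.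
\<close>

lemma substituted_dual_generator:
  fixes A :: "('k::field, 'a) module" (structure)
  assumes "poly_hom A m \<pi>" "graded_functional m d L"
    and L: "\<And>s. s \<in> carrier (poly_ring m) \<Longrightarrow> L s = 0 \<longleftrightarrow> \<pi> (hom_comp d s) = \<zero>"
    and var: "\<And>i. i < m \<Longrightarrow> \<pi> (Var i) \<in> gr 1"
    and indep: "\<And>c i. \<pi> (\<Sum>i<m. Const (c i) * Var i) = \<zero> \<Longrightarrow> i < m \<Longrightarrow> c i = 0"
    and char: "CHAR('k) = 0 \<or> CHAR('k) > d"
    and F: "macaulay_dual_generator n d F A gr"
  obtains G where "G \<in> homogeneous_polys m d" "obtained_by_linear_substitution m G n F"
    "Ann m G = graded_functional.radical m L"
proof -
  interpret poly_hom A m \<pi> by fact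
  interpret graded_functional m d L by fact
  let ?Q = "quotient_algebra (poly_ring n) (Ann n F)"
  have FH: "F \<in> homogeneous_polys n d" using F by (simp add: macaulay_dual_generator_def)
  have zero_Ann: "0 \<in> Ann n F" by (simp add: Ann_def)
  interpret Q: quotient_alg "poly_ring n :: ('k, 'k mpoly) module" "Ann n F"
    by (intro quotient_alg.intro algebra_poly_ring ideal_Ann)
  obtain h where h: "h \<in> graded_algebra_iso A gr ?Q (quotient_grading (poly_ring n) (homogeneous_polys n) (Ann n F))"
    using F unfolding macaulay_dual_generator_def by blast
  have hgr: "h ` gr 1 = (\<lambda>p. Ann n F +>\<^bsub>poly_ring n\<^esub> p) ` homogeneous_polys n 1"
    using h by (simp add: graded_algebra_iso_def quotient_grading_def)
  have "\<exists>l. l \<in> homogeneous_polys n 1 \<and> h (\<pi> (Var i)) = Ann n F +>\<^bsub>poly_ring n\<^esub> l" if "i < m" for i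
    using var[OF that] hgr by blast
  then obtain l where l: "\<And>i. i < m \<Longrightarrow> l i \<in> homogeneous_polys n 1"
      "\<And>i. i < m \<Longrightarrow> h (\<pi> (Var i)) = Ann n F +>\<^bsub>poly_ring n\<^esub> l i" by metis
  define M where "M = mat m n (\<lambda>(i, j). Poly_Mapping.lookup (l i) (Poly_Mapping.single j 1))"
  have M: "M \<in> carrier_mat m n" by (simp add: M_def)
  interpret lin: linear_substitution m n "\<lambda>i j. M $$ (i, j)" .
  have \<tau>: "lin.\<tau> i = l i" if "i < m" for i
  proof -
    have "lin.\<tau> i = (\<Sum>j<n. Const (Poly_Mapping.lookup (l i) (Poly_Mapping.single j 1)) * Var j)"
      unfolding lin.\<tau>_def using that by (intro sum.cong) (auto simp: M_def)
    then show ?thesis using homogeneous_1_eq[OF l(1)[OF that]] by simp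
  qed
  define G where "G = substitute lin.\<sigma> F"
  have GH: "G \<in> homogeneous_polys m d"
    unfolding G_def using lin.\<sigma>_homogeneous FH by (intro substitute_homogeneous) auto
  have hQ: "algebra class_ring ?Q" by (rule Q.algebra_quotient)
  have eq: "h (\<pi> p) = Ann n F +>\<^bsub>poly_ring n\<^esub> substitute lin.\<tau> p" if "p \<in> carrier (poly_ring m)" for p
    using poly_hom_graded_iso(1)[OF h poly_hom_axioms hQ] Q.poly_hom_quotient[OF lin.T.poly_hom_axioms] _ that
    by (rule poly_hom_unique) (simp add: l(2) lin.substitute_\<tau>_Var \<tau>)
  have ker: "\<pi> p = \<zero> \<longleftrightarrow> substitute lin.\<tau> p \<in> Ann n F" if "p \<in> carrier (poly_ring m)" for p
    using poly_hom_graded_iso(2)[OF h poly_hom_axioms hQ that] eq[OF that]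
      Q.coset_zero_iff[of "substitute lin.\<tau> p"] that
    by (simp add: quotient_algebra_simps(4))
  have top: "apolar G p = 0 \<longleftrightarrow> \<pi> p = \<zero>" if p: "p \<in> homogeneous_polys m d" for p
  proof -
    have pS: "p \<in> carrier (poly_ring m)" using p by simp
    have "apolar G p = 0 \<longleftrightarrow> diff_action p G = 0"
    proof -
      obtain e where e: "diff_action p G = Const e" using diff_action_same_degree[OF p GH] by blast
      then have "apolar G p = e" by (simp add: apolar_def Const_def)
      then show ?thesis using e by (metis Const_simps(1) apolar_def lookup_zero)
    qed
    also have "\<dots> \<longleftrightarrow> substitute lin.\<tau> p \<in> Ann n F"
      unfolding G_def lin.diff_action_substitute_top[OF p FH] Ann_def
      using lin.T.hom_closed[OF pS] by blast
    finally show ?thesis using ker[OF pS] by simp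
  qed
  obtain u where u: "u \<in> homogeneous_polys m d" "L u = 1" by (rule obtain_socle_generator)
  have L_top: "L p = 0 \<longleftrightarrow> \<pi> p = \<zero>" if "p \<in> homogeneous_polys m d" for p
    using L[of p] that hom_comp_of_homogeneous[OF that, of d] by simp
  have gf: "graded_functional m d (apolar G)"
  proof (rule graded_functional_apolar[OF GH])
    have "apolar G u \<noteq> 0" using top[OF u(1)] L_top[OF u(1)] u(2) by simp
    then show "\<exists>u\<in>carrier (poly_ring m). apolar G u \<noteq> 0" using u(1) by auto
  qed
  have "apolar G p = 0 \<longleftrightarrow> L p = 0" if p: "p \<in> carrier (poly_ring m)" for p
  proof -
    have "apolar G (hom_comp d p) = 0 \<longleftrightarrow> L (hom_comp d p) = 0"
      using top L_top hom_comp_homogeneous[OF p] by simp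
    then show ?thesis using graded_functional.L_hom_comp[OF gf p] L_hom_comp[OF p] by simp
  qed
  then have "graded_functional.radical m (apolar G) = radical"
    unfolding radical_def graded_functional.radical_def[OF gf] by auto
  then have Ann: "Ann m G = radical" using Ann_eq_radical[OF char GH gf] by simp
  have rank: "vec_space.rank m M = m"
  proof (rule vec_space.rank_eq_rows_if_rows_independent[OF M])
    fix x assume x: "x \<in> carrier_vec m" "\<And>j. j < n \<Longrightarrow> (\<Sum>i<m. x $ i * M $$ (i, j)) = 0"
    let ?p = "\<Sum>i<m. Const (x $ i) * Var i"
    have "substitute lin.\<tau> ?p = finsum (poly_ring n) (\<lambda>i. substitute lin.\<tau> (Const (x $ i) * Var i)) {..<m}"
      by (intro lin.T.hom_sum) auto
    also have "\<dots> = (\<Sum>i<m. substitute lin.\<tau> (Const (x $ i) * Var i))" by (intro finsum_poly_ring) auto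
    also have "\<dots> = (\<Sum>i<m. Const (x $ i) * lin.\<tau> i)"
      by (intro sum.cong) (auto simp: lin.T.hom_smult lin.substitute_\<tau>_Var)
    also have "\<dots> = (\<Sum>j<n. \<Sum>i<m. Const (x $ i * M $$ (i, j)) * Var j)"
      by (simp add: lin.\<tau>_def sum_distrib_left mult.assoc) (rule sum.swap)
    also have "\<dots> = (\<Sum>j<n. Const (\<Sum>i<m. x $ i * M $$ (i, j)) * Var j)"
    proof -
      have "Const (sum f X) = (\<Sum>x\<in>X. Const (f x))" for f :: "nat \<Rightarrow> 'k" and X
        by (induction X rule: infinite_finite_induct) auto
      then show ?thesis by (simp only: sum_distrib_right)
    qed
    also have "\<dots> = 0" using x(2) by simp
    finally have "substitute lin.\<tau> ?p = 0" .
    then have "substitute lin.\<tau> ?p \<in> Ann n F" using zero_Ann by (simp only:)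
    moreover have "?p \<in> carrier (poly_ring m)" by (rule polys_sum) simp
    ultimately have "\<pi> ?p = \<zero>" using ker by blast
    then have "x $ i = 0" if "i < m" for i using indep[of "\<lambda>i. x $ i"] that by blast
    then show "x = 0\<^sub>v m" using x(1) by (intro eq_vecI) (simp_all only: carrier_vecD index_zero_vec)
  qed
  then have "m \<le> n" using vec_space.rank_le_nc[OF M] by simp
  then have "obtained_by_linear_substitution m G n F"
    unfolding obtained_by_linear_substitution_def
    using M rank by (intro bexI[of _ M]) (auto simp: G_def lin.\<sigma>_def[abs_def])
  then show ?thesis using GH Ann by (intro that)
qed

theorem theorem20:
  fixes A :: "('k::field, 'a) module" and gr :: "nat \<Rightarrow> 'a set" and d :: nat
    and V :: "'a set" and B :: "('k, 'a) module" and grB :: "nat \<Rightarrow> 'a set"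
  assumes "artinian_gorenstein A gr" and "has_socle_degree A gr d"
    and "CHAR('k) = 0 \<or> CHAR('k) > d"
    and "subspace (class_ring :: 'k ring) V A" and "V \<subseteq> gr 1"
    and "B = A\<lparr>carrier := subalgebra_generated A V\<rparr>"
    and "grB = (\<lambda>i. carrier B \<inter> gr i)"
    and "grB d = gr d" and "gr d \<noteq> {\<zero>\<^bsub>A\<^esub>}"
  shows "(\<exists>b. gorenstein_quotient_ideal b B grB d) \<and>
    (\<forall>b. gorenstein_quotient_ideal b B grB d \<longrightarrow>
      (\<forall>n F. macaulay_dual_generator n d F A gr \<longrightarrow>
        (\<exists>m G. macaulay_dual_generator m d G
            (quotient_algebra B b) (quotient_grading B grB b) \<and>
          obtained_by_linear_substitution m G n F)))"
proof -
  have std: "standard_graded A gr" and gr: "graded_algebra A gr"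
    using assms(1) by (auto simp: artinian_gorenstein_def standard_graded_def)
  have alg: "algebra (class_ring :: 'k ring) A" and sub_gr: "\<And>i. subspace (class_ring :: 'k ring) (gr i) A"
    and gr_one: "\<one>\<^bsub>A\<^esub> \<in> gr 0" and gr_mult: "\<And>i j a b. a \<in> gr i \<Longrightarrow> b \<in> gr j \<Longrightarrow> a \<otimes>\<^bsub>A\<^esub> b \<in> gr (i + j)"
    using gr unfolding graded_algebra_def by blast+
  have fin: "vectorspace.fin_dim (class_ring :: 'k ring) (A\<lparr>carrier := gr 1\<rparr>)"
    using std by (simp add: standard_graded_def)
  obtain m :: nat and v where v: "\<And>i. i < m \<Longrightarrow> v i \<in> V"
    and gen: "\<And>x. x \<in> V \<Longrightarrow> \<exists>c :: nat \<Rightarrow> 'k. x = (\<Oplus>\<^bsub>A\<^esub>i\<in>{..<m}. c i \<odot>\<^bsub>A\<^esub> v i)"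
    and indep: "\<And>(c :: nat \<Rightarrow> 'k) i. (\<Oplus>\<^bsub>A\<^esub>i\<in>{..<m}. c i \<odot>\<^bsub>A\<^esub> v i) = \<zero>\<^bsub>A\<^esub> \<Longrightarrow> i < m \<Longrightarrow> c i = 0"
    by (rule subspace_basis[OF alg sub_gr fin assms(4,5)]) blast
  have vC: "v i \<in> carrier A" if "i < m" for i
    using v[OF that] assms(5) graded_algebra_carrier[OF gr] by blast
  let ?\<pi> = "eval_poly A m v"
  interpret poly_hom A m ?\<pi> by (rule poly_hom_eval_poly(1)[OF alg vC])
  have var: "?\<pi> (Var i) = v i" if "i < m" for i by (rule poly_hom_eval_poly(2)[OF alg vC that])
  have linear: "?\<pi> (\<Sum>i<m. Const (c i) * Var i) = (\<Oplus>\<^bsub>A\<^esub>i\<in>{..<m}. c i \<odot>\<^bsub>A\<^esub> v i)" for c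
  proof -
    have "?\<pi> (\<Sum>i<m. Const (c i) * Var i) = (\<Oplus>\<^bsub>A\<^esub>i\<in>{..<m}. ?\<pi> (Const (c i) * Var i))"
      by (intro hom_sum) auto
    also have "\<dots> = (\<Oplus>\<^bsub>A\<^esub>i\<in>{..<m}. c i \<odot>\<^bsub>A\<^esub> v i)"
      using vC by (intro finsum_cong') (auto simp: hom_smult var)
    finally show ?thesis .
  qed
  \<comment> \<open>From here on, \<open>B\<close> and its components are images of the polynomial ring.\<close>
  have V_range: "V \<subseteq> ?\<pi> ` carrier (poly_ring m)"
  proof
    fix x assume "x \<in> V"
    then obtain c where "x = (\<Oplus>\<^bsub>A\<^esub>i\<in>{..<m}. c i \<odot>\<^bsub>A\<^esub> v i)" using gen by blast
    then have "x = ?\<pi> (\<Sum>i<m. Const (c i) * Var i)" by (simp only: linear)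
    then show "x \<in> ?\<pi> ` carrier (poly_ring m)" by (rule image_eqI) (rule polys_sum, simp)
  qed
  have B: "B = A\<lparr>carrier := ?\<pi> ` carrier (poly_ring m)\<rparr>"
    using range_eq_subalgebra_generated[OF _ V_range] var v assms(6) by simp
  have hom_gr: "?\<pi> ` homogeneous_polys m i \<subseteq> gr i" for i
    using v var assms(5) by (intro hom_homogeneous sub_gr gr_one gr_mult) auto
  have grB: "grB i = ?\<pi> ` homogeneous_polys m i" for i
  proof (intro equalityI subsetI)
    fix x assume "x \<in> grB i"
    then obtain s where s: "s \<in> carrier (poly_ring m)" "x = ?\<pi> s" "?\<pi> s \<in> gr i"
      unfolding assms(7) B by auto
    have "x = ?\<pi> (hom_comp i s)" unfolding s(2) by (rule hom_component[OF gr hom_gr s(1,3), symmetric])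
    then show "x \<in> ?\<pi> ` homogeneous_polys m i" using hom_comp_homogeneous[OF s(1), of i] by (rule image_eqI)
  next
    fix x assume "x \<in> ?\<pi> ` homogeneous_polys m i"
    then obtain s where s: "s \<in> homogeneous_polys m i" "x = ?\<pi> s" by blast
    then have "x \<in> gr i" "x \<in> ?\<pi> ` carrier (poly_ring m)" using hom_gr[of i] by blast+
    then show "x \<in> grB i" unfolding assms(7) B by simp
  qed
  obtain L where gf: "graded_functional m d L"
    and L: "\<And>s. s \<in> carrier (poly_ring m) \<Longrightarrow> L s = 0 \<longleftrightarrow> ?\<pi> (hom_comp d s) = \<zero>\<^bsub>A\<^esub>"
    using top_degree_coordinate[OF assms(1,2) poly_hom_axioms hom_gr] grB[of d] assms(8) by metis
  interpret L: graded_functional m d L by (rule gf)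
  have ker: "s \<in> L.radical" if s: "s \<in> carrier (poly_ring m)" "?\<pi> s = \<zero>\<^bsub>A\<^esub>" for s
  proof (rule L.in_radicalI[OF s(1)])
    fix q :: "'k mpoly" assume q: "q \<in> carrier (poly_ring m)"
    have "?\<pi> (s * q) = \<zero>\<^bsub>A\<^esub>" using s q by (simp add: hom_mult)
    then show "L (s * q) = 0" using hom_component_zero[OF gr hom_gr, of "s * q" d] s q L by simp
  qed
  have zB: "\<zero>\<^bsub>B\<^esub> = \<zero>\<^bsub>A\<^esub>" by (simp add: B)
  interpret B: presented_functional B m ?\<pi> d L
  proof (intro presented_functional.intro presented_functional_axioms.intro gf)
    show "poly_hom B m ?\<pi>" unfolding B by (rule poly_hom_image)
    show "?\<pi> ` carrier (poly_ring m) = carrier B" by (simp add: B)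
    show "s \<in> carrier (poly_ring m) \<Longrightarrow> ?\<pi> s = \<zero>\<^bsub>B\<^esub> \<Longrightarrow> s \<in> L.radical" for s
      using ker zB by simp
  qed
  have grB': "grB = B.grB" using grB by auto
  show ?thesis
  proof (intro conjI allI impI)
    show "\<exists>b. gorenstein_quotient_ideal b B grB d"
      using B.gorenstein_quotient_radical unfolding grB' by blast
    fix b n F assume b: "gorenstein_quotient_ideal b B grB d" and F: "macaulay_dual_generator n d F A gr"
    interpret Q: quotient_alg B b
      using b by (intro quotient_alg.intro B.algebra_axioms)
        (simp add: gorenstein_quotient_ideal_def homogeneous_ideal_def)
    let ?C = "quotient_algebra B b" and ?\<psi> = "\<lambda>p. b +>\<^bsub>B\<^esub> ?\<pi> p"
    have grC: "quotient_grading B grB b = (\<lambda>i. ?\<psi> ` homogeneous_polys m i)"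
      by (rule ext) (simp add: quotient_grading_def grB image_image)
    have \<psi>: "poly_hom ?C m ?\<psi>" by (rule Q.poly_hom_quotient[OF B.poly_hom_axioms])
    have gor: "artinian_gorenstein ?C (\<lambda>i. ?\<psi> ` homogeneous_polys m i)"
      "has_socle_degree ?C (\<lambda>i. ?\<psi> ` homogeneous_polys m i) d"
      using b unfolding gorenstein_quotient_ideal_def grC by blast+
    \<comment> \<open>Whatever ideal \<open>b\<close> is given, the quotient has the same kernel in the polynomial ring.\<close>
    have ker_\<psi>: "?\<psi> s = \<zero>\<^bsub>?C\<^esub> \<longleftrightarrow> s \<in> L.radical" if "s \<in> carrier (poly_ring m)" for s
    proof (rule gorenstein_kernel_unique[OF \<psi> gf gor _ that])
      fix s :: "'k mpoly" assume s: "s \<in> homogeneous_polys m d" "L s = 0"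
      then have "?\<pi> s = \<zero>\<^bsub>B\<^esub>" using L[of s] hom_comp_of_homogeneous[OF s(1), of d] zB by simp
      then show "?\<psi> s = \<zero>\<^bsub>?C\<^esub>" using Q.coset_zero_iff[of "\<zero>\<^bsub>B\<^esub>"] by (simp add: quotient_algebra_simps(4))
    qed
    obtain G where G: "G \<in> homogeneous_polys m d" "obtained_by_linear_substitution m G n F"
      "Ann m G = L.radical"
    proof (rule substituted_dual_generator[OF poly_hom_axioms gf L _ _ assms(3) F])
      show "?\<pi> (Var i) \<in> gr 1" if "i < m" for i using that v var assms(5) by auto
      show "c i = 0" if "?\<pi> (\<Sum>i<m. Const (c i) * Var i) = \<zero>\<^bsub>A\<^esub>" "i < m" for c i
        using that indep unfolding linear by blast
    qed
    interpret P: quotient_alg "poly_ring m :: ('k, 'k mpoly) module" "Ann m G"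
      by (intro quotient_alg.intro algebra_poly_ring ideal_Ann)
    have "graded_algebra_iso ?C (quotient_grading B grB b)
      (quotient_algebra (poly_ring m) (Ann m G)) (quotient_grading (poly_ring m) (homogeneous_polys m) (Ann m G)) \<noteq> {}"
    proof (rule graded_algebra_iso_exists[OF \<psi> P.poly_hom_quotient[OF poly_hom_id]])
      show "?\<psi> ` carrier (poly_ring m) = carrier ?C"
        unfolding quotient_algebra_simps B.surj[symmetric] image_image ..
      show "(\<lambda>p. Ann m G +>\<^bsub>poly_ring m\<^esub> id p) ` carrier (poly_ring m) = carrier (quotient_algebra (poly_ring m) (Ann m G))"
        by (simp add: quotient_algebra_simps)
      show "?\<psi> p = \<zero>\<^bsub>?C\<^esub> \<longleftrightarrow> Ann m G +>\<^bsub>poly_ring m\<^esub> id p = \<zero>\<^bsub>quotient_algebra (poly_ring m) (Ann m G)\<^esub>"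
        if "p \<in> carrier (poly_ring m)" for p
        using ker_\<psi>[OF that] P.coset_zero_iff[OF that] by (simp add: quotient_algebra_simps(4) G(3))
    qed (simp_all add: grC quotient_grading_def)
    then have "macaulay_dual_generator m d G ?C (quotient_grading B grB b)"
      unfolding macaulay_dual_generator_def using gor G(1) unfolding grC by blast
    then show "\<exists>m G. macaulay_dual_generator m d G ?C (quotient_grading B grB b) \<and>
        obtained_by_linear_substitution m G n F"
      using G(2) by blast
  qed
qed

end
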